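(* Let $p\in(0,1)$ be a constant and let $H$ be a fixed finite simple graph with at least one edge. Let $X_n$ denote the number of copies of $H$ in $G(n,p)$, where the random graphs $G(n,p)$, $n\in\mathbb N$, are all obtained by restricting a single infinite random graph $G(\mathbb N,p)$ to the vertex sets $[n]=\{1,\dots,n\}$. Let $\mu_n=\mathbb E[X_n]$ and $\sigma_n^2=\mathrm{Var}(X_n)$. Then $$\Pr\left[\limsup_{n\to\infty}\frac{X_n-\mu_n}{\sigma_n\sqrt{2\log\log n}}=1\right]=1.$$
   Context: $G(\mathbb N,p)$ is the random graph on vertex set $\mathbb N=\{1,2,\dots\}$ in which each 2-element subset of $\mathbb N$ is an edge with probability $p$, independently. $G(n,p)$ is its induced subgraph on $[n]$, so that $(G(n,p))_{n\ge1}$ is a nested sequence defined on one probability space. A copy of $H$ in a graph $G$ is a (not necessarily induced) subgraph of $G$ isomorphic to $H$ (counting labeled copies instead multiplies $X_n$ by a constant and does not affect the statement). $\log$ is the natural logarithm. The ratio is considered only for $n$ large enough that $\sigma_n>0$ and $\log\log n>0$. *)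

theory Defs
  imports "HOL-Probability.Probability"
begin

type_synonym 'a graph = "'a set \<times> 'a set set"

abbreviation verts :: "'a graph \<Rightarrow> 'a set" where
  "verts G \<equiv> fst G"

abbreviation edges :: "'a graph \<Rightarrow> 'a set set" where
  "edges G \<equiv> snd G"

definition pairs :: "'a set \<Rightarrow> 'a set set" where
  "pairs V = {e. e \<subseteq> V \<and> card e = 2}"

text \<open>Simple graphs may be infinite; finiteness is a separate assumption where it is needed.\<close>

definition simple_graph :: "'a graph \<Rightarrow> bool" where
  "simple_graph G \<longleftrightarrow> edges G \<subseteq> pairs (verts G)"

definition subgraph :: "'a graph \<Rightarrow> 'a graph \<Rightarrow> bool" where
  "subgraph S G \<longleftrightarrow> simple_graph S \<and> verts S \<subseteq> verts G \<and> edges S \<subseteq> edges G"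

definition induced_subgraph :: "'a graph \<Rightarrow> 'a set \<Rightarrow> 'a graph" where
  "induced_subgraph G U = (verts G \<inter> U, {e \<in> edges G. e \<subseteq> U})"

definition isomorphic :: "'a graph \<Rightarrow> 'b graph \<Rightarrow> bool" where
  "isomorphic G H \<longleftrightarrow> (\<exists>f. bij_betw f (verts G) (verts H) \<and>
     (\<forall>x\<in>verts G. \<forall>y\<in>verts G. {x, y} \<in> edges G \<longleftrightarrow> {f x, f y} \<in> edges H))"

text \<open>Copies are unlabelled and not necessarily induced. A copy carries its vertex set, so copies
  that differ only in the placement of isolated vertices of \<open>H\<close> are counted separately.\<close>

definition copies :: "'a graph \<Rightarrow> 'b graph \<Rightarrow> 'b graph set" where
  "copies H G = {S. subgraph S G \<and> isomorphic S H}"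

text \<open>A realisation of \<open>G(\<nat>, p)\<close>, with \<open>\<nat> = {1, 2, \<dots>}\<close>, on an arbitrary probability space.
  Measurability of the edge events is part of \<open>indep_events\<close>.\<close>

locale infinite_random_graph = prob_space M
  for M :: "'w measure" +
  fixes p :: real and G :: "'w \<Rightarrow> nat graph"
  assumes simple: "\<And>\<omega>. \<omega> \<in> space M \<Longrightarrow> simple_graph (G \<omega>)"
    and verts_eq: "\<And>\<omega>. \<omega> \<in> space M \<Longrightarrow> verts (G \<omega>) = {1..}"
    and indep_edges: "indep_events (\<lambda>e. {\<omega> \<in> space M. e \<in> edges (G \<omega>)}) (pairs {1..})"
    and prob_edge: "\<And>e. e \<in> pairs {1..} \<Longrightarrow> prob {\<omega> \<in> space M. e \<in> edges (G \<omega>)} = p"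

definition copy_count :: "'a graph \<Rightarrow> ('w \<Rightarrow> nat graph) \<Rightarrow> nat \<Rightarrow> 'w \<Rightarrow> real" where
  "copy_count H G n \<omega> = real (card (copies H (induced_subgraph (G \<omega>) {1..n})))"

end

(* A centred copy indicator is split into its projection onto single edges and a rest. Summed over
all copies, the projections give a multiple of the centred edge count, because by symmetry every
edge of the complete graph lies in equally many copies. The rests are negligible: the expectation
of a product of four of them vanishes as soon as one copy shares at most two vertices with the other
three, so only quadruples spanning at most 4v - 6 vertices contribute, where v is the number of
vertices of H. The fourth moment of the sum is therefore O(n^(4v - 6)), while the standard deviation
of the linear part has order n^(v - 1); the summability of n^(-2) makes the rest negligible almost
surely by the first Borel-Cantelli lemma. What remains is the law of the iterated logarithm for the
edge count, a sum of n choose 2 independent variables. Its upper half uses an exponential maximal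
inequality along a geometric sequence of ratio close to 1, its lower half independent blocks between
powers of a large base and a lower tail bound obtained from the moment generating function alone. *)
theory Submission
  imports Defs "HOL-Real_Asymp.Real_Asymp"
begin

section \<open>Exponential moments and the second Borel--Cantelli lemma\<close>

text \<open>The law for the edge count is not read off from a law for single variables taken one by
  one: along an enumeration of the edges the counts for the graphs on [n] form a sparse subsequence
  of the partial sums, and the lower half of such a law says nothing about a subsequence. It is
  therefore proved directly for nested index sets that grow by a whole batch at each step. The lower
  half needs no normal approximation: a tail bound whose exponent is wrong by a factor 1 + O(1/b) is
  enough, since the threshold can be lowered by a comparable factor and the base b of the blocks is
  then taken large. This is why exponential moments known only up to a factor 1 +- \<epsilon> in the
  exponent suffice for both halves.\<close>

lemma exp_second_order_approx:
  fixes \<epsilon> :: real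
  assumes "\<epsilon> > 0"
  obtains \<delta> where "\<delta> > 0" "\<And>x::real. \<bar>x\<bar> \<le> \<delta> \<Longrightarrow> \<bar>exp x - (1 + x + x\<^sup>2 / 2)\<bar> \<le> \<epsilon> * x\<^sup>2"
proof -
  have "((\<lambda>x::real. (exp x - (1 + x + x\<^sup>2 / 2)) / x\<^sup>2) \<longlongrightarrow> 0) (at 0)"
    by real_asymp
  then obtain d where d: "d > 0"
    "\<And>x::real. x \<noteq> 0 \<Longrightarrow> \<bar>x\<bar> < d \<Longrightarrow> \<bar>(exp x - (1 + x + x\<^sup>2 / 2)) / x\<^sup>2\<bar> < \<epsilon>"
    using assms unfolding LIM_def dist_real_def by (metis diff_zero)
  show thesis
  proof (rule that[of "d / 2"])
    fix x :: real assume x: "\<bar>x\<bar> \<le> d / 2"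
    show "\<bar>exp x - (1 + x + x\<^sup>2 / 2)\<bar> \<le> \<epsilon> * x\<^sup>2"
    proof (cases "x = 0")
      case False
      then have "\<bar>(exp x - (1 + x + x\<^sup>2 / 2)) / x\<^sup>2\<bar> < \<epsilon>"
        using x d by (intro d(2)) auto
      then show ?thesis using False by (simp add: abs_divide divide_less_eq)
    qed simp
  qed (use d in simp)
qed

lemma (in prob_space) integrable_bounded:
  fixes f :: "'a \<Rightarrow> real"
  assumes "f \<in> borel_measurable M" "\<And>\<omega>. \<omega> \<in> space M \<Longrightarrow> \<bar>f \<omega>\<bar> \<le> B"
  shows "integrable M f"
  using assms by (intro integrable_const_bound[of _ B]) auto

text \<open>Integrating the second-order expansion of exp kills the linear term and leaves 1 + (1/2
  +- \<epsilon>/4) l^2. The point is uniformity: \<open>l0\<close> depends on \<epsilon> and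
  \<open>K\<close> alone, so one threshold serves all variables and later sums of any size.\<close>

lemma (in prob_space) mgf_bounds:
  fixes \<epsilon> K :: real
  assumes "0 < \<epsilon>" "\<epsilon> < 1"
  shows "\<exists>l0>0. \<forall>Y l. Y \<in> borel_measurable M \<longrightarrow> (\<forall>\<omega>\<in>space M. \<bar>Y \<omega>\<bar> \<le> K) \<longrightarrow>
    expectation Y = 0 \<longrightarrow> expectation (\<lambda>\<omega>. (Y \<omega>)\<^sup>2) = 1 \<longrightarrow> \<bar>l\<bar> \<le> l0 \<longrightarrow>
    exp ((1 - \<epsilon>) * (l\<^sup>2 / 2)) \<le> expectation (\<lambda>\<omega>. exp (l * Y \<omega>)) \<and>
    expectation (\<lambda>\<omega>. exp (l * Y \<omega>)) \<le> exp ((1 + \<epsilon>) * (l\<^sup>2 / 2))"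
proof -
  obtain \<delta> where \<delta>: "\<delta> > 0" "\<And>x::real. \<bar>x\<bar> \<le> \<delta> \<Longrightarrow> \<bar>exp x - (1 + x + x\<^sup>2 / 2)\<bar> \<le> \<epsilon> / 4 * x\<^sup>2"
    using exp_second_order_approx[of "\<epsilon> / 4"] assms by auto
  \<comment> \<open>The first entry keeps \<open>l * Y \<omega>\<close> within \<delta>, with the
    added 1 avoiding a division by zero; the other two give
    \<open>l\<^sup>2 \<le> \<epsilon>\<close>, which the lower bound needs.\<close>
  define l0 where "l0 = min (\<delta> / (\<bar>K\<bar> + 1)) (min 1 \<epsilon>)"
  have "l0 * (\<bar>K\<bar> + 1) \<le> \<delta> / (\<bar>K\<bar> + 1) * (\<bar>K\<bar> + 1)"
    by (intro mult_right_mono) (auto simp: l0_def)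
  then have l0: "l0 > 0" "l0 \<le> 1" "l0 \<le> \<epsilon>" "l0 * (\<bar>K\<bar> + 1) \<le> \<delta>"
    using assms \<delta> by (auto simp: l0_def add_nonneg_eq_0_iff)
  have main: "exp ((1 - \<epsilon>) * (l\<^sup>2 / 2)) \<le> expectation (\<lambda>\<omega>. exp (l * Y \<omega>)) \<and>
    expectation (\<lambda>\<omega>. exp (l * Y \<omega>)) \<le> exp ((1 + \<epsilon>) * (l\<^sup>2 / 2))"
    if Y[measurable]: "Y \<in> borel_measurable M" and YK: "\<forall>\<omega>\<in>space M. \<bar>Y \<omega>\<bar> \<le> K"
      and Y1: "expectation Y = 0" and Y2: "expectation (\<lambda>\<omega>. (Y \<omega>)\<^sup>2) = 1" and l: "\<bar>l\<bar> \<le> l0"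
    for Y :: "'a \<Rightarrow> real" and l
  proof -
    have lY: "\<bar>l * Y \<omega>\<bar> \<le> \<delta>" if "\<omega> \<in> space M" for \<omega>
    proof -
      have "\<bar>l * Y \<omega>\<bar> \<le> l0 * (\<bar>K\<bar> + 1)"
        unfolding abs_mult using l YK that l0(1) by (intro mult_mono) force+
      then show ?thesis using l0 by simp
    qed
    have iY: "integrable M Y" by (rule integrable_bounded[where B=K]) (use YK in auto)
    have iY2: "integrable M (\<lambda>\<omega>. (Y \<omega>)\<^sup>2)"
    proof (rule integrable_bounded[where B="K\<^sup>2"])
      fix \<omega> assume "\<omega> \<in> space M"
      then show "\<bar>(Y \<omega>)\<^sup>2\<bar> \<le> K\<^sup>2" using YK power_mono[of "\<bar>Y \<omega>\<bar>" K 2] by auto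
    qed simp
    have iE: "integrable M (\<lambda>\<omega>. exp (l * Y \<omega>))"
    proof (rule integrable_bounded[where B="exp \<delta>"])
      fix \<omega> assume "\<omega> \<in> space M"
      then show "\<bar>exp (l * Y \<omega>)\<bar> \<le> exp \<delta>" using lY by fastforce
    qed simp
    have quad: "expectation (\<lambda>\<omega>. 1 + l * Y \<omega> + c * (l\<^sup>2 * (Y \<omega>)\<^sup>2)) = 1 + c * l\<^sup>2" for c
      using iY iY2 Y1 Y2 by (simp add: prob_space)
    have iq: "integrable M (\<lambda>\<omega>. 1 + l * Y \<omega> + c * (l\<^sup>2 * (Y \<omega>)\<^sup>2))" for c
      using iY iY2 by simp
    have "expectation (\<lambda>\<omega>. exp (l * Y \<omega>)) \<le> expectation (\<lambda>\<omega>. 1 + l * Y \<omega> + (1/2 + \<epsilon>/4) * (l\<^sup>2 * (Y \<omega>)\<^sup>2))"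
    proof (intro integral_mono[OF iE iq])
      fix \<omega> assume "\<omega> \<in> space M"
      have "(1/2 + \<epsilon>/4) * (l\<^sup>2 * (Y \<omega>)\<^sup>2) = (l * Y \<omega>)\<^sup>2 / 2 + \<epsilon> / 4 * (l * Y \<omega>)\<^sup>2"
        by (simp add: power_mult_distrib distrib_right)
      with \<delta>(2)[OF lY[OF \<open>\<omega> \<in> space M\<close>]]
      show "exp (l * Y \<omega>) \<le> 1 + l * Y \<omega> + (1/2 + \<epsilon>/4) * (l\<^sup>2 * (Y \<omega>)\<^sup>2)"
        unfolding abs_le_iff by linarith
    qed
    also have "\<dots> = 1 + (1/2 + \<epsilon>/4) * l\<^sup>2" by (rule quad)
    also have "\<dots> \<le> 1 + (1 + \<epsilon>) * (l\<^sup>2 / 2)"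
      using assms by (simp add: algebra_simps)
    also have "\<dots> \<le> exp ((1 + \<epsilon>) * (l\<^sup>2 / 2))" by (rule exp_ge_add_one_self)
    finally have up: "expectation (\<lambda>\<omega>. exp (l * Y \<omega>)) \<le> exp ((1 + \<epsilon>) * (l\<^sup>2 / 2))" .
    define t where "t = l\<^sup>2 / 2"
    have "l\<^sup>2 \<le> l0\<^sup>2" using l power_mono[of "\<bar>l\<bar>" l0 2] by simp
    also have "l0\<^sup>2 \<le> \<epsilon> * 1" unfolding power2_eq_square using l0 assms by (intro mult_mono) auto
    finally have t: "0 \<le> t" "t \<le> \<epsilon> / 2" by (auto simp: t_def)
    have z: "0 \<le> (1 - \<epsilon>) * t" "(1 - \<epsilon>) * t \<le> t" using t assms by (auto simp: mult_left_le_one_le)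
    \<comment> \<open>The lower bound needs exp bounded from above. The quadratic error is at most
      (\<epsilon>/2) t because t is at most \<epsilon>/2, and (1 - \<epsilon>) t + (\<epsilon>/2) t
      is exactly (1/2 - \<epsilon>/4) l^2.\<close>
    have "exp ((1 - \<epsilon>) * t) \<le> 1 + (1 - \<epsilon>) * t + ((1 - \<epsilon>) * t)\<^sup>2"
      using z t assms by (intro exp_bound) auto
    also have "((1 - \<epsilon>) * t)\<^sup>2 \<le> t\<^sup>2" using z by (intro power_mono) auto
    also have "t\<^sup>2 \<le> (\<epsilon> / 2) * t" unfolding power2_eq_square using t by (intro mult_right_mono) auto
    finally have "exp ((1 - \<epsilon>) * t) \<le> 1 + (1 - \<epsilon>) * t + (\<epsilon> / 2) * t" by simp
    also have "\<dots> = 1 + (1/2 - \<epsilon>/4) * l\<^sup>2" by (simp add: t_def field_simps)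
    also have "\<dots> = expectation (\<lambda>\<omega>. 1 + l * Y \<omega> + (1/2 - \<epsilon>/4) * (l\<^sup>2 * (Y \<omega>)\<^sup>2))"
      by (rule quad[symmetric])
    also have "\<dots> \<le> expectation (\<lambda>\<omega>. exp (l * Y \<omega>))"
    proof (intro integral_mono[OF iq iE])
      fix \<omega> assume "\<omega> \<in> space M"
      have "(1/2 - \<epsilon>/4) * (l\<^sup>2 * (Y \<omega>)\<^sup>2) = (l * Y \<omega>)\<^sup>2 / 2 - \<epsilon> / 4 * (l * Y \<omega>)\<^sup>2"
        by (simp add: power_mult_distrib left_diff_distrib)
      with \<delta>(2)[OF lY[OF \<open>\<omega> \<in> space M\<close>]]
      show "1 + l * Y \<omega> + (1/2 - \<epsilon>/4) * (l\<^sup>2 * (Y \<omega>)\<^sup>2) \<le> exp (l * Y \<omega>)"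
        unfolding abs_le_iff by linarith
    qed
    finally show ?thesis using up by (simp add: t_def)
  qed
  show ?thesis by (intro exI[of _ l0] conjI[OF l0(1)] allI impI) (rule main)
qed

text \<open>\<open>F k\<close> is the complement of the event that is to recur. In this form
  independence is applied to intersections of the \<open>F k\<close> themselves, whose probability
  is at most exp of minus a partial sum of the divergent series; independence of complements is
  never derived.\<close>

lemma (in prob_space) second_borel_cantelli:
  fixes F :: "nat \<Rightarrow> 'a set"
  assumes ind: "indep_events F UNIV" and div: "\<not> summable (\<lambda>k. 1 - prob (F k))"
  shows "AE \<omega> in M. \<exists>\<^sub>F k in sequentially. \<omega> \<notin> F k"
proof -
  have Fm[measurable]: "F k \<in> events" for k using ind by (auto simp: indep_events_def)
  have zero: "prob (\<Inter>k\<in>{m..}. F k) = 0" for m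
  proof (rule antisym[OF _ measure_nonneg], rule field_le_epsilon)
    fix e :: real assume "e > 0"
    have "\<not> summable (\<lambda>k. 1 - prob (F (k + m)))"
      using div by (subst summable_iff_shift)
    then have "\<not> (\<forall>n. (\<Sum>k<n. 1 - prob (F (k + m))) \<le> - ln e)"
      using summableI_nonneg_bounded[of "\<lambda>k. 1 - prob (F (k + m))"] by auto
    then obtain n where n: "(\<Sum>k<n. 1 - prob (F (k + m))) > - ln e" by (auto simp: not_le)
    \<comment> \<open>Independence gives the product formula for nonempty index sets only. An empty
      range can occur only if e > 1, where the bound is trivial.\<close>
    have n0: "n > 0 \<or> e > 1" using n \<open>e > 0\<close> by (cases n) auto
    show "prob (\<Inter>k\<in>{m..}. F k) \<le> 0 + e"
    proof (cases "e > 1")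
      case True then show ?thesis using prob_le_1[of "\<Inter>k\<in>{m..}. F k"] by linarith
    next
      case False
      then have n0: "n > 0" using n0 by auto
      have "prob (\<Inter>k\<in>{m..}. F k) \<le> prob (\<Inter>k\<in>(\<lambda>k. k + m) ` {..<n}. F k)"
        using n0 by (intro finite_measure_mono) (auto intro!: sets.countable_INT')
      also have "\<dots> = (\<Prod>k\<in>(\<lambda>k. k + m) ` {..<n}. prob (F k))"
        using ind n0 by (intro indep_events_def[THEN iffD1, THEN conjunct2, rule_format]) auto
      also have "\<dots> = (\<Prod>k<n. prob (F (k + m)))"
        by (subst prod.reindex) (auto simp: o_def)
      also have "\<dots> \<le> (\<Prod>k<n. exp (- (1 - prob (F (k + m)))))"
      proof (rule prod_mono)
        fix i
        have "1 + - (1 - prob (F (i + m))) \<le> exp (- (1 - prob (F (i + m))))"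
          by (rule exp_ge_add_one_self)
        then show "0 \<le> prob (F (i + m)) \<and> prob (F (i + m)) \<le> exp (- (1 - prob (F (i + m))))" by simp
      qed
      also have "\<dots> = exp (- (\<Sum>k<n. 1 - prob (F (k + m))))"
        by (simp only: exp_sum[symmetric] finite_lessThan sum_negf)
      also have "\<dots> \<le> exp (ln e)" using n by simp
      finally show ?thesis using \<open>e > 0\<close> by simp
    qed
  qed
  have m: "(\<Inter>k\<in>{m..}. F k) \<in> events" for m by (intro sets.countable_INT') auto
  have "AE \<omega> in M. \<omega> \<notin> (\<Inter>k\<in>{m..}. F k)" for m
    using zero[of m] m[of m] prob_eq_0 by blast
  then have "AE \<omega> in M. \<forall>m. \<omega> \<notin> (\<Inter>k\<in>{m..}. F k)"
    by (simp add: AE_all_countable)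
  then show ?thesis
    by (rule AE_mp) (auto simp: frequently_sequentially)
qed

section \<open>Sums of bounded independent variables: exponential moments, maximal inequality, lower
  tail\<close>

locale bounded_independent = prob_space M for M :: "'w measure" +
  fixes \<eta> :: "'e \<Rightarrow> 'w \<Rightarrow> real" and I :: "'e set" and K :: real
  assumes indep: "indep_vars (\<lambda>_. borel) \<eta> I"
    and bounded: "\<And>e \<omega>. e \<in> I \<Longrightarrow> \<omega> \<in> space M \<Longrightarrow> \<bar>\<eta> e \<omega>\<bar> \<le> K"
    and mean_0: "\<And>e. e \<in> I \<Longrightarrow> expectation (\<eta> e) = 0"
    and variance_1: "\<And>e. e \<in> I \<Longrightarrow> expectation (\<lambda>\<omega>. (\<eta> e \<omega>)\<^sup>2) = 1"
begin

definition T :: "'e set \<Rightarrow> 'w \<Rightarrow> real" where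
  "T B \<omega> = (\<Sum>e\<in>B. \<eta> e \<omega>)"

lemma measurable_\<eta>: "e \<in> I \<Longrightarrow> \<eta> e \<in> borel_measurable M"
  using indep by (auto simp: indep_vars_def)

lemma measurable_T: "B \<subseteq> I \<Longrightarrow> T B \<in> borel_measurable M"
  unfolding T_def[abs_def] by (intro borel_measurable_sum measurable_\<eta>) auto

lemma T_bounded:
  assumes "B \<subseteq> I" "\<omega> \<in> space M"
  shows "\<bar>T B \<omega>\<bar> \<le> real (card B) * K"
proof -
  have "\<bar>T B \<omega>\<bar> \<le> (\<Sum>e\<in>B. \<bar>\<eta> e \<omega>\<bar>)" unfolding T_def by (rule sum_abs)
  also have "\<dots> \<le> real (card B) * K" using assms bounded by (intro sum_bounded_above) auto
  finally show ?thesis .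
qed

lemma exp_T_le:
  assumes "B \<subseteq> I" "\<omega> \<in> space M"
  shows "exp (l * T B \<omega>) \<le> exp (\<bar>l\<bar> * (real (card B) * K))"
proof -
  have "l * T B \<omega> \<le> \<bar>l\<bar> * \<bar>T B \<omega>\<bar>" by (metis abs_ge_self abs_mult)
  also have "\<dots> \<le> \<bar>l\<bar> * (real (card B) * K)" using T_bounded[OF assms] by (intro mult_left_mono) auto
  finally show ?thesis by simp
qed

lemma integrable_exp_T: "B \<subseteq> I \<Longrightarrow> integrable M (\<lambda>\<omega>. exp (l * T B \<omega>))"
  using measurable_T[of B] exp_T_le[of B]
  by (intro integrable_bounded[where B="exp (\<bar>l\<bar> * (real (card B) * K))"]) auto

lemma integrable_T: "B \<subseteq> I \<Longrightarrow> integrable M (T B)"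
  using measurable_T[of B] T_bounded[of B]
  by (intro integrable_bounded[where B="real (card B) * K"]) auto

lemma expectation_T: "B \<subseteq> I \<Longrightarrow> expectation (T B) = 0"
proof -
  assume B: "B \<subseteq> I"
  have "integrable M (\<eta> e)" if "e \<in> B" for e
    using B that bounded measurable_\<eta> by (intro integrable_bounded[where B=K]) auto
  then have "expectation (\<lambda>\<omega>. \<Sum>e\<in>B. \<eta> e \<omega>) = (\<Sum>e\<in>B. expectation (\<eta> e))"
    by (rule Bochner_Integration.integral_sum)
  then show ?thesis using B mean_0 by (simp add: T_def[abs_def] subset_iff)
qed

lemma expectation_exp_T_ge_1: "B \<subseteq> I \<Longrightarrow> expectation (\<lambda>\<omega>. exp (l * T B \<omega>)) \<ge> 1"
proof -
  assume B: "B \<subseteq> I"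
  have "1 = expectation (\<lambda>\<omega>. 1 + l * T B \<omega>)"
    using integrable_T[OF B] expectation_T[OF B] by (simp add: prob_space)
  also have "\<dots> \<le> expectation (\<lambda>\<omega>. exp (l * T B \<omega>))"
    using integrable_T[OF B] integrable_exp_T[OF B] by (intro integral_mono) auto
  finally show ?thesis .
qed

text \<open>Independence turns the exponential moment into a product over \<open>B\<close>; since
  the threshold for one variable is uniform, it does not shrink as \<open>B\<close> grows.\<close>

lemma mgf_T_bounds:
  fixes \<epsilon> :: real
  assumes "0 < \<epsilon>" "\<epsilon> < 1"
  shows "\<exists>l0>0. \<forall>B l. finite B \<longrightarrow> B \<subseteq> I \<longrightarrow> \<bar>l\<bar> \<le> l0 \<longrightarrow>
    exp ((1 - \<epsilon>) * l\<^sup>2 * card B / 2) \<le> expectation (\<lambda>\<omega>. exp (l * T B \<omega>)) \<and>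
    expectation (\<lambda>\<omega>. exp (l * T B \<omega>)) \<le> exp ((1 + \<epsilon>) * l\<^sup>2 * card B / 2)"
proof -
  obtain l0 where l0: "l0 > 0" "\<And>Y l. Y \<in> borel_measurable M \<Longrightarrow> (\<forall>\<omega>\<in>space M. \<bar>Y \<omega>\<bar> \<le> K) \<Longrightarrow>
    expectation Y = 0 \<Longrightarrow> expectation (\<lambda>\<omega>. (Y \<omega>)\<^sup>2) = 1 \<Longrightarrow> \<bar>l\<bar> \<le> l0 \<Longrightarrow>
    exp ((1 - \<epsilon>) * (l\<^sup>2 / 2)) \<le> expectation (\<lambda>\<omega>. exp (l * Y \<omega>)) \<and>
    expectation (\<lambda>\<omega>. exp (l * Y \<omega>)) \<le> exp ((1 + \<epsilon>) * (l\<^sup>2 / 2))"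
    using mgf_bounds[OF assms, of K] by (elim exE conjE) (rule that, auto)
  have "exp ((1 - \<epsilon>) * l\<^sup>2 * card B / 2) \<le> expectation (\<lambda>\<omega>. exp (l * T B \<omega>)) \<and>
    expectation (\<lambda>\<omega>. exp (l * T B \<omega>)) \<le> exp ((1 + \<epsilon>) * l\<^sup>2 * card B / 2)"
    if B: "finite B" "B \<subseteq> I" and l: "\<bar>l\<bar> \<le> l0" for B l
  proof -
    have b: "exp ((1 - \<epsilon>) * (l\<^sup>2 / 2)) \<le> expectation (\<lambda>\<omega>. exp (l * \<eta> e \<omega>)) \<and>
      expectation (\<lambda>\<omega>. exp (l * \<eta> e \<omega>)) \<le> exp ((1 + \<epsilon>) * (l\<^sup>2 / 2))" if "e \<in> B" for e
      using that B l bounded mean_0 variance_1 measurable_\<eta> by (intro l0(2)) auto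
    have i: "integrable M (\<lambda>\<omega>. exp (l * \<eta> e \<omega>))" if "e \<in> B" for e
      using integrable_exp_T[of "{e}" l] that B by (simp add: T_def subset_iff)
    have "indep_vars (\<lambda>_. borel) (\<lambda>e \<omega>. exp (l * \<eta> e \<omega>)) B"
      using indep_vars_subset[OF indep B(2)] by (rule indep_vars_compose2) simp
    then have "expectation (\<lambda>\<omega>. \<Prod>e\<in>B. exp (l * \<eta> e \<omega>)) = (\<Prod>e\<in>B. expectation (\<lambda>\<omega>. exp (l * \<eta> e \<omega>)))"
      using B i by (intro indep_vars_lebesgue_integral) auto
    moreover have "(\<lambda>\<omega>. \<Prod>e\<in>B. exp (l * \<eta> e \<omega>)) = (\<lambda>\<omega>. exp (l * T B \<omega>))"
      using B by (simp add: T_def exp_sum sum_distrib_left)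
    ultimately have e: "expectation (\<lambda>\<omega>. exp (l * T B \<omega>)) = (\<Prod>e\<in>B. expectation (\<lambda>\<omega>. exp (l * \<eta> e \<omega>)))"
      by simp
    have c: "exp (c * l\<^sup>2 * card B / 2) = (\<Prod>e\<in>B. exp (c * (l\<^sup>2 / 2)))" for c
    proof -
      have "c * l\<^sup>2 * card B / 2 = real (card B) * (c * (l\<^sup>2 / 2))" by simp
      then show ?thesis unfolding prod_constant by (simp only: exp_of_nat_mult)
    qed
    show ?thesis unfolding e c
      using b by (intro conjI prod_mono) (auto intro: order.trans[OF exp_ge_zero])
  qed
  note main = this
  show ?thesis by (intro exI[of _ l0] conjI[OF l0(1)] allI impI) (rule main)
qed

text \<open>The factors are functions on product spaces over \<open>B\<close> and \<open>C\<close>,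
  which makes explicit the coordinates they depend on. In the maximal inequality one of them carries
  a whole history of partial sums, the other the variables that come later.\<close>

lemma expectation_mult_disjoint:
  fixes f g :: "('e \<Rightarrow> real) \<Rightarrow> real"
  assumes "B \<subseteq> I" "C \<subseteq> I" "B \<inter> C = {}"
    and f: "f \<in> borel_measurable (PiM B (\<lambda>_. borel))" and g: "g \<in> borel_measurable (PiM C (\<lambda>_. borel))"
    and "integrable M (\<lambda>\<omega>. f (restrict (\<lambda>e. \<eta> e \<omega>) B))"
    and "integrable M (\<lambda>\<omega>. g (restrict (\<lambda>e. \<eta> e \<omega>) C))"
  shows "expectation (\<lambda>\<omega>. f (restrict (\<lambda>e. \<eta> e \<omega>) B) * g (restrict (\<lambda>e. \<eta> e \<omega>) C)) =
    expectation (\<lambda>\<omega>. f (restrict (\<lambda>e. \<eta> e \<omega>) B)) * expectation (\<lambda>\<omega>. g (restrict (\<lambda>e. \<eta> e \<omega>) C))"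
  using indep_var_compose[OF indep_var_restrict[OF indep assms(3,1,2)] f g] assms
  by (intro indep_var_lebesgue_integral) (auto simp: o_def)

text \<open>Split according to the first index j at which the level x is reached. On that event exp
  of l times the sum is at least exp (l x), and the increment from j to N is independent of it with
  exponential moment at least 1, so the event contributes at least exp (l x) times its probability
  to the moment at N. This is Doob's inequality for the exponential submartingale, with steps that
  may add many variables at once.\<close>

lemma maximal_inequality:
  fixes A :: "nat \<Rightarrow> 'e set"
  assumes A: "\<And>n. A n \<subseteq> I" "\<And>n. finite (A n)" and mono: "mono A" and l: "l \<ge> 0"
  shows "prob {\<omega> \<in> space M. \<exists>n\<le>N. T (A n) \<omega> \<ge> x} \<le>
    exp (- l * x) * expectation (\<lambda>\<omega>. exp (l * T (A N) \<omega>))"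
proof -
  define F where "F j = {\<omega> \<in> space M. T (A j) \<omega> \<ge> x \<and> (\<forall>i<j. T (A i) \<omega> < x)}" for j
  have [measurable]: "T (A n) \<in> borel_measurable M" for n by (rule measurable_T[OF A(1)])
  have F[measurable]: "F j \<in> events" for j unfolding F_def by measurable
  have eq: "{\<omega> \<in> space M. \<exists>n\<le>N. T (A n) \<omega> \<ge> x} = (\<Union>j\<le>N. F j)"
  proof (intro equalityI subsetI)
    fix \<omega> assume "\<omega> \<in> {\<omega> \<in> space M. \<exists>n\<le>N. T (A n) \<omega> \<ge> x}"
    then obtain n where n: "\<omega> \<in> space M" "n \<le> N" "T (A n) \<omega> \<ge> x" by auto
    define j where "j = (LEAST n. T (A n) \<omega> \<ge> x)"
    have "T (A j) \<omega> \<ge> x" unfolding j_def by (rule LeastI) (fact n)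
    moreover have "j \<le> n" unfolding j_def by (rule Least_le) (fact n)
    moreover have "T (A i) \<omega> < x" if "i < j" for i using not_less_Least[of i] that by (force simp: j_def)
    ultimately show "\<omega> \<in> (\<Union>j\<le>N. F j)" using n by (auto simp: F_def)
  qed (auto simp: F_def)
  have disj: "disjoint_family_on F {..N}"
    unfolding disjoint_family_on_def F_def by (auto simp: not_less) (metis linorder_neqE_nat not_less)
  have step: "exp (l * x) * prob (F j) \<le> expectation (\<lambda>\<omega>. exp (l * T (A N) \<omega>) * indicator (F j) \<omega>)"
    if j: "j \<le> N" for j
  proof -
    \<comment> \<open>\<open>f\<close> encodes the event \<open>F j\<close> through the coordinates
      in \<open>A j\<close> alone, which is possible because the earlier index sets are contained in
      \<open>A j\<close>; \<open>g\<close> uses the coordinates in \<open>A N - A j\<close>.\<close>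
    define f where "f y = exp (l * (\<Sum>e\<in>A j. y e)) *
      of_bool ((\<Sum>e\<in>A j. y e) \<ge> x \<and> (\<forall>i<j. (\<Sum>e\<in>A i. y e) < x))" for y :: "'e \<Rightarrow> real"
    define g where "g y = exp (l * (\<Sum>e\<in>A N - A j. y e))" for y :: "'e \<Rightarrow> real"
    have sub: "A i \<subseteq> A j" if "i \<le> j" for i j using mono that by (rule monoD)
    have cm: "(\<lambda>y. y e :: real) \<in> borel_measurable (PiM B (\<lambda>_. borel))" if "e \<in> B" for e :: 'e and B
      using that by simp
    have fm: "f \<in> borel_measurable (PiM (A j) (\<lambda>_. borel))"
    proof -
      have [measurable]: "(\<lambda>y. \<Sum>e\<in>A i. y e :: real) \<in> borel_measurable (PiM (A j) (\<lambda>_. borel))" if "i \<le> j" for i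
        by (rule borel_measurable_sum[where f="\<lambda>e y. y e"], rule cm) (use sub[OF that] in auto)
      have [measurable]: "(\<lambda>y. \<Sum>e\<in>A j. y e :: real) \<in> borel_measurable (PiM (A j) (\<lambda>_. borel))"
        by (rule borel_measurable_sum[where f="\<lambda>e y. y e"], rule cm)
      have [measurable]: "Measurable.pred (PiM (A j) (\<lambda>_. borel)) (\<lambda>y. \<forall>i\<in>{..<j}. (\<Sum>e\<in>A i. y e :: real) < x)"
        by (intro pred_intros_finite) (auto intro!: borel_measurable_pred_less)
      show ?thesis unfolding f_def[abs_def] Ball_def[symmetric] lessThan_iff[symmetric] by measurable
    qed
    have gm: "g \<in> borel_measurable (PiM (A N - A j) (\<lambda>_. borel))"
      unfolding g_def[abs_def]
      by (intro borel_measurable_exp[THEN measurable_compose[rotated]] borel_measurable_times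
          borel_measurable_const borel_measurable_sum cm)
    have fe: "f (restrict (\<lambda>e. \<eta> e \<omega>) (A j)) = exp (l * T (A j) \<omega>) * indicator (F j) \<omega>"
      if "\<omega> \<in> space M" for \<omega>
    proof -
      have "(\<Sum>e\<in>A i. restrict (\<lambda>e. \<eta> e \<omega>) (A j) e) = T (A i) \<omega>" if "i \<le> j" for i
        unfolding T_def using sub[OF that] by (intro sum.cong) auto
      then have "f (restrict (\<lambda>e. \<eta> e \<omega>) (A j)) = exp (l * T (A j) \<omega>) *
          of_bool (x \<le> T (A j) \<omega> \<and> (\<forall>i<j. T (A i) \<omega> < x))"
        unfolding f_def by (simp only: order_refl less_imp_le cong: imp_cong)
      then show ?thesis using that by (simp add: F_def indicator_def)
    qed
    have ge: "g (restrict (\<lambda>e. \<eta> e \<omega>) (A N - A j)) = exp (l * T (A N - A j) \<omega>)" for \<omega>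
      unfolding g_def T_def by (intro arg_cong[where f="\<lambda>s. exp (l * s)"] sum.cong) auto
    have s1: "A N - A j \<subseteq> I" using A by blast
    have i1: "integrable M (\<lambda>\<omega>. exp (l * T (A j) \<omega>) * indicator (F j) \<omega>)"
      by (rule integrable_real_mult_indicator[OF F integrable_exp_T[OF A(1)]])
    have i1': "integrable M (\<lambda>\<omega>. f (restrict (\<lambda>e. \<eta> e \<omega>) (A j)))"
      using i1 by (subst Bochner_Integration.integrable_cong[OF refl fe])
    have nonneg: "0 \<le> expectation (\<lambda>\<omega>. exp (l * T (A j) \<omega>) * indicator (F j) \<omega>)"
      by (intro Bochner_Integration.integral_nonneg) auto
    have "exp (l * x) * prob (F j) = expectation (\<lambda>\<omega>. exp (l * x) * indicator (F j) \<omega>)"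
      using F by simp
    also have "\<dots> \<le> expectation (\<lambda>\<omega>. exp (l * T (A j) \<omega>) * indicator (F j) \<omega>)"
    proof (rule integral_mono[OF _ i1])
      show "exp (l * x) * indicator (F j) \<omega> \<le> exp (l * T (A j) \<omega>) * indicator (F j) \<omega>"
        if "\<omega> \<in> space M" for \<omega>
        using l by (auto simp: indicator_def F_def intro: mult_left_mono)
    qed (intro integrable_mult_right integrable_real_indicator, auto simp: emeasure_eq_measure)
    also have "\<dots> \<le> expectation (\<lambda>\<omega>. exp (l * T (A j) \<omega>) * indicator (F j) \<omega>) *
        expectation (\<lambda>\<omega>. exp (l * T (A N - A j) \<omega>))"
      using mult_left_mono[OF expectation_exp_T_ge_1[OF s1, of l] nonneg] by simp
    also have "\<dots> = expectation (\<lambda>\<omega>. f (restrict (\<lambda>e. \<eta> e \<omega>) (A j))) *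
        expectation (\<lambda>\<omega>. g (restrict (\<lambda>e. \<eta> e \<omega>) (A N - A j)))"
      unfolding ge by (intro arg_cong2[where f=times] Bochner_Integration.integral_cong refl fe[symmetric])
    also have "\<dots> = expectation (\<lambda>\<omega>. f (restrict (\<lambda>e. \<eta> e \<omega>) (A j)) * g (restrict (\<lambda>e. \<eta> e \<omega>) (A N - A j)))"
      by (rule expectation_mult_disjoint[OF A(1) s1 _ fm gm i1', symmetric]) (auto simp only: ge integrable_exp_T[OF s1])
    also have "\<dots> = expectation (\<lambda>\<omega>. exp (l * T (A N) \<omega>) * indicator (F j) \<omega>)"
    proof (intro Bochner_Integration.integral_cong refl)
      fix \<omega> assume "\<omega> \<in> space M"
      have "T (A N) \<omega> = T (A N - A j) \<omega> + T (A j) \<omega>"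
        unfolding T_def using sum.subset_diff[OF sub[OF j] A(2)] by metis
      then show "f (restrict (\<lambda>e. \<eta> e \<omega>) (A j)) * g (restrict (\<lambda>e. \<eta> e \<omega>) (A N - A j)) =
          exp (l * T (A N) \<omega>) * indicator (F j) \<omega>"
        using \<open>\<omega> \<in> space M\<close> by (simp add: fe ge exp_add[symmetric] algebra_simps)
    qed
    finally show ?thesis .
  qed
  have "exp (l * x) * prob (\<Union>j\<le>N. F j) = (\<Sum>j\<le>N. exp (l * x) * prob (F j))"
    using disj F by (subst finite_measure_finite_Union) (auto simp: sum_distrib_left)
  also have "\<dots> \<le> (\<Sum>j\<le>N. expectation (\<lambda>\<omega>. exp (l * T (A N) \<omega>) * indicator (F j) \<omega>))"
    using step by (intro sum_mono) auto
  also have "\<dots> = expectation (\<lambda>\<omega>. \<Sum>j\<le>N. exp (l * T (A N) \<omega>) * indicator (F j) \<omega>)"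
    by (rule Bochner_Integration.integral_sum[symmetric], rule integrable_real_mult_indicator[OF F integrable_exp_T[OF A(1)]])
  also have "\<dots> \<le> expectation (\<lambda>\<omega>. exp (l * T (A N) \<omega>))"
  proof (intro integral_mono Bochner_Integration.integrable_sum integrable_real_mult_indicator[OF F] integrable_exp_T A(1))
    fix \<omega> assume "\<omega> \<in> space M"
    have "(\<Sum>j\<le>N. exp (l * T (A N) \<omega>) * indicator (F j) \<omega>) = exp (l * T (A N) \<omega>) * indicator (\<Union>j\<le>N. F j) \<omega>"
      using disj by (subst indicator_UN_disjoint) (auto simp: sum_distrib_left)
    also have "\<dots> \<le> exp (l * T (A N) \<omega>)" by (simp add: indicator_def)
    finally show "(\<Sum>j\<le>N. exp (l * T (A N) \<omega>) * indicator (F j) \<omega>) \<le> exp (l * T (A N) \<omega>)" .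
  qed
  finally have "exp (l * x) * prob (\<Union>j\<le>N. F j) \<le> expectation (\<lambda>\<omega>. exp (l * T (A N) \<omega>))" .
  then have "exp (- l * x) * (exp (l * x) * prob (\<Union>j\<le>N. F j)) \<le> exp (- l * x) * expectation (\<lambda>\<omega>. exp (l * T (A N) \<omega>))"
    by (intro mult_left_mono) auto
  then show ?thesis unfolding eq by (simp add: mult.assoc[symmetric] exp_add[symmetric])
qed

text \<open>Most of the exponential moment at \<open>l\<close> comes from values of the sum near \<open>l * card B\<close>: the
  moments at \<open>(1 + \<beta>) * l\<close> and \<open>(1 - \<beta>) * l\<close> bound the contributions from above and from below.\<close>

lemma lower_tail:
  fixes \<beta> :: real
  assumes \<beta>: "0 < \<beta>" "\<beta> < 1"
  shows "\<exists>l0>0. \<forall>B (l::real). finite B \<longrightarrow> B \<subseteq> I \<longrightarrow> 0 < l \<longrightarrow> l \<le> l0 \<longrightarrow> 8 \<le> l\<^sup>2 * card B * \<beta>\<^sup>2 \<longrightarrow>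
    exp (- ((1/2 + 2 * \<beta>) * (l\<^sup>2 * card B))) / 2 \<le> prob {\<omega> \<in> space M. T B \<omega> \<ge> (1 - \<beta>) * l * card B}"
proof -
  \<comment> \<open>With V = l^2 card B, tilting to (1 + \<beta>) l or (1 - \<beta>) l lowers the
    exponent by V \<beta>^2 / 2, while the errors in the three exponential moments cost at most V (2
    \<epsilon> + \<epsilon>/2) = V \<beta>^2 / 4. The net gain V \<beta>^2 / 4 is at least 2 by the
    hypothesis with the constant 8, and exp (-2) is at most 1/4.\<close>
  define \<epsilon> where "\<epsilon> = \<beta>\<^sup>2 / 10"
  have \<beta>2: "0 < \<beta>\<^sup>2" "\<beta>\<^sup>2 \<le> \<beta>" using \<beta> by (auto simp: power2_eq_square mult_left_le_one_le)
  have \<epsilon>: "0 < \<epsilon>" "\<epsilon> < 1" using \<beta>2 \<beta> by (auto simp: \<epsilon>_def)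
  obtain l1 where l1: "l1 > 0" "\<And>B l. finite B \<Longrightarrow> B \<subseteq> I \<Longrightarrow> \<bar>l\<bar> \<le> l1 \<Longrightarrow>
    exp ((1 - \<epsilon>) * l\<^sup>2 * card B / 2) \<le> expectation (\<lambda>\<omega>. exp (l * T B \<omega>)) \<and>
    expectation (\<lambda>\<omega>. exp (l * T B \<omega>)) \<le> exp ((1 + \<epsilon>) * l\<^sup>2 * card B / 2)"
    using mgf_T_bounds[OF \<epsilon>] by (elim exE conjE) (rule that, auto)
  have main: "exp (- ((1/2 + 2 * \<beta>) * (l\<^sup>2 * card B))) / 2 \<le> prob {\<omega> \<in> space M. T B \<omega> \<ge> (1 - \<beta>) * l * card B}"
    if B: "finite B" "B \<subseteq> I" and l: "0 < l" "l \<le> l1 / 2" and large: "8 \<le> l\<^sup>2 * card B * \<beta>\<^sup>2" for B and l :: real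
  proof -
    define V where "V = l\<^sup>2 * real (card B)"
    define x y where "x = (1 - \<beta>) * l * card B" and "y = (1 + \<beta>) * l * card B"
    define E where "E = {\<omega> \<in> space M. T B \<omega> \<ge> x}"
    have V: "8 \<le> V * \<beta>\<^sup>2" "V \<ge> 0" using large by (auto simp: V_def)
    have [measurable]: "T B \<in> borel_measurable M" by (rule measurable_T[OF B(2)])
    have [measurable]: "E \<in> events" unfolding E_def by measurable
    have lx: "l * x = (1 - \<beta>) * V" and ly: "l * y = (1 + \<beta>) * V"
      by (simp_all add: x_def y_def V_def power2_eq_square)
    \<comment> \<open>The threshold \<open>l1\<close> is halved so that the larger tilt, which is
      below 2 l, still lies in the range of the moment bounds.\<close>
    have m: "\<bar>(1 + \<beta>) * l\<bar> \<le> l1" "\<bar>(1 - \<beta>) * l\<bar> \<le> l1" "\<bar>l\<bar> \<le> l1"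
    proof -
      have "(1 + \<beta>) * l \<le> 2 * (l1 / 2)" "(1 - \<beta>) * l \<le> 1 * (l1 / 2)"
        using \<beta> l by (intro mult_mono; simp)+
      then show "\<bar>(1 + \<beta>) * l\<bar> \<le> l1" "\<bar>(1 - \<beta>) * l\<bar> \<le> l1" "\<bar>l\<bar> \<le> l1" using \<beta> l l1(1) by auto
    qed
    have e8: "exp (- 2 :: real) \<le> 1/4"
    proof -
      have "(2::real) * 2 \<le> exp 1 * exp 1" using exp_ge_add_one_self[of "1::real"] by (intro mult_mono) auto
      also have "exp 1 * exp 1 = exp (2::real)" by (simp add: exp_add[symmetric])
      finally show ?thesis by (simp add: exp_minus field_simps)
    qed
    have b2: "(1 - \<beta>)\<^sup>2 \<le> 1" "(1 + \<beta>)\<^sup>2 \<le> 4"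
      using \<beta> power_mono[of "1 - \<beta>" 1 2] power_mono[of "1 + \<beta>" 2 2] by auto
    have small: "exp (c + V * (1/2 - \<beta>\<^sup>2/2 + \<epsilon> * s / 2)) \<le> exp (c + (1 - \<epsilon>) * V / 2) / 4"
      if "s \<le> 4" for s c
    proof -
      have "V * (1/2 - \<beta>\<^sup>2/2 + \<epsilon> * s / 2) \<le> V * (1/2 - \<beta>\<^sup>2/2 + \<epsilon> * 4 / 2)"
        using that V \<epsilon> by (intro mult_left_mono add_left_mono divide_right_mono) auto
      also have "\<dots> = (1 - \<epsilon>) * V / 2 - V * \<beta>\<^sup>2 / 4" by (simp add: \<epsilon>_def field_simps)
      also have "\<dots> \<le> (1 - \<epsilon>) * V / 2 - 2" using V by simp
      finally have "exp (c + V * (1/2 - \<beta>\<^sup>2/2 + \<epsilon> * s / 2)) \<le> exp ((c + (1 - \<epsilon>) * V / 2) + - 2)" by simp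
      also have "\<dots> = exp (c + (1 - \<epsilon>) * V / 2) * exp (- 2)" by (rule exp_add)
      also have "\<dots> \<le> exp (c + (1 - \<epsilon>) * V / 2) * (1/4)" using e8 by (intro mult_left_mono) auto
      finally show ?thesis by simp
    qed
    define a where "a = exp ((1 - \<epsilon>) * V / 2)"
    have t1: "exp (- \<beta> * (l * y)) * expectation (\<lambda>\<omega>. exp ((1 + \<beta>) * l * T B \<omega>)) \<le> a / 4"
    proof -
      have "expectation (\<lambda>\<omega>. exp ((1 + \<beta>) * l * T B \<omega>)) \<le> exp ((1 + \<epsilon>) * ((1 + \<beta>) * l)\<^sup>2 * card B / 2)"
        using l1(2)[OF B m(1)] by simp
      also have "(1 + \<epsilon>) * ((1 + \<beta>) * l)\<^sup>2 * card B / 2 = (1 + \<epsilon>) * (1 + \<beta>)\<^sup>2 * V / 2"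
        by (simp add: V_def power_mult_distrib)
      finally have "exp (- \<beta> * (l * y)) * expectation (\<lambda>\<omega>. exp ((1 + \<beta>) * l * T B \<omega>)) \<le>
          exp (- \<beta> * (l * y)) * exp ((1 + \<epsilon>) * (1 + \<beta>)\<^sup>2 * V / 2)" by (intro mult_left_mono) auto
      also have "\<dots> = exp (0 + V * (1/2 - \<beta>\<^sup>2/2 + \<epsilon> * (1 + \<beta>)\<^sup>2 / 2))"
        unfolding ly exp_add[symmetric] by (rule arg_cong[where f=exp]) (simp add: field_simps power2_eq_square)
      also have "\<dots> \<le> a / 4" using small[OF b2(2), of 0] by (simp add: a_def)
      finally show ?thesis .
    qed
    have t2: "exp (\<beta> * (l * x)) * expectation (\<lambda>\<omega>. exp ((1 - \<beta>) * l * T B \<omega>)) \<le> a / 4"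
    proof -
      have "expectation (\<lambda>\<omega>. exp ((1 - \<beta>) * l * T B \<omega>)) \<le> exp ((1 + \<epsilon>) * ((1 - \<beta>) * l)\<^sup>2 * card B / 2)"
        using l1(2)[OF B m(2)] by simp
      also have "(1 + \<epsilon>) * ((1 - \<beta>) * l)\<^sup>2 * card B / 2 = (1 + \<epsilon>) * (1 - \<beta>)\<^sup>2 * V / 2"
        by (simp add: V_def power_mult_distrib)
      finally have "exp (\<beta> * (l * x)) * expectation (\<lambda>\<omega>. exp ((1 - \<beta>) * l * T B \<omega>)) \<le>
          exp (\<beta> * (l * x)) * exp ((1 + \<epsilon>) * (1 - \<beta>)\<^sup>2 * V / 2)" by (intro mult_left_mono) auto
      also have "\<dots> = exp (0 + V * (1/2 - \<beta>\<^sup>2/2 + \<epsilon> * (1 - \<beta>)\<^sup>2 / 2))"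
        unfolding lx exp_add[symmetric] by (rule arg_cong[where f=exp]) (simp add: field_simps power2_eq_square)
      also have "\<dots> \<le> a / 4" using small[of "(1 - \<beta>)\<^sup>2" 0] b2 by (simp add: a_def)
      finally show ?thesis .
    qed
    \<comment> \<open>Below x the factor exp (\<beta> l (x - T)) is at least 1 and may be inserted,
      above y the factor exp (\<beta> l (T - y)); in between the integrand is at most exp (l y). The
      outer terms use up a/4 each, so half of \<open>a\<close> remains for the event
      \<open>E\<close>.\<close>
    have "a \<le> expectation (\<lambda>\<omega>. exp (l * T B \<omega>))"
      using l1(2)[OF B m(3)] by (simp add: a_def V_def mult.assoc)
    also have "\<dots> \<le> expectation (\<lambda>\<omega>. exp (- \<beta> * (l * y)) * exp ((1 + \<beta>) * l * T B \<omega>) +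
        exp (\<beta> * (l * x)) * exp ((1 - \<beta>) * l * T B \<omega>) + exp (l * y) * indicator E \<omega>)"
    proof (intro integral_mono integrable_exp_T[OF B(2)] Bochner_Integration.integrable_add
        integrable_mult_right integrable_real_indicator)
      fix \<omega> assume \<omega>: "\<omega> \<in> space M"
      have nonneg: "0 \<le> exp (- \<beta> * (l * y)) * exp ((1 + \<beta>) * l * T B \<omega>)"
        "0 \<le> exp (\<beta> * (l * x)) * exp ((1 - \<beta>) * l * T B \<omega>)" "0 \<le> exp (l * y) * indicator E \<omega>"
        by auto
      consider "T B \<omega> < x" | "x \<le> T B \<omega>" "T B \<omega> \<le> y" | "y < T B \<omega>" by linarith
      then show "exp (l * T B \<omega>) \<le> exp (- \<beta> * (l * y)) * exp ((1 + \<beta>) * l * T B \<omega>) +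
        exp (\<beta> * (l * x)) * exp ((1 - \<beta>) * l * T B \<omega>) + exp (l * y) * indicator E \<omega>"
      proof cases
        case 1
        have "\<beta> * l * T B \<omega> \<le> \<beta> * l * x" using 1 \<beta> l by (intro mult_left_mono) auto
        then have "exp (l * T B \<omega>) \<le> exp (\<beta> * (l * x)) * exp ((1 - \<beta>) * l * T B \<omega>)"
          unfolding exp_add[symmetric] by (simp add: algebra_simps)
        then show ?thesis using nonneg by linarith
      next
        case 2
        have "exp (l * T B \<omega>) \<le> exp (l * y) * indicator E \<omega>" using 2 \<omega> l by (simp add: E_def)
        then show ?thesis using nonneg by linarith
      next
        case 3
        have "\<beta> * l * y \<le> \<beta> * l * T B \<omega>" using 3 \<beta> l by (intro mult_left_mono) auto
        then have "exp (l * T B \<omega>) \<le> exp (- \<beta> * (l * y)) * exp ((1 + \<beta>) * l * T B \<omega>)"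
          unfolding exp_add[symmetric] by (simp add: algebra_simps)
        then show ?thesis using nonneg by linarith
      qed
    qed (auto simp: emeasure_eq_measure)
    also have "\<dots> = exp (- \<beta> * (l * y)) * expectation (\<lambda>\<omega>. exp ((1 + \<beta>) * l * T B \<omega>)) +
        exp (\<beta> * (l * x)) * expectation (\<lambda>\<omega>. exp ((1 - \<beta>) * l * T B \<omega>)) + exp (l * y) * prob E"
      using integrable_exp_T[OF B(2)] by (simp add: emeasure_eq_measure)
    also have "\<dots> \<le> a / 4 + a / 4 + exp (l * y) * prob E" using t1 t2 by simp
    finally have "a / 2 \<le> exp (l * y) * prob E" by simp
    then have "exp (- (l * y)) * (a / 2) \<le> exp (- (l * y)) * (exp (l * y) * prob E)" by (intro mult_left_mono) auto
    also have "\<dots> = prob E" by (simp add: mult.assoc[symmetric] exp_add[symmetric])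
    finally have "exp (- (l * y)) * a / 2 \<le> prob E" by simp
    \<comment> \<open>The true exponent is (1 + \<beta>) V - (1 - \<epsilon>) V / 2 = (1/2 + \<beta>
      + \<epsilon>/2) V; the stated one is rounded up.\<close>
    moreover have "exp (- ((1/2 + 2 * \<beta>) * V)) \<le> exp (- (l * y)) * a"
      unfolding a_def exp_add[symmetric] ly
    proof -
      have "(1/2 + \<beta> + \<epsilon> / 2) * V \<le> (1/2 + 2 * \<beta>) * V"
        using V \<beta>2 \<beta> by (intro mult_right_mono) (auto simp: \<epsilon>_def)
      then show "exp (- ((1/2 + 2 * \<beta>) * V)) \<le> exp (- ((1 + \<beta>) * V) + (1 - \<epsilon>) * V / 2)"
        by (simp add: algebra_simps)
    qed
    ultimately show ?thesis by (simp add: V_def E_def x_def)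
  qed
  show ?thesis by (rule exI[of _ "l1 / 2"], intro conjI allI impI) (use l1(1) main in auto)
qed

end

section \<open>Law of the iterated logarithm along nested index sets\<close>

text \<open>The classical scale for a sum of N = n choose 2 terms of unit variance has
  \<open>ln (ln N)\<close> in place of \<open>ln (ln n)\<close>; as N has order n^2, the two agree
  up to a factor tending to 1.\<close>

definition lil_scale :: "nat \<Rightarrow> real" where
  "lil_scale n = sqrt (2 * real (n choose 2) * ln (ln (real n)))"

lemma real_choose_2: "real (n choose 2) = real n * (real n - 1) / 2"
proof (cases n)
  case (Suc m)
  have "even (n * (n - 1))" by (cases n) auto
  then have "real (n * (n - 1) div 2) = real (n * (n - 1)) / 2" using real_of_nat_div by fastforce
  then show ?thesis using Suc by (simp add: choose_two algebra_simps)
qed simp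

lemma ln_ln_nonneg: "3 \<le> n \<Longrightarrow> 0 \<le> ln (ln (real n))"
proof -
  assume "3 \<le> n"
  then have "ln 3 \<le> ln (real n)" by (subst ln_le_cancel_iff) auto
  then have "1 \<le> ln (real n)" using ln3_gt_1 by linarith
  then show ?thesis by simp
qed

lemma ln_ln_mono: "3 \<le> m \<Longrightarrow> m \<le> n \<Longrightarrow> ln (ln (real m)) \<le> ln (ln (real n))"
  by (subst ln_le_cancel_iff) auto

lemma lil_scale_mono:
  assumes "3 \<le> m" "m \<le> n"
  shows "lil_scale m \<le> lil_scale n"
  unfolding lil_scale_def using assms ln_ln_nonneg[of m] ln_ln_mono[OF assms] binomial_right_mono[of m n 2]
  by (intro real_sqrt_le_mono mult_mono) auto

lemma lil_scale_nonneg: "3 \<le> n \<Longrightarrow> 0 \<le> lil_scale n"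
  unfolding lil_scale_def using ln_ln_nonneg[of n] by simp

lemma lil_scale_square: "3 \<le> n \<Longrightarrow> (lil_scale n)\<^sup>2 = 2 * real (n choose 2) * ln (ln (real n))"
  unfolding lil_scale_def using ln_ln_nonneg[of n] by simp

text \<open>This quotient is, up to a constant, the tilt used for deviations of order
  \<open>lil_scale n\<close>; it must tend to 0 for the moment bounds, valid only near 0, to
  apply.\<close>

lemma lil_scale_over_choose_2: "(\<lambda>n. lil_scale n / real (n choose 2)) \<longlonglongrightarrow> 0"
  unfolding lil_scale_def real_choose_2 by real_asymp

text \<open>All that is kept of the edge sets of complete graphs is nesting and size; passing from n
  to n + 1 adds n variables at once.\<close>

locale bounded_independent_nested = bounded_independent M \<eta> I K
  for M :: "'w measure" and \<eta> :: "'e \<Rightarrow> 'w \<Rightarrow> real" and I K +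
  fixes A :: "nat \<Rightarrow> 'e set"
  assumes A_subset: "A n \<subseteq> I" and finite_A: "finite (A n)" and mono_A: "mono A"
    and card_A: "card (A n) = n choose 2"
begin

section \<open>The upper half: maximal inequality along a geometric sequence\<close>

text \<open>The level is (1 + \<epsilon>) times the scale at the left end of a block, while the
  variance N belongs to the right end. Squaring the level gives (1 + \<epsilon>)^2, the growth of N
  costs one of the two factors, and what is left makes the probability at most a power of
  \<open>ln (m k)\<close> with exponent -(1 + \<epsilon>/2). As \<open>ln (m k)\<close> grows at
  least linearly in k, this is summable.\<close>

lemma upper_tail_summable:
  fixes \<epsilon> :: real
  assumes \<epsilon>: "0 < \<epsilon>" "\<epsilon> \<le> 1" and m: "\<And>k. m k \<le> m (Suc k)"
    and large: "\<forall>\<^sub>F k in sequentially. 3 \<le> m k"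
    and ratio: "\<forall>\<^sub>F k in sequentially. real (m (Suc k) choose 2) \<le> (1 + \<epsilon>) * real (m k choose 2)"
    and geometric: "\<forall>\<^sub>F k in sequentially. a * real k \<le> ln (real (m k))" and a: "a > 0"
  shows "summable (\<lambda>k. prob {\<omega> \<in> space M. \<exists>n\<le>m (Suc k). T (A n) \<omega> \<ge> (1 + \<epsilon>) * lil_scale (m k)})"
proof -
  have \<epsilon>4: "0 < \<epsilon> / 4" "\<epsilon> / 4 < 1" using \<epsilon> by auto
  obtain l0 where l0: "l0 > 0" "\<And>B l. finite B \<Longrightarrow> B \<subseteq> I \<Longrightarrow> \<bar>l\<bar> \<le> l0 \<Longrightarrow>
    exp ((1 - \<epsilon>/4) * l\<^sup>2 * card B / 2) \<le> expectation (\<lambda>\<omega>. exp (l * T B \<omega>)) \<and>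
    expectation (\<lambda>\<omega>. exp (l * T B \<omega>)) \<le> exp ((1 + \<epsilon>/4) * l\<^sup>2 * card B / 2)"
    using mgf_T_bounds[OF \<epsilon>4] by (elim exE conjE) (rule that, auto)
  have m_top: "filterlim m at_top sequentially"
  proof -
    have "filterlim (\<lambda>k. a * real k) at_top sequentially"
      using a by real_asymp
    then have "filterlim (\<lambda>k. ln (real (m k))) at_top sequentially"
      by (rule filterlim_at_top_mono) (fact geometric)
    moreover have "ln (real n) \<le> real n" for n by (cases n) (auto simp: ln_le_minus_one intro: order.trans[OF ln_le_minus_one])
    ultimately have "filterlim (\<lambda>k. real (m k)) at_top sequentially"
      by (elim filterlim_at_top_mono) auto
    then show ?thesis by (simp add: filterlim_sequentially_iff_filterlim_real)
  qed
  have "(\<lambda>k. (1 + \<epsilon>) * (lil_scale (m k) / real (m k choose 2))) \<longlonglongrightarrow> (1 + \<epsilon>) * 0"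
    by (intro tendsto_intros filterlim_compose[OF lil_scale_over_choose_2 m_top])
  then have small: "\<forall>\<^sub>F k in sequentially. (1 + \<epsilon>) * (lil_scale (m k) / real (m k choose 2)) < l0"
    using l0(1) by (intro order_tendstoD(2)) auto
  have "\<forall>\<^sub>F k in sequentially. prob {\<omega> \<in> space M. \<exists>n\<le>m (Suc k). T (A n) \<omega> \<ge> (1 + \<epsilon>) * lil_scale (m k)} \<le>
      a powr (- (1 + \<epsilon> / 2)) * real k powr (- (1 + \<epsilon> / 2))"
    using large ratio geometric small eventually_gt_at_top[of 0]
  proof eventually_elim
    case (elim k)
    define x where "x = (1 + \<epsilon>) * lil_scale (m k)"
    define N where "N = real (m (Suc k) choose 2)"
    define N0 where "N0 = real (m k choose 2)"
    define L where "L = ln (ln (real (m k)))"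
    \<comment> \<open>The minimiser of - l x + l^2 N / 2.\<close>
    define l where "l = x / N"
    have N0: "N0 > 0" using elim(1) by (simp add: N0_def)
    have NN: "N0 \<le> N" using binomial_right_mono[OF m[of k], of 2] by (simp add: N_def N0_def)
    have L: "L \<ge> 0" using ln_ln_nonneg elim(1) by (simp add: L_def)
    have x: "x \<ge> 0" using lil_scale_nonneg elim(1) \<epsilon> by (simp add: x_def)
    have l: "0 \<le> l" using x N0 NN by (simp add: l_def)
    have "l \<le> x / N0" unfolding l_def using x N0 NN by (intro divide_left_mono) auto
    also have "\<dots> \<le> l0" using elim(4) by (simp add: x_def N0_def)
    finally have l_le: "\<bar>l\<bar> \<le> l0" using l by simp
    have "prob {\<omega> \<in> space M. \<exists>n\<le>m (Suc k). T (A n) \<omega> \<ge> x} \<le>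
        exp (- l * x) * expectation (\<lambda>\<omega>. exp (l * T (A (m (Suc k))) \<omega>))"
      by (rule maximal_inequality[OF A_subset finite_A mono_A l])
    also have "\<dots> \<le> exp (- l * x) * exp ((1 + \<epsilon>/4) * l\<^sup>2 * N / 2)"
      using l0(2)[OF finite_A A_subset l_le] card_A by (intro mult_left_mono) (auto simp: N_def)
    also have "\<dots> = exp (- ((1 - \<epsilon>/4) * (x\<^sup>2 / (2 * N))))"
      unfolding exp_add[symmetric] l_def using N0 NN
      by (intro arg_cong[where f=exp]) (simp add: field_simps power2_eq_square)
    also have "\<dots> \<le> exp (- (1 + \<epsilon>/2) * L)"
    proof -
      have "(1 + \<epsilon>) * N * L \<le> (1 + \<epsilon>) * ((1 + \<epsilon>) * N0) * L"
        using elim(2) L \<epsilon> by (intro mult_right_mono mult_left_mono) (auto simp: N_def N0_def)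
      also have "\<dots> = x\<^sup>2 / 2"
        using lil_scale_square[OF elim(1)] by (simp add: x_def power_mult_distrib N0_def L_def power2_eq_square)
      finally have "(1 + \<epsilon>) * L \<le> x\<^sup>2 / (2 * N)" using N0 NN by (simp add: field_simps)
      then have "(1 - \<epsilon>/4) * ((1 + \<epsilon>) * L) \<le> (1 - \<epsilon>/4) * (x\<^sup>2 / (2 * N))" using \<epsilon> by (intro mult_left_mono) auto
      moreover have "(1 + \<epsilon>/2) * L \<le> (1 - \<epsilon>/4) * (1 + \<epsilon>) * L"
      proof (rule mult_right_mono[OF _ L])
        have "\<epsilon> * \<epsilon> \<le> \<epsilon> * 1" using \<epsilon> by (intro mult_left_mono) auto
        moreover have "(1 - \<epsilon>/4) * (1 + \<epsilon>) = 1 + 3 * \<epsilon> / 4 - \<epsilon> * \<epsilon> / 4" by (simp add: field_simps)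
        ultimately show "1 + \<epsilon>/2 \<le> (1 - \<epsilon>/4) * (1 + \<epsilon>)" using \<epsilon> by linarith
      qed
      ultimately have "(1 + \<epsilon>/2) * L \<le> (1 - \<epsilon>/4) * (x\<^sup>2 / (2 * N))" by (simp only: mult.assoc)
      then show ?thesis unfolding exp_le_cancel_iff minus_mult_left[symmetric] neg_le_iff_le .
    qed
    also have "\<dots> = ln (real (m k)) powr (- (1 + \<epsilon>/2))"
    proof -
      have "ln (real (m k)) > 0" using elim(1) by (intro ln_gt_zero) auto
      then show ?thesis by (simp add: powr_def L_def)
    qed
    also have "\<dots> \<le> (a * real k) powr (- (1 + \<epsilon>/2))"
      using elim a \<epsilon> by (intro powr_mono2') auto
    also have "\<dots> = a powr (- (1 + \<epsilon>/2)) * real k powr (- (1 + \<epsilon>/2))"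
      using a by (simp add: powr_mult)
    finally show ?case by (simp add: x_def)
  qed
  moreover have "summable (\<lambda>k. a powr (- (1 + \<epsilon> / 2)) * real k powr (- (1 + \<epsilon> / 2)))"
    using \<epsilon> by (intro summable_mult) (simp add: summable_real_powr_iff)
  ultimately show ?thesis
    by (elim summable_comparison_test_ev[rotated] eventually_mono) simp
qed

text \<open>Almost surely only finitely many blocks violate the bound at their left end; inside a
  block the scale only increases, so the bound passes to every n.\<close>

theorem eventually_le_lil_scale:
  fixes \<epsilon> :: real
  assumes \<epsilon>: "0 < \<epsilon>" "\<epsilon> \<le> 1"
  shows "AE \<omega> in M. \<forall>\<^sub>F n in sequentially. T (A n) \<omega> \<le> (1 + \<epsilon>) * lil_scale n"
proof -
  \<comment> \<open>The number of variables grows quadratically in n, so it is \<theta>^2 that has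
    to stay below 1 + \<epsilon>.\<close>
  define \<theta> where "\<theta> = 1 + \<epsilon> / 4"
  have \<theta>: "\<theta> > 1" "\<theta>\<^sup>2 < 1 + \<epsilon>"
  proof -
    have "\<epsilon> * \<epsilon> \<le> \<epsilon> * 1" using \<epsilon> by (intro mult_left_mono) auto
    moreover have "\<theta>\<^sup>2 = 1 + \<epsilon> / 2 + \<epsilon> * \<epsilon> / 16" by (simp add: \<theta>_def power2_eq_square algebra_simps)
    ultimately show "\<theta>\<^sup>2 < 1 + \<epsilon>" using \<epsilon> by linarith
    show "\<theta> > 1" using \<epsilon> by (simp add: \<theta>_def)
  qed
  define m where "m k = nat \<lfloor>\<theta> ^ k\<rfloor>" for k
  have m_le: "real (m k) \<le> \<theta> ^ k" for k
    using \<theta> by (simp add: m_def)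
  have m_ge: "\<theta> ^ k - 1 \<le> real (m k)" for k
    using \<theta> by (simp add: m_def)
  have \<theta>_top: "filterlim (\<lambda>k. \<theta> ^ k) at_top sequentially"
    using \<theta> by real_asymp
  have m_mono: "m k \<le> m (Suc k)" for k
    unfolding m_def using \<theta> by (intro nat_mono floor_mono power_increasing) auto
  have large: "\<forall>\<^sub>F k in sequentially. 3 \<le> m k"
    using filterlim_at_top_dense[THEN iffD1, OF \<theta>_top, rule_format, of 4]
  proof eventually_elim
    case (elim k)
    then show ?case using m_ge[of k] by linarith
  qed
  \<comment> \<open>With x = \<theta>^k, rounding down leaves \<open>m k\<close> at least x - 1,
    hence m k (m k - 1) at least (x - 1) (x - 2), while \<open>m (Suc k)\<close> is at most \<theta>
    x. The strict gap between \<theta>^2 and 1 + \<epsilon> absorbs the rounding.\<close>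
  have "((\<lambda>x::real. ((x - 1) * (x - 2)) / x\<^sup>2) \<longlongrightarrow> 1) at_top"
    by real_asymp
  then have "\<forall>\<^sub>F x::real in at_top. \<theta>\<^sup>2 / (1 + \<epsilon>) < ((x - 1) * (x - 2)) / x\<^sup>2"
    using \<theta> \<epsilon> by (intro order_tendstoD(1)) auto
  then have "\<forall>\<^sub>F x::real in at_top. \<theta>\<^sup>2 * x\<^sup>2 \<le> (1 + \<epsilon>) * ((x - 1) * (x - 2)) \<and> x > 2"
    using eventually_gt_at_top[of "2::real"]
  proof eventually_elim
    case (elim x)
    then have "x\<^sup>2 > 0" by simp
    with elim \<epsilon> show ?case by (simp add: field_simps)
  qed
  then have r: "\<forall>\<^sub>F k in sequentially. \<theta>\<^sup>2 * (\<theta>^k)\<^sup>2 \<le> (1 + \<epsilon>) * ((\<theta>^k - 1) * (\<theta>^k - 2)) \<and> \<theta>^k > 2"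
    using \<theta>_top by (rule eventually_compose_filterlim)
  have ratio: "\<forall>\<^sub>F k in sequentially. real (m (Suc k) choose 2) \<le> (1 + \<epsilon>) * real (m k choose 2)"
    using r
  proof eventually_elim
    case (elim k)
    have "2 * real (m (Suc k) choose 2) \<le> real (m (Suc k)) * real (m (Suc k))"
      by (simp add: real_choose_2 algebra_simps)
    also have "\<dots> \<le> \<theta> ^ Suc k * \<theta> ^ Suc k" using \<theta> by (intro mult_mono m_le) auto
    also have "\<dots> = \<theta>\<^sup>2 * (\<theta>^k)\<^sup>2" by (simp add: power2_eq_square)
    also have "\<dots> \<le> (1 + \<epsilon>) * ((\<theta>^k - 1) * (\<theta>^k - 2))" using elim by simp
    also have "\<dots> \<le> (1 + \<epsilon>) * (real (m k) * (real (m k) - 1))"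
      using m_ge[of k] elim \<epsilon> by (intro mult_left_mono mult_mono) auto
    finally show ?case by (simp add: real_choose_2)
  qed
  have "\<forall>\<^sub>F x::real in at_top. ln x / 2 \<le> ln (x - 1)"
    by real_asymp
  then have "\<forall>\<^sub>F x::real in at_top. ln x / 2 \<le> ln (x - 1) \<and> x > 1"
    using eventually_gt_at_top by (rule eventually_conj)
  then have g: "\<forall>\<^sub>F k in sequentially. ln (\<theta>^k) / 2 \<le> ln (\<theta>^k - 1) \<and> \<theta>^k > 1"
    using \<theta>_top by (rule eventually_compose_filterlim)
  have geometric: "\<forall>\<^sub>F k in sequentially. (ln \<theta> / 2) * real k \<le> ln (real (m k))"
    using g
  proof eventually_elim
    case (elim k)
    have "(ln \<theta> / 2) * real k = ln (\<theta>^k) / 2" using \<theta> by (simp add: ln_realpow)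
    also have "\<dots> \<le> ln (\<theta>^k - 1)" using elim by simp
    also have "\<dots> \<le> ln (real (m k))" using m_ge[of k] elim by (intro ln_mono) auto
    finally show ?case .
  qed
  define E where "E k = {\<omega> \<in> space M. \<exists>n\<le>m (Suc k). T (A n) \<omega> \<ge> (1 + \<epsilon>) * lil_scale (m k)}" for k
  have [measurable]: "T (A n) \<in> borel_measurable M" for n by (rule measurable_T[OF A_subset])
  have Em: "E k \<in> events" for k unfolding E_def by measurable
  have "summable (\<lambda>k. prob (E k))"
    unfolding E_def using \<theta> by (intro upper_tail_summable[OF \<epsilon> m_mono large ratio geometric]) auto
  then have "AE \<omega> in M. \<forall>\<^sub>F k in sequentially. \<omega> \<in> space M - E k"
    by (intro borel_cantelli_AE1 Em) (auto simp: emeasure_eq_measure)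
  then show ?thesis
  proof (rule AE_mp, intro AE_I2 impI)
    fix \<omega> assume "\<forall>\<^sub>F k in sequentially. \<omega> \<in> space M - E k"
    then have "\<forall>\<^sub>F k in sequentially. \<omega> \<in> space M - E k \<and> 3 \<le> m k"
      using large by (rule eventually_conj)
    then obtain k0 where k0: "\<And>k. k \<ge> k0 \<Longrightarrow> \<omega> \<in> space M - E k \<and> 3 \<le> m k"
      by (auto simp: eventually_sequentially)
    show "\<forall>\<^sub>F n in sequentially. T (A n) \<omega> \<le> (1 + \<epsilon>) * lil_scale n"
      using eventually_ge_at_top[of "m k0"]
    proof eventually_elim
      case (elim n)
      \<comment> \<open>The block containing n. Minimality gives \<open>m k \<le> n\<close>, except
        when k = k0, where this is the assumption on n.\<close>
      define k where "k = (LEAST k. n < m (Suc k) \<and> k \<ge> k0)"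
      have "\<exists>k. n < m (Suc k) \<and> k \<ge> k0"
      proof -
        have "\<forall>\<^sub>F k in sequentially. real n + 1 < \<theta> ^ k" using \<theta>_top by (auto simp: filterlim_at_top_dense)
        then have "\<forall>\<^sub>F k in sequentially. real n + 1 < \<theta> ^ k \<and> k \<ge> Suc k0"
          using eventually_ge_at_top[of "Suc k0"] by (rule eventually_conj)
        then obtain j where j: "real n + 1 < \<theta> ^ j" "j \<ge> Suc k0"
          by (auto simp: eventually_sequentially)
        then have "n < m j" using m_ge[of j] by linarith
        then show ?thesis using j(2) by (intro exI[of _ "j - 1"]) auto
      qed
      then have k: "n < m (Suc k)" "k \<ge> k0" unfolding k_def by (rule LeastI2_ex, simp)+
      have mk: "m k \<le> n"
      proof (cases "k = k0")
        case False
        then obtain j where j: "k = Suc j" "j \<ge> k0" using k(2) by (cases k) auto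
        have "\<not> (n < m (Suc j) \<and> j \<ge> k0)" using j(1) unfolding k_def by (intro not_less_Least) simp
        then show ?thesis using j by simp
      qed (use elim in simp)
      have "T (A n) \<omega> < (1 + \<epsilon>) * lil_scale (m k)"
        using k0[OF k(2)] less_imp_le[OF k(1)] by (auto simp: E_def not_le dest: spec[of _ n])
      also have "\<dots> \<le> (1 + \<epsilon>) * lil_scale n"
        using k0[OF k(2)] mk \<epsilon> by (intro mult_left_mono lil_scale_mono) auto
      finally show ?case by simp
    qed
  qed
qed

section \<open>The lower half: independent blocks\<close>

lemma uminus: "bounded_independent_nested M (\<lambda>e \<omega>. - \<eta> e \<omega>) I K A"
proof (intro bounded_independent_nested.intro bounded_independent.intro
    bounded_independent_axioms.intro bounded_independent_nested_axioms.intro prob_space_axioms)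
  show "indep_vars (\<lambda>_. borel) (\<lambda>e \<omega>. - \<eta> e \<omega>) I"
    using indep by (rule indep_vars_compose2) simp
qed (use bounded mean_0 variance_1 A_subset finite_A mono_A card_A in auto)

text \<open>The upper half for the negated variables. It controls how far the sum before a block can
  pull down the sum after it.\<close>

lemma eventually_ge_lil_scale:
  fixes \<epsilon> :: real
  assumes \<epsilon>: "0 < \<epsilon>" "\<epsilon> \<le> 1"
  shows "AE \<omega> in M. \<forall>\<^sub>F n in sequentially. T (A n) \<omega> \<ge> - (1 + \<epsilon>) * lil_scale n"
proof -
  interpret U: bounded_independent_nested M "\<lambda>e \<omega>. - \<eta> e \<omega>" I K A by (rule uminus)
  have "U.T (A n) \<omega> = - T (A n) \<omega>" for n \<omega> by (simp add: T_def U.T_def sum_negf)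
  then have "T (A n) \<omega> \<ge> - (1 + \<epsilon>) * lil_scale n \<longleftrightarrow> U.T (A n) \<omega> \<le> (1 + \<epsilon>) * lil_scale n" for n \<omega>
    by (auto simp: algebra_simps)
  with U.eventually_le_lil_scale[OF assms] show ?thesis by simp
qed

text \<open>The level is chosen so that the lower tail bound comes out as exp (- L) / 2 with L =
  \<open>ln (ln (real (b ^ Suc k)))\<close>, that is, half the reciprocal of (k + 1) ln b: a
  multiple of the harmonic series.\<close>

lemma block_sum_prob:
  fixes b :: nat
  assumes b: "2 \<le> b"
  defines "\<beta> \<equiv> 1 / real b"
  defines "V k \<equiv> real (b ^ Suc k choose 2) - real (b ^ k choose 2)"
  shows "\<forall>\<^sub>F k in sequentially. 1 / (2 * real (Suc k) * ln b) \<le>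
    prob {\<omega> \<in> space M. T (A (b ^ Suc k) - A (b ^ k)) \<omega> \<ge>
      (1 - \<beta>) * sqrt (2 * V k * ln (ln (real (b ^ Suc k))) / (1 + 4 * \<beta>))}"
proof -
  have \<beta>: "0 < \<beta>" "\<beta> < 1" using b by (auto simp: \<beta>_def)
  obtain l0 where l0: "l0 > 0" "\<And>B (l::real). finite B \<Longrightarrow> B \<subseteq> I \<Longrightarrow> 0 < l \<Longrightarrow> l \<le> l0 \<Longrightarrow> 8 \<le> l\<^sup>2 * card B * \<beta>\<^sup>2 \<Longrightarrow>
    exp (- ((1/2 + 2 * \<beta>) * (l\<^sup>2 * card B))) / 2 \<le> prob {\<omega> \<in> space M. T B \<omega> \<ge> (1 - \<beta>) * l * card B}"
    using lower_tail[OF \<beta>] by (elim exE conjE) (rule that, assumption, blast)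
  have pow_top: "filterlim (\<lambda>k. b ^ Suc k) at_top sequentially"
  proof -
    have "1 < real b" using b by simp
    then have "filterlim (\<lambda>k. real b ^ Suc k) at_top sequentially" by real_asymp
    then have "filterlim (\<lambda>k. real (b ^ Suc k)) at_top sequentially" by simp
    then show ?thesis by (simp only: filterlim_sequentially_iff_filterlim_real)
  qed
  \<comment> \<open>Guarantees \<open>l \<le> l0\<close> below: since a block holds at least half of
    the variables, l^2 is at most 4 L divided by the binomial coefficient.\<close>
  have "(\<lambda>n::nat. ln (ln (real n)) / (real n * (real n - 1) / 2)) \<longlonglongrightarrow> 0" by real_asymp
  then have "(\<lambda>n. ln (ln (real n)) / real (n choose 2)) \<longlonglongrightarrow> 0" by (simp add: real_choose_2)
  then have "\<forall>\<^sub>F n in sequentially. ln (ln (real n)) / real (n choose 2) < l0\<^sup>2 / 4"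
    using l0 by (intro order_tendstoD(2)) auto
  then have ev1: "\<forall>\<^sub>F k in sequentially. ln (ln (real (b ^ Suc k))) / real (b ^ Suc k choose 2) < l0\<^sup>2 / 4"
    using pow_top by (rule eventually_compose_filterlim)
  \<comment> \<open>Guarantees the condition with the constant 8 in the lower tail bound, because
    l^2 times the block size is 2 L / (1 + 4 \<beta>).\<close>
  have "filterlim (\<lambda>n::nat. ln (ln (real n))) at_top sequentially" by real_asymp
  then have "\<forall>\<^sub>F n in sequentially. ln (ln (real n)) > 4 * (1 + 4 * \<beta>) / \<beta>\<^sup>2" by (auto simp: filterlim_at_top_dense)
  then have ev2: "\<forall>\<^sub>F k in sequentially. ln (ln (real (b ^ Suc k))) > 4 * (1 + 4 * \<beta>) / \<beta>\<^sup>2"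
    using pow_top by (rule eventually_compose_filterlim)
  show ?thesis
    using ev1 ev2
  proof eventually_elim
    case (elim k)
    define L where "L = ln (ln (real (b ^ Suc k)))"
    define B where "B = A (b ^ Suc k) - A (b ^ k)"
    \<comment> \<open>The solution of (1/2 + 2 \<beta>) l^2 V = L; the factor 1 + 4 \<beta> is twice
      1/2 + 2 \<beta>.\<close>
    define l where "l = sqrt (2 * L / ((1 + 4 * \<beta>) * V k))"
    have B: "finite B" "B \<subseteq> I" using finite_A A_subset by (auto simp: B_def)
    have pw: "b ^ k \<le> b ^ Suc k" using b by simp
    have cB: "real (card B) = V k"
      using monoD[OF mono_A pw] card_mono[OF finite_A[of "b ^ Suc k"] monoD[OF mono_A pw]]
      by (simp add: B_def V_def card_Diff_subset finite_A card_A of_nat_diff)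
    have b2: "b ^ Suc k \<ge> 2" using b one_le_power[of b k] by (simp add: le_trans[OF b])
    have N: "real (b ^ Suc k choose 2) > 0" using b2 by simp
    have Vhalf: "V k \<ge> real (b ^ Suc k choose 2) / 2"
    proof -
      define x where "x = real (b ^ k)"
      have x1: "x \<ge> 1" using b by (simp add: x_def)
      have "2 * (x * (x - 1)) \<le> real b * x * (real b * x - 1)"
      proof -
        have "real b * x * (real b * x - 1) \<ge> 2 * x * (1 * x - 1)"
          using b x1 by (intro mult_mono diff_right_mono) auto
        then show ?thesis by simp
      qed
      then have "2 * real (b ^ k choose 2) \<le> real (b ^ Suc k choose 2)"
        unfolding real_choose_2 by (simp add: x_def)
      then show ?thesis by (simp add: V_def)
    qed
    then have V: "V k > 0" using N by linarith
    have L: "L > 0" using elim(2) \<beta> by (intro less_trans[OF _ elim(2)[folded L_def]]) auto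
    have l: "l > 0" using V L \<beta> by (simp add: l_def)
    have l2: "l\<^sup>2 * V k = 2 * L / (1 + 4 * \<beta>)"
      using V L \<beta> by (simp add: l_def)
    have "2 * L / ((1 + 4 * \<beta>) * V k) \<le> 2 * L / (1 * (real (b ^ Suc k choose 2) / 2))"
      using N L by (intro frac_le mult_mono Vhalf) (use \<beta> in auto)
    also have "\<dots> \<le> l0\<^sup>2" using elim(1) by (simp add: L_def field_simps)
    finally have "l \<le> sqrt (l0\<^sup>2)" unfolding l_def by (rule real_sqrt_le_mono)
    then have ll0: "l \<le> l0" using l0(1) by simp
    have eight: "8 \<le> l\<^sup>2 * card B * \<beta>\<^sup>2"
      using elim(2) \<beta> unfolding cB l2 by (simp add: L_def field_simps)
    have "exp (- ((1/2 + 2 * \<beta>) * (l\<^sup>2 * card B))) / 2 \<le> prob {\<omega> \<in> space M. T B \<omega> \<ge> (1 - \<beta>) * l * card B}"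
      by (rule l0(2)[OF B l ll0 eight])
    also have "(1/2 + 2 * \<beta>) * (l\<^sup>2 * card B) = L"
      unfolding cB l2 using \<beta> by (simp add: field_simps)
    also have "exp (- L) / 2 = 1 / (2 * real (Suc k) * ln b)"
    proof -
      have "ln (real (b ^ Suc k)) > 0" using b2 by (intro ln_gt_zero) linarith
      moreover have "ln (real (b ^ Suc k)) = real (Suc k) * ln b" using b by (simp only: of_nat_power ln_realpow)
      ultimately show ?thesis unfolding L_def by (simp add: exp_minus field_simps)
    qed
    also have "(1 - \<beta>) * l * card B = (1 - \<beta>) * sqrt (2 * V k * L / (1 + 4 * \<beta>))"
    proof -
      have "l * V k = sqrt (2 * L / ((1 + 4 * \<beta>) * V k) * (V k)\<^sup>2)"
        unfolding real_sqrt_mult l_def using V by simp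
      also have "2 * L / ((1 + 4 * \<beta>) * V k) * (V k)\<^sup>2 = 2 * V k * L / (1 + 4 * \<beta>)"
        using V by (simp add: power2_eq_square)
      finally show ?thesis by (simp add: cB)
    qed
    finally show ?case by (simp add: B_def L_def)
  qed
qed

text \<open>Successive blocks use disjoint sets of variables, so their sums are independent, and the
  divergence of the harmonic series feeds the second Borel-Cantelli lemma.\<close>

lemma frequently_block_sum_ge:
  fixes b :: nat
  assumes b: "2 \<le> b"
  defines "\<beta> \<equiv> 1 / real b"
  defines "V k \<equiv> real (b ^ Suc k choose 2) - real (b ^ k choose 2)"
  shows "AE \<omega> in M. \<exists>\<^sub>F k in sequentially. T (A (b ^ Suc k) - A (b ^ k)) \<omega> \<ge>
      (1 - \<beta>) * sqrt (2 * V k * ln (ln (real (b ^ Suc k))) / (1 + 4 * \<beta>))"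
proof -
  define t where "t k = (1 - \<beta>) * sqrt (2 * V k * ln (ln (real (b ^ Suc k))) / (1 + 4 * \<beta>))" for k
  define B where "B k = A (b ^ Suc k) - A (b ^ k)" for k
  have BI: "B k \<subseteq> I" for k using A_subset by (auto simp: B_def)
  have [measurable]: "T (B k) \<in> borel_measurable M" for k by (rule measurable_T[OF BI])
  have disj: "disjoint_family_on B UNIV"
  proof -
    have "B i \<inter> B j = {}" if "i < j" for i j
    proof -
      have "A (b ^ Suc i) \<subseteq> A (b ^ j)" using that b by (intro monoD[OF mono_A] power_increasing) auto
      then show ?thesis by (auto simp: B_def)
    qed
    then show ?thesis unfolding disjoint_family_on_def by (metis inf_commute linorder_neqE_nat)
  qed
  have "indep_vars (\<lambda>k. PiM (B k) (\<lambda>_. borel)) (\<lambda>k \<omega>. restrict (\<lambda>e. \<eta> e \<omega>) (B k)) UNIV"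
    by (rule indep_vars_restrict[OF indep BI disj])
  then have "indep_vars (\<lambda>_. borel) (\<lambda>k \<omega>. \<Sum>e\<in>B k. restrict (\<lambda>e. \<eta> e \<omega>) (B k) e) UNIV"
    by (rule indep_vars_compose2[where Y="\<lambda>k y. \<Sum>e\<in>B k. y e"])
       (rule borel_measurable_sum[where f="\<lambda>e y. y e"], simp)
  then have "indep_vars (\<lambda>_. borel) (\<lambda>k. T (B k)) UNIV"
    by (simp add: T_def[abs_def] cong: sum.cong)
  then have ind: "indep_events (\<lambda>k. {\<omega> \<in> space M. T (B k) \<omega> < t k}) UNIV"
    by (intro indep_eventsI_indep_vars[where P="\<lambda>k y. y < t k"]) auto
  have compl: "1 - prob {\<omega> \<in> space M. T (B k) \<omega> < t k} = prob {\<omega> \<in> space M. T (B k) \<omega> \<ge> t k}" for k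
    by (subst prob_compl[symmetric], simp) (auto intro!: arg_cong[where f=prob])
  have "\<not> summable (\<lambda>k. prob {\<omega> \<in> space M. T (B k) \<omega> \<ge> t k})"
  proof
    assume s: "summable (\<lambda>k. prob {\<omega> \<in> space M. T (B k) \<omega> \<ge> t k})"
    have "\<forall>\<^sub>F k in sequentially. norm (1 / (2 * real (Suc k) * ln b)) \<le> prob {\<omega> \<in> space M. T (B k) \<omega> \<ge> t k}"
      using block_sum_prob[OF b]
    proof eventually_elim
      case (elim k)
      moreover have "0 \<le> 1 / (2 * real (Suc k) * ln b)" using b by (intro divide_nonneg_nonneg mult_nonneg_nonneg) auto
      ultimately show ?case unfolding B_def t_def V_def \<beta>_def real_norm_def by linarith
    qed
    then have "summable (\<lambda>k. 1 / (2 * real (Suc k) * ln b))"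
      by (rule summable_comparison_test_ev[OF _ s])
    then have "summable (\<lambda>k. (2 * ln b) * (1 / (2 * real (Suc k) * ln b)))" by (rule summable_mult)
    moreover have "(2 * ln b) * (1 / (2 * real (Suc k) * ln b)) = inverse (real (Suc k))" for k
    proof -
      have "ln (real b) \<noteq> 0" using b by simp
      then show ?thesis by (simp add: inverse_eq_divide del: of_nat_Suc)
    qed
    ultimately have "summable (\<lambda>k. inverse (real (Suc k)))" by simp
    then show False using not_summable_harmonic[where 'a=real] summable_Suc_iff[of "\<lambda>n. inverse (real n)"]
      by (simp add: inverse_eq_divide)
  qed
  then have "AE \<omega> in M. \<exists>\<^sub>F k in sequentially. \<omega> \<notin> {\<omega> \<in> space M. T (B k) \<omega> < t k}"
    by (intro second_borel_cantelli[OF ind]) (simp add: compl)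
  then show ?thesis
    unfolding B_def[symmetric] t_def[symmetric]
    by (rule AE_mp) (auto simp: not_less intro!: AE_I2)
qed

text \<open>The sum at b^(k+1) is the block sum plus the sum at b^k. For large b the block carries
  nearly all the variance, and the scale at b^k is only a fraction 1/b of the scale at b^(k+1), so
  the earlier sum cannot spoil a large block.\<close>

theorem frequently_ge_lil_scale:
  fixes \<epsilon> :: real
  assumes \<epsilon>: "0 < \<epsilon>"
  shows "AE \<omega> in M. \<exists>\<^sub>F n in sequentially. T (A n) \<omega> \<ge> (1 - \<epsilon>) * lil_scale n"
proof -
  \<comment> \<open>The constant obtained at the end, with \<beta> = 1/b: the losses 1 - \<beta> and
    1 + 4 \<beta> come from the tail bound, 1 - \<beta>^2 from the share of the block in the
    variance, and 2 \<beta> from the earlier sum. It tends to 1, so some b works.\<close>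
  have "((\<lambda>b::nat. (1 - 1/b) * sqrt ((1 - 1/b\<^sup>2) / (1 + 4 * (1/b))) - 2/b) \<longlongrightarrow> (1::real)) sequentially"
    by real_asymp
  then have "\<forall>\<^sub>F b::nat in sequentially. (1 - 1/b) * sqrt ((1 - 1/b\<^sup>2) / (1 + 4 * (1/b))) - 2/b > 1 - \<epsilon>"
    using \<epsilon> by (intro order_tendstoD(1)) auto
  then obtain b :: nat where b: "(1 - 1/b) * sqrt ((1 - 1/b\<^sup>2) / (1 + 4 * (1/b))) - 2/b > 1 - \<epsilon>" "b \<ge> 3"
    using eventually_happens[OF eventually_conj[OF _ eventually_ge_at_top[of "3::nat"]]] by fastforce
  define \<beta> where "\<beta> = 1 / real b"
  define V where "V k = real (b ^ Suc k choose 2) - real (b ^ k choose 2)" for k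
  have \<beta>: "0 < \<beta>" "\<beta> < 1" using b(2) by (auto simp: \<beta>_def)
  have pow_top: "filterlim (\<lambda>k. b ^ k) at_top sequentially"
  proof -
    have "1 < real b" using b by simp
    then have "filterlim (\<lambda>k. real b ^ k) at_top sequentially" by real_asymp
    then have "filterlim (\<lambda>k. real (b ^ k)) at_top sequentially" by simp
    then show ?thesis by (simp only: filterlim_sequentially_iff_filterlim_real)
  qed
  have b2: "2 \<le> b" using b by simp
  have AE1: "AE \<omega> in M. \<exists>\<^sub>F k in sequentially. T (A (b ^ Suc k) - A (b ^ k)) \<omega> \<ge>
      (1 - \<beta>) * sqrt (2 * V k * ln (ln (real (b ^ Suc k))) / (1 + 4 * \<beta>))"
    using frequently_block_sum_ge[OF b2] by (simp add: \<beta>_def V_def)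
  \<comment> \<open>The crude constant 2 suffices, as it gets multiplied by \<beta>.\<close>
  have AE2: "AE \<omega> in M. \<forall>\<^sub>F n in sequentially. T (A n) \<omega> \<ge> - 2 * lil_scale n"
    using eventually_ge_lil_scale[of 1] by simp
  show ?thesis
    using AE1 AE2
  proof (eventually_elim)
    case (elim \<omega>)
    have "\<forall>\<^sub>F k in sequentially. T (A (b ^ k)) \<omega> \<ge> - 2 * lil_scale (b ^ k)"
      using elim(2) pow_top by (rule eventually_compose_filterlim)
    moreover have "\<forall>\<^sub>F k in sequentially. 3 \<le> b ^ k"
      using pow_top by (simp add: filterlim_at_top)
    ultimately have ev: "\<forall>\<^sub>F k in sequentially. T (A (b ^ k)) \<omega> \<ge> - 2 * lil_scale (b ^ k) \<and> 3 \<le> b ^ k"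
      by (rule eventually_conj)
    have "\<exists>\<^sub>F k in sequentially. T (A (b ^ Suc k)) \<omega> \<ge> (1 - \<epsilon>) * lil_scale (b ^ Suc k)"
    proof (rule frequently_rev_mp[OF elim(1)], rule eventually_mono[OF ev], intro impI)
      fix k
      assume k: "T (A (b ^ k)) \<omega> \<ge> - 2 * lil_scale (b ^ k) \<and> 3 \<le> b ^ k"
      assume big: "T (A (b ^ Suc k) - A (b ^ k)) \<omega> \<ge>
        (1 - \<beta>) * sqrt (2 * V k * ln (ln (real (b ^ Suc k))) / (1 + 4 * \<beta>))"
      define L where "L = ln (ln (real (b ^ Suc k)))"
      define N where "N = real (b ^ Suc k choose 2)"
      have pw: "b ^ k \<le> b ^ Suc k" using b by simp
      have k3: "3 \<le> b ^ Suc k" using k pw by linarith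
      have L: "L \<ge> 0" "ln (ln (real (b ^ k))) \<le> L"
        unfolding L_def using ln_ln_nonneg[of "b ^ Suc k"] ln_ln_mono[of "b ^ k" "b ^ Suc k"] k pw
        by (metis order.trans)+
      have Nk: "real (b ^ k choose 2) \<le> \<beta>\<^sup>2 * N"
      proof -
        define x where "x = real (b ^ k)"
        have "real b * x * (real b * x - real b) \<le> real b * x * (real b * x - 1)"
          using b by (intro mult_left_mono) (auto simp: x_def)
        then have "real b ^ 2 * (x * (x - 1)) \<le> real b * x * (real b * x - 1)"
          by (simp add: power2_eq_square algebra_simps)
        then have "real b ^ 2 * real (b ^ k choose 2) \<le> N"
          by (simp add: real_choose_2 x_def N_def)
        then show ?thesis using b by (simp add: \<beta>_def field_simps power2_eq_square)
      qed
      then have V: "V k \<ge> (1 - \<beta>\<^sup>2) * N" by (simp add: V_def N_def algebra_simps)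
      have N: "N \<ge> 0" by (simp add: N_def)
      have sc: "lil_scale (b ^ Suc k) = sqrt (2 * N * L)" by (simp add: lil_scale_def N_def L_def)
      have "lil_scale (b ^ k) \<le> sqrt (2 * (\<beta>\<^sup>2 * N) * L)"
        unfolding lil_scale_def using Nk L N k ln_ln_nonneg[of "b ^ k"]
        by (intro real_sqrt_le_mono mult_mono) auto
      also have "2 * (\<beta>\<^sup>2 * N) * L = \<beta>\<^sup>2 * (2 * N * L)" by simp
      finally have s1: "lil_scale (b ^ k) \<le> \<beta> * lil_scale (b ^ Suc k)"
        using \<beta> by (simp only: sc real_sqrt_mult real_sqrt_abs abs_of_pos)
      have "(1 - \<beta>\<^sup>2) / (1 + 4 * \<beta>) * (2 * N * L) = 2 * ((1 - \<beta>\<^sup>2) * N) * L / (1 + 4 * \<beta>)" by simp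
      also have "\<dots> \<le> 2 * V k * L / (1 + 4 * \<beta>)"
        using V L \<beta> by (intro divide_right_mono mult_right_mono mult_left_mono) auto
      finally have "sqrt ((1 - \<beta>\<^sup>2) / (1 + 4 * \<beta>)) * lil_scale (b ^ Suc k) \<le> sqrt (2 * V k * L / (1 + 4 * \<beta>))"
        unfolding sc real_sqrt_mult[symmetric] by (rule real_sqrt_le_mono)
      then have "(1 - \<beta>) * (sqrt ((1 - \<beta>\<^sup>2) / (1 + 4 * \<beta>)) * lil_scale (b ^ Suc k)) \<le>
          (1 - \<beta>) * sqrt (2 * V k * L / (1 + 4 * \<beta>))"
        using \<beta> by (intro mult_left_mono) auto
      also have "\<dots> \<le> T (A (b ^ Suc k) - A (b ^ k)) \<omega>" using big by (simp only: L_def)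
      also have "\<dots> = T (A (b ^ Suc k)) \<omega> - T (A (b ^ k)) \<omega>"
        unfolding T_def using sum.subset_diff[OF monoD[OF mono_A pw] finite_A, of "\<lambda>e. \<eta> e \<omega>"] by simp
      finally have "((1 - \<beta>) * sqrt ((1 - \<beta>\<^sup>2) / (1 + 4 * \<beta>)) - 2 * \<beta>) * lil_scale (b ^ Suc k) \<le> T (A (b ^ Suc k)) \<omega>"
        using k s1 by (simp add: algebra_simps)
      moreover have "(1 - \<epsilon>) * lil_scale (b ^ Suc k) \<le>
          ((1 - \<beta>) * sqrt ((1 - \<beta>\<^sup>2) / (1 + 4 * \<beta>)) - 2 * \<beta>) * lil_scale (b ^ Suc k)"
        using b(1) by (intro mult_right_mono lil_scale_nonneg k3) (simp add: \<beta>_def power_divide)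
      ultimately show "T (A (b ^ Suc k)) \<omega> \<ge> (1 - \<epsilon>) * lil_scale (b ^ Suc k)" by linarith
    qed
    then have "\<exists>\<^sub>F k in sequentially. T (A (b ^ k)) \<omega> \<ge> (1 - \<epsilon>) * lil_scale (b ^ k)"
      unfolding frequently_sequentially by (meson le_Suc_eq le_refl order.trans)
    then show ?case
    proof (rule contrapos_pp)
      assume "\<not> (\<exists>\<^sub>F n in sequentially. T (A n) \<omega> \<ge> (1 - \<epsilon>) * lil_scale n)"
      then have "\<forall>\<^sub>F n in sequentially. \<not> T (A n) \<omega> \<ge> (1 - \<epsilon>) * lil_scale n" by (simp add: not_frequently)
      then have "\<forall>\<^sub>F k in sequentially. \<not> T (A (b ^ k)) \<omega> \<ge> (1 - \<epsilon>) * lil_scale (b ^ k)"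
        using pow_top by (rule eventually_compose_filterlim)
      then show "\<not> (\<exists>\<^sub>F k in sequentially. T (A (b ^ k)) \<omega> \<ge> (1 - \<epsilon>) * lil_scale (b ^ k))"
        by (simp add: not_frequently)
    qed
  qed
qed

theorem law_of_iterated_logarithm:
  "AE \<omega> in M. limsup (\<lambda>n. ereal (T (A n) \<omega> / lil_scale n)) = 1"
proof -
  \<comment> \<open>Countably many values of \<epsilon>, so that the exceptional null sets can be
    united; all are at most 1, as the upper half requires.\<close>
  have "AE \<omega> in M. (\<forall>j. \<forall>\<^sub>F n in sequentially. T (A n) \<omega> \<le> (1 + 1 / Suc j) * lil_scale n) \<and>
      (\<forall>j. \<exists>\<^sub>F n in sequentially. T (A n) \<omega> \<ge> (1 - 1 / Suc j) * lil_scale n)"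
    using eventually_le_lil_scale frequently_ge_lil_scale by (simp add: AE_all_countable)
  then show ?thesis
  proof eventually_elim
    case (elim \<omega>)
    have pos: "\<forall>\<^sub>F n in sequentially. 0 < lil_scale n"
      unfolding lil_scale_def real_choose_2 by real_asymp
    have lim: "(\<lambda>j. ereal (1 + 1 / Suc j)) \<longlonglongrightarrow> 1" "(\<lambda>j. ereal (1 - 1 / Suc j)) \<longlonglongrightarrow> 1"
      unfolding one_ereal_def lim_ereal by real_asymp+
    have "limsup (\<lambda>n. ereal (T (A n) \<omega> / lil_scale n)) \<le> ereal (1 + 1 / Suc j)" for j
    proof (rule Limsup_bounded)
      show "\<forall>\<^sub>F n in sequentially. ereal (T (A n) \<omega> / lil_scale n) \<le> ereal (1 + 1 / Suc j)"
        using elim[THEN conjunct1, rule_format, of j] pos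
        by eventually_elim (simp add: pos_divide_le_eq)
    qed
    then have le: "limsup (\<lambda>n. ereal (T (A n) \<omega> / lil_scale n)) \<le> 1"
      by (intro LIMSEQ_le_const[OF lim(1)]) auto
    have "ereal (1 - 1 / Suc j) \<le> limsup (\<lambda>n. ereal (T (A n) \<omega> / lil_scale n))" for j
    proof (rule ccontr)
      assume "\<not> ereal (1 - 1 / Suc j) \<le> limsup (\<lambda>n. ereal (T (A n) \<omega> / lil_scale n))"
      then have "\<forall>\<^sub>F n in sequentially. ereal (T (A n) \<omega> / lil_scale n) < ereal (1 - 1 / Suc j)"
        by (intro Limsup_lessD) (simp only: not_le)
      with pos have "\<forall>\<^sub>F n in sequentially. \<not> T (A n) \<omega> \<ge> (1 - 1 / Suc j) * lil_scale n"
        by eventually_elim (simp add: pos_divide_less_eq)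
      with elim[THEN conjunct2, rule_format, of j] show False by (simp add: frequently_def)
    qed
    then have "1 \<le> limsup (\<lambda>n. ereal (T (A n) \<omega> / lil_scale n))"
      by (intro LIMSEQ_le_const2[OF lim(2)]) auto
    with le show ?case by (rule antisym)
  qed
qed

end

section \<open>Copies of a graph in complete graphs\<close>

definition map_graph :: "('a \<Rightarrow> 'b) \<Rightarrow> 'a graph \<Rightarrow> 'b graph" where
  "map_graph g K = (g ` verts K, (`) g ` edges K)"

lemma verts_map_graph: "verts (map_graph g K) = g ` verts K"
  and edges_map_graph: "edges (map_graph g K) = (`) g ` edges K"
  by (simp_all add: map_graph_def)

lemma simple_graph_edgeD:
  assumes "simple_graph K" "e \<in> edges K"
  shows "e \<subseteq> verts K" "card e = 2" "finite e"
proof -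
  show "e \<subseteq> verts K" and card: "card e = 2" using assms by (auto simp: simple_graph_def pairs_def)
  show "finite e" using card by (intro card_ge_0_finite) simp
qed

lemma simple_graph_edgeE:
  assumes "simple_graph K" "e \<in> edges K"
  obtains x y where "e = {x, y}" "x \<noteq> y" "x \<in> verts K" "y \<in> verts K"
  using simple_graph_edgeD[OF assms] by (auto simp: card_2_iff)

lemma inj_on_image_edges:
  assumes "simple_graph K" "inj_on g (verts K)"
  shows "inj_on ((`) g) (edges K)"
  by (rule inj_on_subset[OF inj_on_image_Pow[OF assms(2)]]) (use simple_graph_edgeD[OF assms(1)] in auto)

lemma simple_graph_map_graph:
  assumes "simple_graph K" "inj_on g (verts K)"
  shows "simple_graph (map_graph g K)"
  unfolding simple_graph_def pairs_def map_graph_def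
  using simple_graph_edgeD[OF assms(1)] card_image[OF inj_on_subset[OF assms(2)]] by auto

lemma isomorphic_map_graph:
  assumes "simple_graph K" "inj_on g (verts K)"
  shows "isomorphic (map_graph g K) K"
proof -
  define f where "f = the_inv_into (verts K) g"
  have fg: "f (g x) = x" if "x \<in> verts K" for x using that assms(2) by (simp add: f_def the_inv_into_f_f)
  have "bij_betw f (verts (map_graph g K)) (verts K)"
    unfolding f_def verts_map_graph using assms(2) by (intro bij_betw_the_inv_into) (simp add: bij_betw_def)
  moreover have "{g x, g y} \<in> edges (map_graph g K) \<longleftrightarrow> {x, y} \<in> edges K"
    if xy: "x \<in> verts K" "y \<in> verts K" for x y
  proof
    assume "{g x, g y} \<in> edges (map_graph g K)"
    then obtain e where e: "e \<in> edges K" "g ` {x, y} = g ` e" by (auto simp: edges_map_graph)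
    then have "{x, y} = e"
      using inj_on_image_eq_iff[OF assms(2), of "{x, y}" e] simple_graph_edgeD(1)[OF assms(1) e(1)] xy by auto
    then show "{x, y} \<in> edges K" using e by simp
  next
    assume "{x, y} \<in> edges K"
    then have "g ` {x, y} \<in> edges (map_graph g K)" unfolding edges_map_graph by (rule imageI)
    then show "{g x, g y} \<in> edges (map_graph g K)" by simp
  qed
  ultimately show ?thesis unfolding isomorphic_def by (intro exI[of _ f]) (auto simp: verts_map_graph fg)
qed

lemma isomorphic_trans:
  assumes "isomorphic A B" "isomorphic B C"
  shows "isomorphic A C"
proof -
  obtain f where f: "bij_betw f (verts A) (verts B)"
    "\<forall>x\<in>verts A. \<forall>y\<in>verts A. {x, y} \<in> edges A \<longleftrightarrow> {f x, f y} \<in> edges B"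
    using assms(1) unfolding isomorphic_def by auto
  obtain g where g: "bij_betw g (verts B) (verts C)"
    "\<forall>x\<in>verts B. \<forall>y\<in>verts B. {x, y} \<in> edges B \<longleftrightarrow> {g x, g y} \<in> edges C"
    using assms(2) unfolding isomorphic_def by auto
  have "f x \<in> verts B" if "x \<in> verts A" for x using f(1) that by (rule bij_betwE[THEN bspec])
  then show ?thesis
    unfolding isomorphic_def using f g bij_betw_trans[OF f(1) g(1)]
    by (intro exI[of _ "g \<circ> f"]) auto
qed

lemma isomorphic_card_verts: "isomorphic S K \<Longrightarrow> card (verts S) = card (verts K)"
  unfolding isomorphic_def by (auto intro: bij_betw_same_card)

text \<open>An isomorphism only speaks of sets {x, y} of vertices. Simplicity of both graphs ensures
  that every edge has this form, so that edges correspond bijectively.\<close>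

lemma isomorphic_card_edges:
  assumes "isomorphic S K" "simple_graph S" "simple_graph K"
  shows "card (edges S) = card (edges K)"
proof -
  obtain f where f: "bij_betw f (verts S) (verts K)"
    "\<forall>x\<in>verts S. \<forall>y\<in>verts S. {x, y} \<in> edges S \<longleftrightarrow> {f x, f y} \<in> edges K"
    using assms(1) unfolding isomorphic_def by auto
  have inj: "inj_on f (verts S)" using f(1) by (simp add: bij_betw_def)
  have "(`) f ` edges S = edges K"
  proof (intro equalityI subsetI)
    fix e assume "e \<in> (`) f ` edges S"
    then obtain e' where e': "e' \<in> edges S" "e = f ` e'" by auto
    obtain x y where "e' = {x, y}" "x \<in> verts S" "y \<in> verts S" using simple_graph_edgeE[OF assms(2) e'(1)] by metis
    then show "e \<in> edges K" using f(2) e' by auto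
  next
    fix e assume e: "e \<in> edges K"
    obtain x y where xy: "e = {x, y}" "x \<in> verts K" "y \<in> verts K" using simple_graph_edgeE[OF assms(3) e] by metis
    obtain a b where ab: "a \<in> verts S" "b \<in> verts S" "f a = x" "f b = y"
      using f(1) xy(2,3) unfolding bij_betw_def by (metis imageE)
    then have "{a, b} \<in> edges S" using f(2) e xy(1) by auto
    then have "f ` {a, b} \<in> (`) f ` edges S" by (rule imageI)
    then show "e \<in> (`) f ` edges S" using ab xy(1) by simp
  qed
  then show ?thesis using card_image[OF inj_on_image_edges[OF assms(2) inj]] by simp
qed

text \<open>Used twice with \<open>A\<close> and \<open>B\<close> single edges: for a permutation of
  [n] carrying one edge to another, and for placing \<open>H\<close> with a chosen edge on {1,
  2}.\<close>

lemma bij_betw_extending_subset: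
  assumes "finite V" "finite W" "card V = card W" "A \<subseteq> V" "B \<subseteq> W" "card A = card B"
  obtains g where "bij_betw g V W" "g ` A = B"
proof -
  have fin: "finite A" "finite B" using assms by (auto intro: finite_subset)
  obtain g1 where g1: "bij_betw g1 A B" using finite_same_card_bij[OF fin assms(6)] by auto
  have "card (V - A) = card (W - B)" using assms fin by (simp add: card_Diff_subset)
  then obtain g2 where g2: "bij_betw g2 (V - A) (W - B)"
    using assms by (metis finite_Diff finite_same_card_bij)
  define g where "g x = (if x \<in> A then g1 x else g2 x)" for x
  have 1: "bij_betw g A B" using g1 by (subst bij_betw_cong[of A g g1]) (auto simp: g_def)
  have 2: "bij_betw g (V - A) (W - B)" using g2 by (subst bij_betw_cong[of "V - A" g g2]) (auto simp: g_def)
  have "bij_betw g (A \<union> (V - A)) (B \<union> (W - B))" using 1 2 by (rule bij_betw_combine) auto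
  moreover have "A \<union> (V - A) = V" "B \<union> (W - B) = W" using assms by auto
  ultimately show thesis using 1 by (intro that[of g]) (auto simp: bij_betw_def)
qed

section \<open>Copies in the complete graph on [n] and how many pass through an edge\<close>

text \<open>A deterministic index set: a copy in the random graph is one of these whose edges are
  all present, so the count becomes a fixed sum of random indicators.\<close>

definition complete_copies :: "'a graph \<Rightarrow> nat \<Rightarrow> nat graph set" where
  "complete_copies H n = copies H ({1..n}, pairs {1..n})"

text \<open>The edge {1, 2} is an arbitrary representative; by symmetry every other edge on [n]
  gives the same number.\<close>

definition edge_degree :: "'a graph \<Rightarrow> nat \<Rightarrow> nat" where
  "edge_degree H n = card {S \<in> complete_copies H n. {1, 2} \<in> edges S}"

lemma finite_pairs: "finite V \<Longrightarrow> finite (pairs V)"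
  unfolding pairs_def by (rule finite_subset[of _ "Pow V"]) auto

lemma card_pairs: "finite V \<Longrightarrow> card (pairs V) = card V choose 2"
  unfolding pairs_def by (rule n_subsets)

lemma pairs_mono: "V \<subseteq> W \<Longrightarrow> pairs V \<subseteq> pairs W"
  by (auto simp: pairs_def)

lemma complete_copies_iff:
  "S \<in> complete_copies H n \<longleftrightarrow> simple_graph S \<and> verts S \<subseteq> {1..n} \<and> isomorphic S H"
proof -
  have "edges S \<subseteq> pairs {1..n}" if "simple_graph S" "verts S \<subseteq> {1..n}"
    using that pairs_mono[OF that(2)] by (auto simp: simple_graph_def)
  then show ?thesis by (auto simp: complete_copies_def copies_def subgraph_def)
qed

lemma complete_copies_edges: "S \<in> complete_copies H n \<Longrightarrow> edges S \<subseteq> pairs {1..n}"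
  by (auto simp: complete_copies_def copies_def subgraph_def)

lemma finite_complete_copies: "finite (complete_copies H n)"
proof (rule finite_subset)
  show "complete_copies H n \<subseteq> Pow {1..n} \<times> Pow (pairs {1..n})"
    by (auto simp: complete_copies_def copies_def subgraph_def)
qed (simp add: finite_pairs)

lemma map_graph_complete_copies:
  assumes "S \<in> complete_copies H m" "inj_on g (verts S)" "g ` verts S \<subseteq> {1..n}"
  shows "map_graph g S \<in> complete_copies H n"
  using assms simple_graph_map_graph[of S g] isomorphic_map_graph[of S g]
  by (auto simp: complete_copies_iff verts_map_graph intro: isomorphic_trans)

text \<open>A permutation of [n] carrying e to e' maps the copies through e injectively to copies
  through e'. Exchanging the roles of e and e' gives equality.\<close>

lemma card_copies_through_edge_le:
  assumes e: "e \<in> pairs {1..n}" "e' \<in> pairs {1..n}"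
  shows "card {S \<in> complete_copies H n. e \<in> edges S} \<le> card {S \<in> complete_copies H n. e' \<in> edges S}"
proof -
  obtain g where g: "bij_betw g {1..n} {1..n}" "g ` e = e'"
    by (rule bij_betw_extending_subset[of "{1..n}" "{1..n}" e e']) (use e in \<open>auto simp: pairs_def\<close>)
  have inj: "inj_on g {1..n}" using g(1) by (simp add: bij_betw_def)
  have sub: "verts S \<subseteq> {1..n}" "edges S \<subseteq> Pow {1..n}" if "S \<in> complete_copies H n" for S
    using that complete_copies_edges[OF that] by (auto simp: complete_copies_iff pairs_def)
  show ?thesis
  proof (rule card_inj_on_le[where f="map_graph g"])
    show "inj_on (map_graph g) {S \<in> complete_copies H n. e \<in> edges S}"
    proof (rule inj_onI)
      fix S S' assume S: "S \<in> {S \<in> complete_copies H n. e \<in> edges S}" "S' \<in> {S \<in> complete_copies H n. e \<in> edges S}"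
        and eq: "map_graph g S = map_graph g S'"
      have "verts S = verts S'"
        using eq sub S inj_on_image_eq_iff[OF inj, of "verts S" "verts S'"] by (auto simp: map_graph_def)
      moreover have "edges S = edges S'"
        using eq sub S inj_on_image_eq_iff[OF inj_on_image_Pow[OF inj], of "edges S" "edges S'"] by (auto simp: map_graph_def)
      ultimately show "S = S'" by (rule prod_eqI)
    qed
    show "map_graph g ` {S \<in> complete_copies H n. e \<in> edges S} \<subseteq> {S \<in> complete_copies H n. e' \<in> edges S}"
    proof (intro image_subsetI CollectI conjI)
      fix S assume S: "S \<in> {S \<in> complete_copies H n. e \<in> edges S}"
      show "map_graph g S \<in> complete_copies H n"
      proof (rule map_graph_complete_copies)
        show "S \<in> complete_copies H n" using S by simp
        show "inj_on g (verts S)" by (rule inj_on_subset[OF inj sub(1)]) (use S in simp)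
        show "g ` verts S \<subseteq> {1..n}" using g(1) sub(1)[of S] S by (auto simp: bij_betw_def)
      qed
      show "e' \<in> edges (map_graph g S)" using S g(2) by (auto simp: edges_map_graph)
    qed
  qed (simp add: finite_complete_copies)
qed

lemma card_copies_through_edge:
  assumes "e \<in> pairs {1..n}"
  shows "card {S \<in> complete_copies H n. e \<in> edges S} = edge_degree H n"
proof -
  \<comment> \<open>The existence of any pair forces n to be at least 2, which makes {1, 2} a pair
    within [n].\<close>
  have "card e \<le> card {1..n}" using assms by (intro card_mono) (auto simp: pairs_def)
  then have "{1, 2} \<in> pairs {1..n}" using assms by (auto simp: pairs_def)
  then show ?thesis
    unfolding edge_degree_def using assms by (intro antisym card_copies_through_edge_le)
qed

text \<open>One copy for each choice of the other vertices: a fixed edge of \<open>H\<close> is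
  placed on {1, 2} and the remaining vertices on \<open>U\<close>. Different \<open>U\<close> give
  different vertex sets, hence different copies. This has the right order in n and avoids counting
  automorphisms.\<close>

lemma edge_degree_ge:
  assumes H: "simple_graph H" "finite (verts H)" "edges H \<noteq> {}" and n: "n \<ge> 2"
  shows "edge_degree H n \<ge> (n - 2) choose (card (verts H) - 2)"
proof -
  define v where "v = card (verts H)"
  obtain e where e: "e \<in> edges H" using H(3) by auto
  have e2: "e \<subseteq> verts H" "card e = 2" using simple_graph_edgeD[OF H(1) e] by auto
  then have v: "v \<ge> 2" using card_mono[OF H(2), of e] by (simp add: v_def)
  define \<U> where "\<U> = {U. U \<subseteq> {3..n} \<and> card U = v - 2}"
  have "\<exists>S. S \<in> complete_copies H n \<and> {1, 2} \<in> edges S \<and> verts S = U \<union> {1, 2}" if "U \<in> \<U>" for U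
  proof -
    have U: "finite U" "U \<subseteq> {3..n}" "card U = v - 2" using that by (auto simp: \<U>_def intro: finite_subset)
    have "card (U \<union> {1, 2}) = v" using U v by (subst card_Un_disjoint) auto
    then obtain g where g: "bij_betw g (verts H) (U \<union> {1, 2})" "g ` e = {1, 2}"
      using bij_betw_extending_subset[of "verts H" "U \<union> {1, 2}" e "{1, 2::nat}"] H U e2 by (auto simp: v_def)
    then have inj: "inj_on g (verts H)" and img: "g ` verts H = U \<union> {1, 2}" by (auto simp: bij_betw_def)
    have "map_graph g H \<in> complete_copies H n"
      using simple_graph_map_graph[OF H(1) inj] isomorphic_map_graph[OF H(1) inj] img U n
      by (auto simp: complete_copies_iff verts_map_graph)
    moreover have "{1, 2} \<in> edges (map_graph g H)" unfolding edges_map_graph using e g(2) by blast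
    ultimately show ?thesis using img by (intro exI[of _ "map_graph g H"]) (simp add: verts_map_graph)
  qed
  then obtain S where S: "\<And>U. U \<in> \<U> \<Longrightarrow> S U \<in> complete_copies H n \<and> {1, 2} \<in> edges (S U) \<and> verts (S U) = U \<union> {1, 2}"
    by metis
  have "card \<U> \<le> card {S \<in> complete_copies H n. {1, 2} \<in> edges S}"
  proof (rule card_inj_on_le[where f=S])
    show "inj_on S \<U>"
    proof (rule inj_onI)
      fix U U' assume UU: "U \<in> \<U>" "U' \<in> \<U>" "S U = S U'"
      have "U \<union> {1, 2} = U' \<union> {1, 2}" using S[OF UU(1)] S[OF UU(2)] UU(3) by simp
      moreover have "1 \<notin> U" "2 \<notin> U" "1 \<notin> U'" "2 \<notin> U'" using UU by (auto simp: \<U>_def)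
      ultimately show "U = U'" by blast
    qed
    show "S ` \<U> \<subseteq> {S \<in> complete_copies H n. {1, 2} \<in> edges S}" using S by auto
  qed (simp add: finite_complete_copies)
  moreover have "card \<U> = (n - 2) choose (v - 2)"
    unfolding \<U>_def using n_subsets[of "{3..n}" "v - 2"] by simp
  ultimately show ?thesis by (simp add: edge_degree_def v_def)
qed

text \<open>Double counting: a point of the union lies in at least two of the sets unless it is private to
  one of them.\<close>

lemma card_Union_of_overlapping_sets:
  fixes V :: "'i \<Rightarrow> 'b set"
  assumes "finite J" "\<And>i. i \<in> J \<Longrightarrow> finite (V i)" "\<And>i. i \<in> J \<Longrightarrow> card (V i) = v"
    and "\<And>i. i \<in> J \<Longrightarrow> card (V i \<inter> (\<Union>j\<in>J - {i}. V j)) \<ge> 3"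
  shows "2 * card (\<Union>i\<in>J. V i) + 3 * card J \<le> 2 * v * card J"
proof -
  define W where "W = (\<Union>i\<in>J. V i)"
  define P where "P i = V i - (\<Union>j\<in>J - {i}. V j)" for i
  have W: "finite W" using assms by (auto simp: W_def)
  have "2 \<le> (\<Sum>i\<in>J. of_bool (x \<in> V i) + of_bool (x \<in> P i) :: nat)" if x: "x \<in> W" for x
  proof -
    obtain i where i: "i \<in> J" "x \<in> V i" using x unfolding W_def by blast
    show ?thesis
    proof (cases "x \<in> P i")
      case True
      then have "2 = (\<Sum>i\<in>{i}. of_bool (x \<in> V i) + of_bool (x \<in> P i) :: nat)" using i by simp
      also have "\<dots> \<le> (\<Sum>i\<in>J. of_bool (x \<in> V i) + of_bool (x \<in> P i))" using i assms(1) by (intro sum_mono2) auto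
      finally show ?thesis .
    next
      case False
      then obtain j where j: "j \<in> J" "j \<noteq> i" "x \<in> V j" using i by (auto simp: P_def)
      have "2 = (\<Sum>i\<in>{i, j}. of_bool (x \<in> V i) :: nat)" using i j by simp
      also have "\<dots> \<le> (\<Sum>i\<in>{i, j}. of_bool (x \<in> V i) + of_bool (x \<in> P i))" by (intro sum_mono) simp
      also have "\<dots> \<le> (\<Sum>i\<in>J. of_bool (x \<in> V i) + of_bool (x \<in> P i))" using i j assms(1) by (intro sum_mono2) auto
      finally show ?thesis .
    qed
  qed
  then have "(\<Sum>x\<in>W. 2) \<le> (\<Sum>x\<in>W. \<Sum>i\<in>J. of_bool (x \<in> V i) + of_bool (x \<in> P i) :: nat)"
    by (intro sum_mono) auto
  also have "\<dots> = (\<Sum>i\<in>J. \<Sum>x\<in>W. of_bool (x \<in> V i) + of_bool (x \<in> P i))" by (rule sum.swap)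
  also have "\<dots> = (\<Sum>i\<in>J. card (V i) + card (P i))"
  proof (intro sum.cong refl)
    fix i assume "i \<in> J"
    then have "W \<inter> V i = V i" "W \<inter> P i = P i" by (auto simp: W_def P_def)
    then show "(\<Sum>x\<in>W. of_bool (x \<in> V i) + of_bool (x \<in> P i)) = card (V i) + card (P i)"
      using W by (simp add: sum.distrib sum_of_bool_eq)
  qed
  finally have A: "2 * card W \<le> (\<Sum>i\<in>J. card (V i) + card (P i))" by simp
  have "card (P i) + 3 \<le> v" if "i \<in> J" for i
  proof -
    have "card (P i) + card (V i \<inter> (\<Union>j\<in>J - {i}. V j)) = card (V i)"
      unfolding P_def using assms(2)[OF that] by (metis card_Int_Diff add.commute)
    then show ?thesis using assms(3,4)[OF that] by simp
  qed
  then have "(\<Sum>i\<in>J. card (V i) + card (P i) + 3) \<le> (\<Sum>i\<in>J. 2 * v)"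
    using assms(3) by (intro sum_mono) fastforce
  then have "(\<Sum>i\<in>J. card (V i) + card (P i)) + 3 * card J \<le> 2 * v * card J"
    by (simp add: sum.distrib mult_ac)
  then show ?thesis using A by (simp add: W_def mult_ac)
qed

section \<open>Polynomials in the edge variables\<close>

context infinite_random_graph
begin

definition \<xi> :: "nat set \<Rightarrow> 'w \<Rightarrow> real" where
  "\<xi> e \<omega> = of_bool (e \<in> edges (G \<omega>))"

definition monomial :: "nat set set \<Rightarrow> 'w \<Rightarrow> real" where
  "monomial D \<omega> = (\<Prod>e\<in>D. \<xi> e \<omega>)"

text \<open>\<open>monomial F\<close> is the product of the factors p + (\<xi> e - p). The two
  subtracted terms are the constant and the linear part of its expansion in the centred
  variables.\<close>

definition centred_product :: "nat set set \<Rightarrow> 'w \<Rightarrow> real" where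
  "centred_product F \<omega> = monomial F \<omega> - p ^ card F - p ^ (card F - 1) * (\<Sum>e\<in>F. \<xi> e \<omega> - p)"

lemma \<xi>_bounds: "0 \<le> \<xi> e \<omega>" "\<xi> e \<omega> \<le> 1"
  by (simp_all add: \<xi>_def)

lemma measurable_\<xi>: "e \<in> pairs {1..} \<Longrightarrow> \<xi> e \<in> borel_measurable M"
proof -
  assume "e \<in> pairs {1..}"
  then have [measurable]: "{\<omega> \<in> space M. e \<in> edges (G \<omega>)} \<in> events"
    using indep_edges by (auto simp: indep_events_def)
  show ?thesis unfolding \<xi>_def[abs_def] of_bool_def by measurable
qed

lemma p_bounds: "0 \<le> p" "p \<le> 1"
proof -
  have "{1, 2} \<in> pairs {1::nat..}" by (auto simp: pairs_def)
  from prob_edge[OF this] show "0 \<le> p" "p \<le> 1" by (metis measure_nonneg, metis prob_le_1)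
qed

lemma monomial_eq_of_bool: "finite D \<Longrightarrow> monomial D \<omega> = of_bool (D \<subseteq> edges (G \<omega>))"
  unfolding monomial_def \<xi>_def by (induction D rule: finite_induct) auto

lemma monomial_bounds: "0 \<le> monomial D \<omega>" "monomial D \<omega> \<le> 1"
  unfolding monomial_def using \<xi>_bounds by (auto intro: prod_nonneg prod_le_1)

lemma monomial_singleton: "monomial {e} = \<xi> e"
  by (simp add: monomial_def fun_eq_iff)

lemma monomial_empty: "monomial {} = (\<lambda>_. 1)"
  by (simp add: monomial_def fun_eq_iff)

text \<open>The edge variables take the values 0 and 1, so squares collapse; this keeps products
  within the linear span of the monomials.\<close>

lemma monomial_mult:
  "finite D \<Longrightarrow> finite E \<Longrightarrow> monomial D \<omega> * monomial E \<omega> = monomial (D \<union> E) \<omega>"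
  by (simp add: monomial_eq_of_bool)

lemma measurable_monomial: "D \<subseteq> pairs {1..} \<Longrightarrow> monomial D \<in> borel_measurable M"
  unfolding monomial_def[abs_def] by (intro borel_measurable_prod measurable_\<xi>) auto

lemma integrable_monomial: "D \<subseteq> pairs {1..} \<Longrightarrow> integrable M (monomial D)"
  using monomial_bounds by (intro integrable_const_bound[of _ 1] measurable_monomial) auto

lemma expectation_monomial:
  assumes "finite D" "D \<subseteq> pairs {1..}"
  shows "expectation (monomial D) = p ^ card D"
proof (cases "D = {}")
  case False
  have "expectation (monomial D) = expectation (indicator (\<Inter>e\<in>D. {\<omega> \<in> space M. e \<in> edges (G \<omega>)}))"
    using False by (intro Bochner_Integration.integral_cong) (auto simp: monomial_eq_of_bool assms indicator_def)
  also have "\<dots> = prob (\<Inter>e\<in>D. {\<omega> \<in> space M. e \<in> edges (G \<omega>)})"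
  proof -
    have "(\<Inter>e\<in>D. {\<omega> \<in> space M. e \<in> edges (G \<omega>)}) \<subseteq> space M" using False by auto
    then show ?thesis by (simp add: Int_absorb1 Int_absorb2)
  qed
  also have "\<dots> = (\<Prod>e\<in>D. prob {\<omega> \<in> space M. e \<in> edges (G \<omega>)})"
    using indep_edges False assms by (auto simp: indep_events_def)
  also have "\<dots> = (\<Prod>e\<in>D. p)" using assms prob_edge by (intro prod.cong) auto
  finally show ?thesis by simp
qed (simp add: monomial_empty prob_space)

section \<open>The span of edge monomials and orthogonality\<close>

text \<open>The linear span of the monomials with edges in \<open>B\<close>. It records which edges
  a random variable depends on without generated sigma-algebras, and reduces integrability and
  orthogonality to monomials by induction.\<close>

inductive edge_polynomial :: "nat set set \<Rightarrow> ('w \<Rightarrow> real) \<Rightarrow> bool" for B where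
  monomial: "D \<subseteq> B \<Longrightarrow> edge_polynomial B (monomial D)"
| add: "edge_polynomial B f \<Longrightarrow> edge_polynomial B g \<Longrightarrow> edge_polynomial B (\<lambda>\<omega>. f \<omega> + g \<omega>)"
| scale: "edge_polynomial B f \<Longrightarrow> edge_polynomial B (\<lambda>\<omega>. c * f \<omega>)"

lemma edge_polynomial_mono: "edge_polynomial B f \<Longrightarrow> B \<subseteq> C \<Longrightarrow> edge_polynomial C f"
  by (induction rule: edge_polynomial.induct) (auto intro: edge_polynomial.intros)

lemma edge_polynomial_const: "edge_polynomial B (\<lambda>_. c)"
  using edge_polynomial.scale[OF edge_polynomial.monomial[of "{}" B], of c] by (simp add: monomial_empty)

lemma edge_polynomial_sum:
  "(\<And>i. i \<in> J \<Longrightarrow> edge_polynomial B (f i)) \<Longrightarrow> edge_polynomial B (\<lambda>\<omega>. \<Sum>i\<in>J. f i \<omega>)"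
  by (induction J rule: infinite_finite_induct)
     (auto intro: edge_polynomial_const edge_polynomial.add)

lemma edge_polynomial_mult:
  assumes "finite B" "edge_polynomial B f" "edge_polynomial B g"
  shows "edge_polynomial B (\<lambda>\<omega>. f \<omega> * g \<omega>)"
  using assms(2)
proof (induction rule: edge_polynomial.induct)
  case (monomial D)
  show ?case using assms(3)
  proof (induction rule: edge_polynomial.induct)
    case (monomial E)
    have "(\<lambda>\<omega>. monomial D \<omega> * monomial E \<omega>) = monomial (D \<union> E)"
      using monomial \<open>D \<subseteq> B\<close> assms(1) by (intro ext monomial_mult) (auto intro: finite_subset)
    then show ?case using monomial \<open>D \<subseteq> B\<close> by (auto intro!: edge_polynomial.monomial)
  next
    case (add f g)
    then show ?case using edge_polynomial.add[OF add(3,4)] by (simp add: distrib_left)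
  next
    case (scale f c)
    then show ?case using edge_polynomial.scale[OF scale(2), of c] by (simp add: mult_ac)
  qed
next
  case (add f h)
  then show ?case using edge_polynomial.add[OF add(3,4)] by (simp add: distrib_right)
next
  case (scale f c)
  then show ?case using edge_polynomial.scale[OF scale(2), of c] by (simp add: mult_ac)
qed

lemma edge_polynomial_prod:
  "finite B \<Longrightarrow> (\<And>i. i \<in> J \<Longrightarrow> edge_polynomial B (f i)) \<Longrightarrow> edge_polynomial B (\<lambda>\<omega>. \<Prod>i\<in>J. f i \<omega>)"
  by (induction J rule: infinite_finite_induct)
     (auto intro: edge_polynomial_const edge_polynomial_mult)

lemma edge_polynomial_integrable:
  "edge_polynomial B f \<Longrightarrow> B \<subseteq> pairs {1..} \<Longrightarrow> integrable M f"
  by (induction rule: edge_polynomial.induct) (auto intro!: integrable_monomial)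

lemma edge_polynomial_\<xi>: "e \<in> B \<Longrightarrow> edge_polynomial B (\<lambda>\<omega>. \<xi> e \<omega> - p)"
  using edge_polynomial.add[OF edge_polynomial.monomial[of "{e}" B] edge_polynomial_const[of B "- p"]]
  by (simp add: monomial_singleton)

lemma edge_polynomial_centred_product: "edge_polynomial F (centred_product F)"
proof -
  have "edge_polynomial F (\<lambda>\<omega>. (monomial F \<omega> + - (p ^ card F)) + (- (p ^ (card F - 1))) * (\<Sum>e\<in>F. \<xi> e \<omega> - p))"
    by (intro edge_polynomial.intros edge_polynomial_const edge_polynomial_sum edge_polynomial_\<xi>) auto
  then show ?thesis by (simp add: centred_product_def[abs_def])
qed

lemma abs_centred_product_le: "finite F \<Longrightarrow> \<bar>centred_product F \<omega>\<bar> \<le> real (card F) + 2"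
proof -
  assume F: "finite F"
  have pw: "0 \<le> p ^ k" "p ^ k \<le> 1" for k using p_bounds by (auto intro: power_le_one)
  have "\<bar>\<Sum>e\<in>F. \<xi> e \<omega> - p\<bar> \<le> (\<Sum>e\<in>F. \<bar>\<xi> e \<omega> - p\<bar>)" by (rule sum_abs)
  also have "\<dots> \<le> real (card F) * 1"
  proof (rule sum_bounded_above)
    show "\<bar>\<xi> e \<omega> - p\<bar> \<le> 1" for e using \<xi>_bounds[of e \<omega>] p_bounds by linarith
  qed
  finally have "\<bar>p ^ (card F - 1) * (\<Sum>e\<in>F. \<xi> e \<omega> - p)\<bar> \<le> 1 * real (card F)"
    unfolding abs_mult using pw by (intro mult_mono) auto
  then show ?thesis
    unfolding centred_product_def using monomial_bounds[of F \<omega>] pw[of "card F"] by linarith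
qed

text \<open>Subtracting the projections onto constants and onto single edges leaves a variable that is
  uncorrelated with every function sharing at most one edge with it.\<close>

lemma expectation_centred_product_monomial:
  assumes F: "finite F" "F \<subseteq> pairs {1..}" "F \<noteq> {}" and D: "finite D" "D \<subseteq> pairs {1..}"
    and "card (F \<inter> D) \<le> 1"
  shows "expectation (\<lambda>\<omega>. centred_product F \<omega> * monomial D \<omega>) = 0"
proof -
  define h d where "h = card F - 1" and "d = card D"
  have h: "card F = Suc h" using F by (simp add: h_def card_gt_0_iff)
  have fin: "finite (insert e D)" "insert e D \<subseteq> pairs {1..}" if "e \<in> F" for e using that F D by auto
  have ins: "\<xi> e \<omega> * monomial D \<omega> = monomial (insert e D) \<omega>" for e \<omega>
    using monomial_mult[of "{e}" D \<omega>] D by (simp add: monomial_singleton)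
  have "(\<lambda>\<omega>. centred_product F \<omega> * monomial D \<omega>) = (\<lambda>\<omega>. monomial (F \<union> D) \<omega> - p ^ Suc h * monomial D \<omega> -
      p ^ h * (\<Sum>e\<in>F. monomial (insert e D) \<omega> - p * monomial D \<omega>))"
    using monomial_mult[OF F(1) D(1)]
    by (simp add: fun_eq_iff centred_product_def h left_diff_distrib mult.assoc sum_distrib_right ins)
  then have "expectation (\<lambda>\<omega>. centred_product F \<omega> * monomial D \<omega>) = expectation (monomial (F \<union> D)) -
      p ^ Suc h * expectation (monomial D) -
      p ^ h * (\<Sum>e\<in>F. expectation (monomial (insert e D)) - p * expectation (monomial D))"
    using F D fin integrable_monomial by simp
  also have "\<dots> = p ^ card (F \<union> D) - p ^ Suc h * p ^ d - p ^ h * (\<Sum>e\<in>F. p ^ card (insert e D) - p * p ^ d)"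
    using F D fin by (simp add: expectation_monomial d_def)
  \<comment> \<open>An edge e outside \<open>D\<close> contributes nothing, since inserting it
    multiplies the expectation by p; only common edges survive.\<close>
  also have "(\<Sum>e\<in>F. p ^ card (insert e D) - p * p ^ d) = (\<Sum>e\<in>F \<inter> D. p ^ d - p * p ^ d)"
    using F D by (intro sum.mono_neutral_cong_right) (auto simp: d_def insert_absorb)
  also have "\<dots> = real (card (F \<inter> D)) * (p ^ d - p * p ^ d)" by simp
  \<comment> \<open>With no common edge the first two terms cancel. With one, their difference
    p^(h+d) - p^(h+1+d) is exactly what the linear part removes.\<close>
  also have "p ^ card (F \<union> D) - p ^ Suc h * p ^ d - p ^ h * (real (card (F \<inter> D)) * (p ^ d - p * p ^ d)) = 0"
  proof -
    have c: "card (F \<union> D) + card (F \<inter> D) = Suc h + d" using card_Un_Int[OF F(1) D(1)] h by (simp add: d_def)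
    from assms(6) consider "card (F \<inter> D) = 0" | "card (F \<inter> D) = 1" by linarith
    then show ?thesis
    proof cases
      case 1
      then have "card (F \<union> D) = Suc h + d" using c by simp
      with 1 show ?thesis by (simp add: power_add)
    next
      case 2
      then have "card (F \<union> D) = h + d" using c by simp
      with 2 show ?thesis by (simp add: power_add algebra_simps)
    qed
  qed
  finally show ?thesis .
qed

text \<open>Linear extension from monomials. It is applied with \<open>B\<close> empty to get mean
  zero, with a single edge to get orthogonality to the edge count, and with the edges of three
  copies in the fourth moment.\<close>

lemma expectation_centred_product_mult:
  assumes F: "finite F" "F \<subseteq> pairs {1..}" "F \<noteq> {}" and B: "finite B" "B \<subseteq> pairs {1..}"
    and FB: "card (F \<inter> B) \<le> 1" and W: "edge_polynomial B W"
  shows "expectation (\<lambda>\<omega>. centred_product F \<omega> * W \<omega>) = 0"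
proof -
  have int: "integrable M (\<lambda>\<omega>. centred_product F \<omega> * f \<omega>)" if "edge_polynomial B f" for f
  proof (rule edge_polynomial_integrable)
    show "edge_polynomial (F \<union> B) (\<lambda>\<omega>. centred_product F \<omega> * f \<omega>)"
      using F B edge_polynomial_mono[OF edge_polynomial_centred_product[of F]] edge_polynomial_mono[OF that]
      by (intro edge_polynomial_mult) auto
  qed (use F B in auto)
  show ?thesis using W
  proof (induction rule: edge_polynomial.induct)
    case (monomial D)
    have "card (F \<inter> D) \<le> card (F \<inter> B)" using monomial F by (intro card_mono) auto
    then show ?case using monomial F B FB
      by (intro expectation_centred_product_monomial) (auto intro: finite_subset)
  next
    case (add f g)
    then show ?case using int by (simp add: distrib_left)
  next
    case (scale f c)
    have "(\<lambda>\<omega>. centred_product F \<omega> * (c * f \<omega>)) = (\<lambda>\<omega>. c * (centred_product F \<omega> * f \<omega>))" by (simp add: mult_ac)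
    then show ?case using scale by simp
  qed
qed

lemma copy_count_eq:
  assumes "\<omega> \<in> space M" "simple_graph H" "finite (verts H)"
  shows "copy_count H G n \<omega> = (\<Sum>S\<in>complete_copies H n. monomial (edges S) \<omega>)"
proof -
  have sub: "edges (G \<omega>) \<subseteq> pairs {1..}" using simple[OF assms(1)] verts_eq[OF assms(1)] by (simp add: simple_graph_def)
  have fin: "finite (edges S)" if "S \<in> complete_copies H n" for S
    using complete_copies_edges[OF that] by (rule finite_subset) (simp add: finite_pairs)
  have "copies H (induced_subgraph (G \<omega>) {1..n}) = {S \<in> complete_copies H n. edges S \<subseteq> edges (G \<omega>)}"
    using verts_eq[OF assms(1)] sub
    by (auto simp: copies_def subgraph_def complete_copies_def induced_subgraph_def pairs_def simple_graph_def)
  then have "copy_count H G n \<omega> = real (card {S \<in> complete_copies H n. edges S \<subseteq> edges (G \<omega>)})"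
    by (simp add: copy_count_def)
  also have "\<dots> = (\<Sum>S\<in>complete_copies H n. of_bool (edges S \<subseteq> edges (G \<omega>)))"
    by (simp add: sum_of_bool_eq finite_complete_copies Int_def)
  also have "\<dots> = (\<Sum>S\<in>complete_copies H n. monomial (edges S) \<omega>)"
    using fin by (intro sum.cong) (auto simp: monomial_eq_of_bool)
  finally show ?thesis .
qed

section \<open>The fourth moment of the remainder\<close>

definition remainder :: "'a graph \<Rightarrow> nat \<Rightarrow> 'w \<Rightarrow> real" where
  "remainder H n \<omega> = (\<Sum>S\<in>complete_copies H n. centred_product (edges S) \<omega>)"

lemma complete_copies_props:
  assumes H: "simple_graph H" "finite (verts H)" "edges H \<noteq> {}" and S: "S \<in> complete_copies H n"
  shows "card (verts S) = card (verts H)" "card (edges S) = card (edges H)" "finite (verts S)"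
    "finite (edges S)" "edges S \<noteq> {}" "edges S \<subseteq> pairs {1..}" "edges S \<subseteq> pairs {1..n}" "edges S \<subseteq> pairs (verts S)"
proof -
  have S': "simple_graph S" "verts S \<subseteq> {1..n}" "isomorphic S H" using S by (auto simp: complete_copies_iff)
  show "card (verts S) = card (verts H)" using S'(3) by (rule isomorphic_card_verts)
  show c: "card (edges S) = card (edges H)" using S' H by (intro isomorphic_card_edges)
  show "finite (verts S)" using S'(2) by (rule finite_subset) simp
  show e: "edges S \<subseteq> pairs {1..n}" by (rule complete_copies_edges[OF S])
  then show f: "finite (edges S)" by (rule finite_subset) (simp add: finite_pairs)
  show "edges S \<subseteq> pairs {1..}" using e pairs_mono[of "{1..n}" "{1..}"] by auto
  show "edges S \<subseteq> pairs (verts S)" using S'(1) by (simp add: simple_graph_def)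
  have "edges H \<subseteq> pairs (verts H)" using H(1) by (simp add: simple_graph_def)
  then have "finite (edges H)" by (rule finite_subset) (simp add: finite_pairs H)
  then have "card (edges H) > 0" using H(3) by (simp add: card_gt_0_iff)
  then show "edges S \<noteq> {}" using c by auto
qed

lemma edge_polynomial_remainder: "edge_polynomial (pairs {1..n}) (remainder H n)"
  unfolding remainder_def[abs_def]
  using edge_polynomial_mono[OF edge_polynomial_centred_product complete_copies_edges]
  by (intro edge_polynomial_sum)

lemma pairs_upto_subset: "pairs {1..n} \<subseteq> pairs {1::nat..}"
  by (rule pairs_mono) auto

text \<open>If each of the four copies met the others in three or more vertices, double counting
  would give 2 |W| + 12 \<le> 8 v for the union W of the vertex sets and the order v of
  \<open>H\<close>, that is |W| \<le> 4 v - 6. So some copy has at most two vertices in common with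
  the rest, and two vertices span at most one edge, which is what orthogonality requires.\<close>

lemma expectation_four_copies_eq_0:
  assumes H: "simple_graph H" "finite (verts H)" "edges H \<noteq> {}"
    and g: "\<And>i. i < 4 \<Longrightarrow> g i \<in> complete_copies H n"
    and large: "card (\<Union>i<4. verts (g i)) > 4 * card (verts H) - 6"
  shows "expectation (\<lambda>\<omega>. \<Prod>i<4::nat. centred_product (edges (g i)) \<omega>) = 0"
proof -
  note P = complete_copies_props[OF H g]
  have "\<exists>i<4. card (verts (g i) \<inter> (\<Union>j\<in>{..<4} - {i}. verts (g j))) < 3"
  proof (rule ccontr)
    assume "\<not> ?thesis"
    then have "3 \<le> card (verts (g i) \<inter> (\<Union>j\<in>{..<4} - {i}. verts (g j)))" if "i < 4" for i
      using that by (meson not_less)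
    then have "2 * card (\<Union>i\<in>{..<4}. verts (g i)) + 3 * card {..<4::nat} \<le> 2 * card (verts H) * card {..<4::nat}"
      using P(1,3) by (intro card_Union_of_overlapping_sets) (simp_all only: lessThan_iff finite_lessThan)
    then show False using large by simp
  qed
  then obtain i where i: "i < 4" "card (verts (g i) \<inter> (\<Union>j\<in>{..<4} - {i}. verts (g j))) < 3" by auto
  define B where "B = (\<Union>j\<in>{..<4} - {i}. edges (g j))"
  define U where "U = verts (g i) \<inter> (\<Union>j\<in>{..<4} - {i}. verts (g j))"
  have U: "finite U" "card U \<le> 2" using P(3)[OF i(1)] i(2) by (auto simp: U_def)
  have B: "finite B" "B \<subseteq> pairs {1..}" using P(4,6) by (auto simp: B_def)
  have "edges (g i) \<inter> B \<subseteq> pairs U"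
    using P(8) i(1) by (fastforce simp: B_def U_def pairs_def)
  then have "card (edges (g i) \<inter> B) \<le> card (pairs U)" using U by (intro card_mono finite_pairs)
  also have "\<dots> \<le> 2 choose 2" unfolding card_pairs[OF U(1)] using U(2) by (rule binomial_right_mono)
  finally have one: "card (edges (g i) \<inter> B) \<le> 1" by simp
  have "(\<lambda>\<omega>. \<Prod>i<4. centred_product (edges (g i)) \<omega>) =
      (\<lambda>\<omega>. centred_product (edges (g i)) \<omega> * (\<Prod>j\<in>{..<4} - {i}. centred_product (edges (g j)) \<omega>))"
    using i(1) by (intro ext prod.remove) auto
  moreover have "edge_polynomial B (\<lambda>\<omega>. \<Prod>j\<in>{..<4} - {i}. centred_product (edges (g j)) \<omega>)"
    by (intro edge_polynomial_prod B edge_polynomial_mono[OF edge_polynomial_centred_product]) (auto simp: B_def)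
  ultimately show ?thesis
    using expectation_centred_product_mult[OF P(4,6,5)[OF i(1)] B one] by simp
qed

text \<open>The vertices of a quadruple are enlarged to a set U of exactly u elements, which needs u
  \<le> n. Inside U each copy is an element of \<open>Pow U \<times> Pow (Pow U)\<close>, so the
  number of quadruples is bounded by a constant depending on u alone; only the choice of U depends
  on n.\<close>

lemma card_concentrated_copies_le:
  fixes u :: nat
  assumes "u \<le> n"
  shows "card {g \<in> {..<4::nat} \<rightarrow>\<^sub>E complete_copies H n. card (\<Union>i<4. verts (g i)) \<le> u}
    \<le> (n choose u) * (2 ^ u * 2 ^ (2 ^ u)) ^ 4"
proof -
  define \<U> where "\<U> = {U. U \<subseteq> {1..n} \<and> card U = u}"
  have fU: "finite \<U>" by (simp add: \<U>_def)
  have "{g \<in> {..<4::nat} \<rightarrow>\<^sub>E complete_copies H n. card (\<Union>i<4. verts (g i)) \<le> u} \<subseteq>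
      (\<Union>U\<in>\<U>. {..<4} \<rightarrow>\<^sub>E Pow U \<times> Pow (Pow U))"
  proof
    fix g assume g: "g \<in> {g \<in> {..<4::nat} \<rightarrow>\<^sub>E complete_copies H n. card (\<Union>i<4. verts (g i)) \<le> u}"
    define W where "W = (\<Union>i<4. verts (g i))"
    have gi: "g i \<in> complete_copies H n" if "i < 4" for i using g that by (auto simp: PiE_iff)
    have W: "W \<subseteq> {1..n}" "card W \<le> u" using g gi by (auto simp: W_def complete_copies_iff)
    obtain U where U: "W \<subseteq> U" "U \<subseteq> {1..n}" "card U = u"
      using exists_subset_between[of W u "{1..n}"] W assms by auto
    have "g i \<in> Pow U \<times> Pow (Pow U)" if "i < 4" for i
    proof -
      have "verts (g i) \<subseteq> U" using U(1) that by (auto simp: W_def)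
      moreover have "edges (g i) \<subseteq> Pow (verts (g i))"
        using gi[OF that] by (auto simp: complete_copies_iff simple_graph_def pairs_def)
      ultimately show ?thesis by (auto simp: mem_Times_iff)
    qed
    then show "g \<in> (\<Union>U\<in>\<U>. {..<4} \<rightarrow>\<^sub>E Pow U \<times> Pow (Pow U))"
      using U g by (auto simp: \<U>_def PiE_iff intro!: exI[of _ U])
  qed
  then have "card {g \<in> {..<4::nat} \<rightarrow>\<^sub>E complete_copies H n. card (\<Union>i<4. verts (g i)) \<le> u} \<le>
      card (\<Union>U\<in>\<U>. {..<4::nat} \<rightarrow>\<^sub>E Pow U \<times> Pow (Pow U))"
    using fU by (intro card_mono finite_UN_I finite_PiE) (auto simp: \<U>_def intro: finite_subset)
  also have "\<dots> \<le> (\<Sum>U\<in>\<U>. card ({..<4::nat} \<rightarrow>\<^sub>E Pow U \<times> Pow (Pow U)))" by (rule card_UN_le[OF fU])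
  also have "\<dots> = (\<Sum>U\<in>\<U>. (2 ^ u * 2 ^ (2 ^ u)) ^ 4)"
  proof (intro sum.cong refl)
    fix U assume "U \<in> \<U>"
    then have "finite U" "card U = u" by (auto simp: \<U>_def intro: finite_subset)
    then show "card ({..<4::nat} \<rightarrow>\<^sub>E Pow U \<times> Pow (Pow U)) = (2 ^ u * 2 ^ (2 ^ u)) ^ 4"
      by (simp add: card_PiE card_cartesian_product card_Pow)
  qed
  also have "\<dots> = (n choose u) * (2 ^ u * 2 ^ (2 ^ u)) ^ 4"
    unfolding \<U>_def by (simp add: n_subsets)
  finally show ?thesis .
qed

text \<open>The fourth power expands into a sum over quadruples of copies, each term being bounded
  independently of n; only the quadruples on few vertices have nonzero expectation, and their number
  gives the order.\<close>

lemma remainder_fourth_moment: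
  assumes H: "simple_graph H" "finite (verts H)" "edges H \<noteq> {}"
  shows "\<exists>K. \<forall>n. n \<ge> 4 * card (verts H) - 6 \<longrightarrow>
    expectation (\<lambda>\<omega>. remainder H n \<omega> ^ 4) \<le> K * real n ^ (4 * card (verts H) - 6)"
proof (intro exI allI impI)
  define u where "u = 4 * card (verts H) - 6"
  define c where "c = (real (card (edges H)) + 2) ^ 4"
  fix n assume n: "n \<ge> 4 * card (verts H) - 6"
  define Q where "Q = {..<4::nat} \<rightarrow>\<^sub>E complete_copies H n"
  define Q' where "Q' = {g \<in> Q. card (\<Union>i<4. verts (g i)) \<le> u}"
  have fQ: "finite Q" unfolding Q_def by (intro finite_PiE finite_complete_copies) auto
  have gi: "g i \<in> complete_copies H n" if "g \<in> Q" "i < 4" for g i using that by (auto simp: Q_def PiE_iff)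
  have poly: "edge_polynomial (pairs {1..n}) (\<lambda>\<omega>. \<Prod>i<4. centred_product (edges (g i)) \<omega>)" if "g \<in> Q" for g
    using complete_copies_edges[OF gi[OF that]]
    by (intro edge_polynomial_prod edge_polynomial_mono[OF edge_polynomial_centred_product]) (auto simp: finite_pairs)
  have int: "integrable M (\<lambda>\<omega>. \<Prod>i<4. centred_product (edges (g i)) \<omega>)" if "g \<in> Q" for g
    by (rule edge_polynomial_integrable[OF poly[OF that] pairs_upto_subset])
  have "remainder H n \<omega> ^ 4 = (\<Sum>g\<in>Q. \<Prod>i<4. centred_product (edges (g i)) \<omega>)" for \<omega>
  proof -
    have "remainder H n \<omega> ^ 4 = (\<Prod>i<4::nat. \<Sum>S\<in>complete_copies H n. centred_product (edges S) \<omega>)"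
      by (simp add: remainder_def)
    also have "\<dots> = (\<Sum>g\<in>Q. \<Prod>i<4. centred_product (edges (g i)) \<omega>)"
      unfolding Q_def by (rule prod_sum_PiE) (auto simp: finite_complete_copies)
    finally show ?thesis .
  qed
  then have "expectation (\<lambda>\<omega>. remainder H n \<omega> ^ 4) =
      (\<Sum>g\<in>Q. expectation (\<lambda>\<omega>. \<Prod>i<4. centred_product (edges (g i)) \<omega>))"
    using int by simp
  also have "\<dots> = (\<Sum>g\<in>Q'. expectation (\<lambda>\<omega>. \<Prod>i<4. centred_product (edges (g i)) \<omega>))"
  proof (rule sum.mono_neutral_right[OF fQ])
    show "\<forall>g\<in>Q - Q'. expectation (\<lambda>\<omega>. \<Prod>i<4. centred_product (edges (g i)) \<omega>) = 0"
      using gi by (intro ballI expectation_four_copies_eq_0[OF H]) (auto simp: Q'_def u_def not_le)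
  qed (auto simp: Q'_def)
  also have "\<dots> \<le> (\<Sum>g\<in>Q'. c)"
  proof (rule sum_mono)
    fix g assume g: "g \<in> Q'"
    then have gQ: "g \<in> Q" by (simp add: Q'_def)
    have "expectation (\<lambda>\<omega>. \<Prod>i<4. centred_product (edges (g i)) \<omega>) \<le> expectation (\<lambda>_. c)"
    proof (rule integral_mono[OF int[OF gQ]])
      fix \<omega>
      have "(\<Prod>i<4. centred_product (edges (g i)) \<omega>) \<le> \<bar>\<Prod>i<4. centred_product (edges (g i)) \<omega>\<bar>" by simp
      also have "\<dots> = (\<Prod>i<4. \<bar>centred_product (edges (g i)) \<omega>\<bar>)" by (rule abs_prod)
      also have "\<dots> \<le> (\<Prod>i<4::nat. real (card (edges H)) + 2)"
        using abs_centred_product_le[of "edges (g _)" \<omega>] complete_copies_props(2,4)[OF H gi[OF gQ]]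
        by (intro prod_mono) (metis abs_ge_zero lessThan_iff)
      finally show "(\<Prod>i<4. centred_product (edges (g i)) \<omega>) \<le> c" by (simp add: c_def)
    qed simp
    then show "expectation (\<lambda>\<omega>. \<Prod>i<4. centred_product (edges (g i)) \<omega>) \<le> c" by (simp add: prob_space)
  qed
  also have "\<dots> = c * real (card Q')" by simp
  also have "\<dots> \<le> c * real ((n choose u) * (2 ^ u * 2 ^ (2 ^ u)) ^ 4)"
    using card_concentrated_copies_le[of u n H] n unfolding Q'_def Q_def u_def c_def
    by (intro mult_left_mono of_nat_mono) auto
  also have "\<dots> \<le> c * (real n ^ u * ((2 ^ u * 2 ^ (2 ^ u)) ^ 4))"
  proof -
    have "n choose u \<le> n ^ u" using n unfolding u_def by (rule binomial_le_pow)
    then have "real (n choose u) \<le> real n ^ u" by (metis of_nat_le_iff of_nat_power)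
    then show ?thesis unfolding of_nat_mult of_nat_power of_nat_numeral c_def
      by (intro mult_left_mono mult_right_mono) auto
  qed
  finally show "expectation (\<lambda>\<omega>. remainder H n \<omega> ^ 4) \<le>
      ((real (card (edges H)) + 2) ^ 4 * (2 ^ (4 * card (verts H) - 6) * 2 ^ (2 ^ (4 * card (verts H) - 6))) ^ 4)
      * real n ^ (4 * card (verts H) - 6)"
    by (simp add: c_def u_def mult_ac)
qed

end

section \<open>The linear part and the remainder\<close>

text \<open>The preimage of any set under an indicator is the event, its complement, the whole space
  or empty, hence lies in the sigma-algebra generated by the event; independence of events passes to
  these sigma-algebras.\<close>

lemma (in prob_space) indep_vars_of_bool:
  assumes "indep_events (\<lambda>i. {\<omega> \<in> space M. P i \<omega>}) J"
  shows "indep_vars (\<lambda>_. borel) (\<lambda>i \<omega>. of_bool (P i \<omega>) :: real) J"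
  unfolding indep_vars_def2
proof (intro conjI ballI)
  fix i assume "i \<in> J"
  then have [measurable]: "{\<omega> \<in> space M. P i \<omega>} \<in> events" using assms by (auto simp: indep_events_def)
  show "random_variable borel (\<lambda>\<omega>. of_bool (P i \<omega>) :: real)" unfolding of_bool_def by measurable
next
  have "indep_sets (\<lambda>i. sigma_sets (space M) {{\<omega> \<in> space M. P i \<omega>}}) J"
    using assms unfolding indep_events_def_alt by (intro indep_sets_sigma) (auto simp: Int_stable_def)
  then show "indep_sets (\<lambda>i. {(\<lambda>\<omega>. of_bool (P i \<omega>) :: real) -` A \<inter> space M |A. A \<in> sets borel}) J"
  proof (rule indep_sets_mono_sets)
    fix i
    define E where "E = {\<omega> \<in> space M. P i \<omega>}"
    have "(\<lambda>\<omega>. of_bool (P i \<omega>) :: real) -` A \<inter> space M \<in> sigma_sets (space M) {E}" for A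
    proof -
      have "(\<lambda>\<omega>. of_bool (P i \<omega>) :: real) -` A \<inter> space M =
          (if 1 \<in> A then if 0 \<in> A then space M else E else if 0 \<in> A then space M - E else {})"
        by (auto simp: E_def of_bool_def split: if_splits)
      then show ?thesis
        by (auto intro: sigma_sets_top sigma_sets.Basic sigma_sets.Compl sigma_sets.Empty)
    qed
    then show "{(\<lambda>\<omega>. of_bool (P i \<omega>) :: real) -` A \<inter> space M |A. A \<in> sets borel}
        \<subseteq> sigma_sets (space M) {{\<omega> \<in> space M. P i \<omega>}}"
      by (auto simp: E_def)
  qed
qed

locale subgraph_counts = infinite_random_graph M p G
  for M :: "'w measure" and p :: real and G :: "'w \<Rightarrow> nat graph" +
  fixes H :: "'a graph"
  assumes p: "0 < p" "p < 1"
    and H: "simple_graph H" "finite (verts H)" "edges H \<noteq> {}"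
begin

definition s :: real where "s = sqrt (p * (1 - p))"

definition \<eta> :: "nat set \<Rightarrow> 'w \<Rightarrow> real" where
  "\<eta> e \<omega> = (\<xi> e \<omega> - p) / s"

lemma s_pos: "s > 0" and s_square: "s\<^sup>2 = p * (1 - p)"
  using p by (simp_all add: s_def)

lemma expectation_\<xi>: "e \<in> pairs {1..} \<Longrightarrow> expectation (\<xi> e) = p"
  using expectation_monomial[of "{e}"] by (simp add: monomial_singleton)

lemma integrable_\<xi>: "e \<in> pairs {1..} \<Longrightarrow> integrable M (\<xi> e)"
  using integrable_monomial[of "{e}"] by (simp add: monomial_singleton)

lemma expectation_\<xi>_centred_mult:
  assumes "e \<in> pairs {1..}" "e' \<in> pairs {1..}"
  shows "expectation (\<lambda>\<omega>. (\<xi> e \<omega> - p) * (\<xi> e' \<omega> - p)) = (if e = e' then s\<^sup>2 else 0)"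
proof -
  have sub: "{e, e'} \<subseteq> pairs {1..}" using assms by simp
  have "(\<lambda>\<omega>. (\<xi> e \<omega> - p) * (\<xi> e' \<omega> - p)) =
      (\<lambda>\<omega>. monomial {e, e'} \<omega> - p * \<xi> e \<omega> - p * \<xi> e' \<omega> + p * p)"
    using monomial_mult[of "{e}" "{e'}"] by (simp add: fun_eq_iff monomial_singleton algebra_simps insert_commute)
  then have "expectation (\<lambda>\<omega>. (\<xi> e \<omega> - p) * (\<xi> e' \<omega> - p)) =
      expectation (\<lambda>\<omega>. monomial {e, e'} \<omega> - p * \<xi> e \<omega> - p * \<xi> e' \<omega> + p * p)"
    by (simp only:)
  also have "\<dots> = p ^ card {e, e'} - p * p"
    using assms integrable_\<xi> integrable_monomial[OF sub] expectation_\<xi> expectation_monomial[OF _ sub]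
    by (simp add: prob_space)
  finally have eq: "expectation (\<lambda>\<omega>. (\<xi> e \<omega> - p) * (\<xi> e' \<omega> - p)) = p ^ card {e, e'} - p * p" .
  show ?thesis unfolding eq s_square by (simp add: power2_eq_square algebra_simps)
qed

lemma indep_\<xi>: "indep_vars (\<lambda>_. borel) \<xi> (pairs {1..})"
  using indep_vars_of_bool[OF indep_edges] by (simp add: \<xi>_def[abs_def])

sublocale bounded_independent_nested M \<eta> "pairs {1..}" "1 / s" "\<lambda>n. pairs {1..n}"
proof
  show "indep_vars (\<lambda>_. borel) \<eta> (pairs {1..})"
    unfolding \<eta>_def[abs_def] using indep_\<xi> by (rule indep_vars_compose2) simp
  show "\<bar>\<eta> e \<omega>\<bar> \<le> 1 / s" for e \<omega>
  proof -
    have "\<bar>\<xi> e \<omega> - p\<bar> \<le> 1" using \<xi>_bounds[of e \<omega>] p by linarith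
    then show ?thesis using s_pos by (simp add: \<eta>_def abs_divide divide_right_mono)
  qed
  show "expectation (\<eta> e) = 0" if "e \<in> pairs {1..}" for e
    unfolding \<eta>_def[abs_def] using that integrable_\<xi> expectation_\<xi> by (simp add: prob_space)
  show "expectation (\<lambda>\<omega>. (\<eta> e \<omega>)\<^sup>2) = 1" if "e \<in> pairs {1..}" for e
    using expectation_\<xi>_centred_mult[OF that that] s_pos by (simp add: \<eta>_def power_divide power2_eq_square)
  show "mono (\<lambda>n. pairs {1..n})" by (intro monoI pairs_mono) auto
  show "card (pairs {1..n}) = n choose 2" for n by (simp add: card_pairs)
  show "pairs {1..n} \<subseteq> pairs {1..}" for n :: nat by (rule pairs_upto_subset)
qed (simp add: finite_pairs)

section \<open>Decomposition of the copy count, its mean and variance\<close>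

definition Y :: "nat \<Rightarrow> 'w \<Rightarrow> real" where
  "Y n = T (pairs {1..n})"

text \<open>The coefficient common to all centred edge variables in the sum of the linear parts; the
  factor \<open>s\<close> undoes the normalisation in \<open>\<eta>\<close>.\<close>

definition slope :: "nat \<Rightarrow> real" where
  "slope n = edge_degree H n * p ^ (card (edges H) - 1) * s"

definition mean :: "nat \<Rightarrow> real" where
  "mean n = card (complete_copies H n) * p ^ card (edges H)"

lemma Y_eq: "Y n \<omega> = (\<Sum>e\<in>pairs {1..n}. \<xi> e \<omega> - p) / s"
  by (simp add: Y_def T_def \<eta>_def sum_divide_distrib)

text \<open>Double counting of incidences between copies and edges: in the sum of all linear parts
  each edge occurs once for every copy through it, and this number is the same for all
  edges.\<close>

lemma copy_count_decomposition:
  assumes "\<omega> \<in> space M"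
  shows "copy_count H G n \<omega> = mean n + (slope n * Y n \<omega> + remainder H n \<omega>)"
proof -
  let ?C = "complete_copies H n"
  have "(\<Sum>S\<in>?C. \<Sum>e\<in>edges S. \<xi> e \<omega> - p) =
      (\<Sum>S\<in>?C. \<Sum>e\<in>{e \<in> pairs {1..n}. e \<in> edges S}. \<xi> e \<omega> - p)"
    using complete_copies_edges[of _ H n] by (intro sum.cong) auto
  also have "\<dots> = (\<Sum>e\<in>pairs {1..n}. \<Sum>S\<in>{S \<in> ?C. e \<in> edges S}. \<xi> e \<omega> - p)"
    by (rule sum.swap_restrict) (auto simp: finite_complete_copies finite_pairs)
  also have "\<dots> = (\<Sum>e\<in>pairs {1..n}. edge_degree H n * (\<xi> e \<omega> - p))"
    by (intro sum.cong) (auto simp: card_copies_through_edge)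
  also have "\<dots> = edge_degree H n * (s * Y n \<omega>)"
    using s_pos by (simp only: sum_distrib_left[symmetric]) (simp add: Y_eq)
  finally have lin: "(\<Sum>S\<in>?C. \<Sum>e\<in>edges S. \<xi> e \<omega> - p) = edge_degree H n * (s * Y n \<omega>)" .
  have "copy_count H G n \<omega> = (\<Sum>S\<in>?C. monomial (edges S) \<omega>)"
    by (rule copy_count_eq[OF assms H(1,2)])
  also have "\<dots> = (\<Sum>S\<in>?C. p ^ card (edges H) +
      (p ^ (card (edges H) - 1) * (\<Sum>e\<in>edges S. \<xi> e \<omega> - p) + centred_product (edges S) \<omega>))"
    using complete_copies_props(2)[OF H] by (intro sum.cong) (auto simp: centred_product_def)
  also have "\<dots> = mean n + (p ^ (card (edges H) - 1) * (\<Sum>S\<in>?C. \<Sum>e\<in>edges S. \<xi> e \<omega> - p) + remainder H n \<omega>)"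
    unfolding sum.distrib sum_distrib_left mean_def remainder_def by simp
  finally show ?thesis by (simp add: lin slope_def mult_ac)
qed

lemma edge_polynomial_Y: "edge_polynomial (pairs {1..n}) (Y n)"
proof -
  have "edge_polynomial (pairs {1..n}) (\<lambda>\<omega>. (1 / s) * (\<Sum>e\<in>pairs {1..n}. \<xi> e \<omega> - p))"
    by (intro edge_polynomial.scale edge_polynomial_sum edge_polynomial_\<xi>)
  moreover have "(\<lambda>\<omega>. (1 / s) * (\<Sum>e\<in>pairs {1..n}. \<xi> e \<omega> - p)) = Y n"
    by (simp add: fun_eq_iff Y_eq)
  ultimately show ?thesis by (simp only:)
qed

lemma integrable_polynomials:
  assumes "edge_polynomial (pairs {1..n}) f" "edge_polynomial (pairs {1..n}) g"
  shows "integrable M f" "integrable M (\<lambda>\<omega>. f \<omega> * g \<omega>)"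
proof -
  show "integrable M f" by (rule edge_polynomial_integrable[OF assms(1) pairs_upto_subset])
  have "edge_polynomial (pairs {1..n}) (\<lambda>\<omega>. f \<omega> * g \<omega>)"
    by (intro edge_polynomial_mult assms) (simp add: finite_pairs)
  then show "integrable M (\<lambda>\<omega>. f \<omega> * g \<omega>)" by (rule edge_polynomial_integrable[OF _ pairs_upto_subset])
qed

lemma expectation_Y: "expectation (Y n) = 0"
  unfolding Y_def by (rule expectation_T[OF pairs_upto_subset])

lemma expectation_Y_square: "expectation (\<lambda>\<omega>. Y n \<omega> * Y n \<omega>) = real (n choose 2)"
proof -
  let ?P = "pairs {1..n}"
  have sub: "e \<in> pairs {1..}" if "e \<in> ?P" for e using that pairs_upto_subset by auto
  have int: "integrable M (\<lambda>\<omega>. (\<xi> e \<omega> - p) * (\<xi> e' \<omega> - p))" if "e \<in> ?P" "e' \<in> ?P" for e e'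
    using that by (intro integrable_polynomials(2) edge_polynomial_\<xi>)
  have "(\<lambda>\<omega>. Y n \<omega> * Y n \<omega>) = (\<lambda>\<omega>. (\<Sum>e\<in>?P. \<Sum>e'\<in>?P. (\<xi> e \<omega> - p) * (\<xi> e' \<omega> - p)) / s\<^sup>2)"
    by (simp add: fun_eq_iff Y_eq sum_product power2_eq_square)
  then have "expectation (\<lambda>\<omega>. Y n \<omega> * Y n \<omega>) =
      expectation (\<lambda>\<omega>. \<Sum>e\<in>?P. \<Sum>e'\<in>?P. (\<xi> e \<omega> - p) * (\<xi> e' \<omega> - p)) / s\<^sup>2"
    by (simp only: integral_divide_zero)
  also have "expectation (\<lambda>\<omega>. \<Sum>e\<in>?P. \<Sum>e'\<in>?P. (\<xi> e \<omega> - p) * (\<xi> e' \<omega> - p)) =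
      (\<Sum>e\<in>?P. expectation (\<lambda>\<omega>. \<Sum>e'\<in>?P. (\<xi> e \<omega> - p) * (\<xi> e' \<omega> - p)))"
    by (intro Bochner_Integration.integral_sum Bochner_Integration.integrable_sum int)
  also have "\<dots> = (\<Sum>e\<in>?P. \<Sum>e'\<in>?P. expectation (\<lambda>\<omega>. (\<xi> e \<omega> - p) * (\<xi> e' \<omega> - p)))"
    by (intro sum.cong refl Bochner_Integration.integral_sum int)
  also have "(\<Sum>e\<in>?P. \<Sum>e'\<in>?P. expectation (\<lambda>\<omega>. (\<xi> e \<omega> - p) * (\<xi> e' \<omega> - p))) = (\<Sum>e\<in>?P. \<Sum>e'\<in>?P. if e = e' then s\<^sup>2 else 0)"
    by (intro sum.cong refl expectation_\<xi>_centred_mult sub)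
  also have "\<dots> = real (n choose 2) * s\<^sup>2" by (simp add: finite_pairs card_pairs)
  finally show ?thesis using s_pos by simp
qed

lemma expectation_remainder: "expectation (remainder H n) = 0"
proof -
  have int: "integrable M (centred_product (edges S))" if "S \<in> complete_copies H n" for S
    by (rule edge_polynomial_integrable[OF edge_polynomial_centred_product]) (rule complete_copies_props[OF H that])
  have "expectation (centred_product (edges S)) = 0" if "S \<in> complete_copies H n" for S
    using expectation_centred_product_mult[of "edges S" "{}" "\<lambda>_. 1"] complete_copies_props[OF H that]
    by (simp add: edge_polynomial_const)
  then show ?thesis unfolding remainder_def[abs_def] using int by simp
qed

text \<open>Each centred product is orthogonal to every single centred edge variable, whether or not
  the edge belongs to the copy. Hence the variance of the count splits without a cross term.\<close>

lemma expectation_Y_remainder: "expectation (\<lambda>\<omega>. Y n \<omega> * remainder H n \<omega>) = 0"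
proof -
  let ?P = "pairs {1..n}" and ?C = "complete_copies H n"
  have int: "integrable M (\<lambda>\<omega>. centred_product (edges S) \<omega> * (\<xi> e \<omega> - p))" if "S \<in> ?C" "e \<in> ?P" for S e
    using that complete_copies_edges[of S H n]
    by (intro integrable_polynomials(2) edge_polynomial_\<xi> edge_polynomial_mono[OF edge_polynomial_centred_product]) auto
  have z: "expectation (\<lambda>\<omega>. centred_product (edges S) \<omega> * (\<xi> e \<omega> - p)) = 0" if "S \<in> ?C" "e \<in> ?P" for S e
  proof (rule expectation_centred_product_mult)
    have "card (edges S \<inter> {e}) \<le> card {e}" by (intro card_mono) auto
    then show "card (edges S \<inter> {e}) \<le> 1" by simp
    show "{e} \<subseteq> pairs {1..}" using that(2) pairs_upto_subset by auto
  qed (use complete_copies_props[OF H that(1)] in \<open>auto intro: edge_polynomial_\<xi>\<close>)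
  have "(\<lambda>\<omega>. Y n \<omega> * remainder H n \<omega>) =
      (\<lambda>\<omega>. (\<Sum>S\<in>?C. \<Sum>e\<in>?P. centred_product (edges S) \<omega> * (\<xi> e \<omega> - p)) / s)"
    unfolding sum_product[symmetric] Y_eq remainder_def by (simp add: fun_eq_iff mult.commute)
  then have "expectation (\<lambda>\<omega>. Y n \<omega> * remainder H n \<omega>) =
      expectation (\<lambda>\<omega>. \<Sum>S\<in>?C. \<Sum>e\<in>?P. centred_product (edges S) \<omega> * (\<xi> e \<omega> - p)) / s"
    by (simp only: integral_divide_zero)
  also have "expectation (\<lambda>\<omega>. \<Sum>S\<in>?C. \<Sum>e\<in>?P. centred_product (edges S) \<omega> * (\<xi> e \<omega> - p)) =
      (\<Sum>S\<in>?C. expectation (\<lambda>\<omega>. \<Sum>e\<in>?P. centred_product (edges S) \<omega> * (\<xi> e \<omega> - p)))"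
    by (intro Bochner_Integration.integral_sum Bochner_Integration.integrable_sum int)
  also have "\<dots> = (\<Sum>S\<in>?C. \<Sum>e\<in>?P. expectation (\<lambda>\<omega>. centred_product (edges S) \<omega> * (\<xi> e \<omega> - p)))"
    by (intro sum.cong refl Bochner_Integration.integral_sum int)
  also have "\<dots> = (\<Sum>S\<in>?C. \<Sum>e\<in>?P. 0)" by (intro sum.cong refl z)
  finally show ?thesis by simp
qed

lemma expectation_copy_count: "expectation (copy_count H G n) = mean n"
proof -
  have i: "integrable M (Y n)" "integrable M (remainder H n)"
    by (rule integrable_polynomials[OF edge_polynomial_Y edge_polynomial_Y],
        rule integrable_polynomials[OF edge_polynomial_remainder edge_polynomial_remainder])
  have "expectation (copy_count H G n) = expectation (\<lambda>\<omega>. mean n + (slope n * Y n \<omega> + remainder H n \<omega>))"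
    by (intro Bochner_Integration.integral_cong copy_count_decomposition refl)
  then show ?thesis using i by (simp add: expectation_Y expectation_remainder prob_space)
qed

lemma variance_copy_count:
  "variance (copy_count H G n) = (slope n)\<^sup>2 * real (n choose 2) + expectation (\<lambda>\<omega>. (remainder H n \<omega>)\<^sup>2)"
proof -
  have i: "integrable M (\<lambda>\<omega>. Y n \<omega> * Y n \<omega>)" "integrable M (\<lambda>\<omega>. Y n \<omega> * remainder H n \<omega>)"
    "integrable M (\<lambda>\<omega>. remainder H n \<omega> * remainder H n \<omega>)"
    by (rule integrable_polynomials(2)[OF edge_polynomial_Y edge_polynomial_Y],
        rule integrable_polynomials(2)[OF edge_polynomial_Y edge_polynomial_remainder],
        rule integrable_polynomials(2)[OF edge_polynomial_remainder edge_polynomial_remainder])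
  have "variance (copy_count H G n) = expectation (\<lambda>\<omega>. (slope n)\<^sup>2 * (Y n \<omega> * Y n \<omega>) +
      2 * slope n * (Y n \<omega> * remainder H n \<omega>) + remainder H n \<omega> * remainder H n \<omega>)"
    unfolding expectation_copy_count
    by (intro Bochner_Integration.integral_cong refl)
       (simp add: copy_count_decomposition power2_eq_square algebra_simps)
  also have "\<dots> = (slope n)\<^sup>2 * real (n choose 2) + expectation (\<lambda>\<omega>. remainder H n \<omega> * remainder H n \<omega>)"
    using i by (simp add: expectation_Y_square expectation_Y_remainder)
  finally show ?thesis by (simp add: power2_eq_square)
qed

text \<open>Writing the number of vertices as \<open>w + 2\<close> avoids truncated subtraction in the exponents.\<close>

definition w :: nat where "w = card (verts H) - 2"

lemma card_verts: "card (verts H) = w + 2"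
proof -
  obtain e where e: "e \<in> edges H" using H(3) by auto
  have "card e \<le> card (verts H)" using simple_graph_edgeD[OF H(1) e] H(2) by (intro card_mono)
  then show ?thesis using simple_graph_edgeD[OF H(1) e] by (simp add: w_def)
qed

section \<open>Orders of growth of the remainder and the linear part\<close>

lemma remainder_moment_bound:
  obtains K where "K \<ge> 0"
    "\<forall>\<^sub>F n in sequentially. expectation (\<lambda>\<omega>. remainder H n \<omega> ^ 4) \<le> K * real n ^ (4 * w + 2)"
proof -
  obtain K where K: "\<And>n. n \<ge> 4 * card (verts H) - 6 \<Longrightarrow>
      expectation (\<lambda>\<omega>. remainder H n \<omega> ^ 4) \<le> K * real n ^ (4 * card (verts H) - 6)"
    using remainder_fourth_moment[OF H] by blast
  have e: "4 * card (verts H) - 6 = 4 * w + 2" by (simp add: card_verts)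
  show thesis
  \<comment> \<open>The constant obtained above carries no sign, but a square root of it is taken
    later.\<close>
  proof (rule that[of "max K 0"])
    show "\<forall>\<^sub>F n in sequentially. expectation (\<lambda>\<omega>. remainder H n \<omega> ^ 4) \<le> max K 0 * real n ^ (4 * w + 2)"
      using eventually_ge_at_top[of "4 * w + 2"]
    proof eventually_elim
      case (elim n)
      have "expectation (\<lambda>\<omega>. remainder H n \<omega> ^ 4) \<le> K * real n ^ (4 * w + 2)" using K[of n] elim unfolding e by simp
      also have "\<dots> \<le> max K 0 * real n ^ (4 * w + 2)" by (intro mult_right_mono) auto
      finally show ?case .
    qed
  qed simp
qed

lemma remainder_powers_integrable:
  "integrable M (\<lambda>\<omega>. (remainder H n \<omega>)\<^sup>2)" "integrable M (\<lambda>\<omega>. remainder H n \<omega> ^ 4)"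
proof -
  have "edge_polynomial (pairs {1..n}) (\<lambda>\<omega>. \<Prod>i<k. remainder H n \<omega>)" for k :: nat
    by (intro edge_polynomial_prod edge_polynomial_remainder) (simp add: finite_pairs)
  then have "edge_polynomial (pairs {1..n}) (\<lambda>\<omega>. remainder H n \<omega> ^ k)" for k :: nat
    by (simp only: prod_constant card_lessThan)
  then have "integrable M (\<lambda>\<omega>. remainder H n \<omega> ^ k)" for k :: nat
    by (rule edge_polynomial_integrable[OF _ pairs_upto_subset])
  then show "integrable M (\<lambda>\<omega>. (remainder H n \<omega>)\<^sup>2)" "integrable M (\<lambda>\<omega>. remainder H n \<omega> ^ 4)" by auto
qed

text \<open>Markov's inequality for the fourth power: the exponents 4 w + 2 of the moment and 4 (w +
  1) of the level differ by 2, which leaves a summable bound for each fixed \<epsilon>. The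
  remainder is thus negligible even before dividing by the iterated logarithm.\<close>

lemma remainder_negligible_AE:
  "AE \<omega> in M. (\<lambda>n. remainder H n \<omega> / real n ^ (w + 1)) \<longlonglongrightarrow> 0"
proof -
  obtain K where K: "K \<ge> 0"
    "\<forall>\<^sub>F n in sequentially. expectation (\<lambda>\<omega>. remainder H n \<omega> ^ 4) \<le> K * real n ^ (4 * w + 2)"
    by (rule remainder_moment_bound)
  have [measurable]: "remainder H n \<in> borel_measurable M" for n
    by (rule borel_measurable_integrable[OF edge_polynomial_integrable[OF edge_polynomial_remainder pairs_upto_subset]])
  have one: "AE \<omega> in M. \<forall>\<^sub>F n in sequentially. \<bar>remainder H n \<omega> / real n ^ (w + 1)\<bar> < \<epsilon>" if \<epsilon>: "\<epsilon> > 0" for \<epsilon> :: real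
  proof -
    define A where "A n = {\<omega> \<in> space M. (\<epsilon> * real n ^ (w + 1)) ^ 4 \<le> remainder H n \<omega> ^ 4}" for n
    have A[measurable]: "A n \<in> events" for n unfolding A_def by measurable
    have "\<forall>\<^sub>F n in sequentially. norm (prob (A n)) \<le> K / \<epsilon> ^ 4 * (1 / real n ^ 2)"
      using K(2) eventually_gt_at_top[of 0]
    proof eventually_elim
      case (elim n)
      have "prob (A n) \<le> expectation (\<lambda>\<omega>. remainder H n \<omega> ^ 4) / (\<epsilon> * real n ^ (w + 1)) ^ 4"
        unfolding A_def using remainder_powers_integrable(2) elim(2) \<epsilon>
        by (intro integral_Markov_inequality_measure[where A="{}"]) auto
      also have "\<dots> \<le> K * real n ^ (4 * w + 2) / (\<epsilon> * real n ^ (w + 1)) ^ 4"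
        using elim \<epsilon> by (intro divide_right_mono) auto
      also have "(\<epsilon> * real n ^ (w + 1)) ^ 4 = \<epsilon> ^ 4 * (real n ^ (4 * w + 2) * real n ^ 2)"
      proof -
        have "(real n ^ (w + 1)) ^ 4 = real n ^ ((w + 1) * 4)" by (rule power_mult[symmetric])
        also have "(w + 1) * 4 = (4 * w + 2) + 2" by simp
        finally show ?thesis by (simp only: power_mult_distrib power_add[symmetric])
      qed
      also have "K * real n ^ (4 * w + 2) / \<dots> = K / \<epsilon> ^ 4 * (1 / real n ^ 2)"
        using elim(2) \<epsilon> by (simp add: field_simps)
      finally show ?case by simp
    qed
    moreover have "summable (\<lambda>n. K / \<epsilon> ^ 4 * (1 / real n ^ 2))"
      using inverse_power_summable[of 2, where 'a=real] by (intro summable_mult) (simp add: inverse_eq_divide)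
    ultimately have "summable (\<lambda>n. prob (A n))" by (rule summable_comparison_test_ev)
    then have "AE \<omega> in M. \<forall>\<^sub>F n in sequentially. \<omega> \<in> space M - A n"
      by (intro borel_cantelli_AE1 A) (auto simp: emeasure_eq_measure)
    then show ?thesis
    proof eventually_elim
      case (elim \<omega>)
      then show ?case using eventually_gt_at_top[of 0]
      proof eventually_elim
        case (elim n)
        have "\<bar>remainder H n \<omega>\<bar> < \<epsilon> * real n ^ (w + 1)"
        proof (rule ccontr)
          assume "\<not> ?thesis"
          then have "(\<epsilon> * real n ^ (w + 1)) ^ 4 \<le> \<bar>remainder H n \<omega>\<bar> ^ 4" using \<epsilon> by (intro power_mono) auto
          then show False using elim by (simp add: A_def power_even_abs)
        qed
        then show ?case using elim(2) by (simp add: abs_divide divide_less_eq)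
      qed
    qed
  qed
  have "AE \<omega> in M. \<forall>j. \<forall>\<^sub>F n in sequentially. \<bar>remainder H n \<omega> / real n ^ (w + 1)\<bar> < inverse (real (Suc j))"
    by (intro AE_all_countable[THEN iffD2] allI one) simp
  then show ?thesis
  proof eventually_elim
    case (elim \<omega>)
    show ?case
    proof (rule tendstoI)
      fix e :: real assume "e > 0"
      then obtain j where j: "inverse (real (Suc j)) < e" using reals_Archimedean by blast
      show "\<forall>\<^sub>F n in sequentially. dist (remainder H n \<omega> / real n ^ (w + 1)) 0 < e"
        using elim[rule_format, of j] by eventually_elim (use j in simp)
    qed
  qed
qed

definition linear_sd :: "nat \<Rightarrow> real" where
  "linear_sd n = slope n * sqrt (n choose 2)"

text \<open>The degree contributes order n^w through the binomial coefficient n - 2 over w, and the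
  square root of n choose 2 one further power of n.\<close>

lemma linear_sd_lower_bound:
  obtains c where "c > 0" "\<forall>\<^sub>F n in sequentially. c * real n ^ (w + 1) \<le> linear_sd n"
proof -
  define q where "q = p ^ (card (edges H) - 1) * s"
  \<comment> \<open>The 2 comes from n \<le> 2 (n - 2), and w + 1 replaces w so that the case w = 0
    involves no division by zero. The last factor comes from n choose 2 being at least
    (n/2)^2.\<close>
  define c where "c = (1 / (2 * real (w + 1))) ^ w * q * (1 / 2)"
  have q: "q > 0" using p s_pos by (simp add: q_def)
  have "\<forall>\<^sub>F n in sequentially. c * real n ^ (w + 1) \<le> linear_sd n"
    using eventually_ge_at_top[of "w + 4"]
  proof eventually_elim
    case (elim n)
    have "(real n * (1 / (2 * real (w + 1)))) ^ w \<le> real ((n - 2) choose w)"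
    proof (cases "w = 0")
      case False
      have "real n * (1 / (2 * real (w + 1))) \<le> real (n - 2) / real w"
      proof -
        have "real n * real w \<le> (2 * real (n - 2)) * real (w + 1)" using elim by (intro mult_mono) auto
        then show ?thesis using False by (simp add: field_simps)
      qed
      then have "(real n * (1 / (2 * real (w + 1)))) ^ w \<le> (real (n - 2) / real w) ^ w"
        by (intro power_mono) auto
      also have "\<dots> \<le> real ((n - 2) choose w)" using elim by (intro binomial_ge_n_over_k_pow_k) auto
      finally show ?thesis .
    qed simp
    also have "\<dots> \<le> edge_degree H n"
      using edge_degree_ge[OF H, of n] elim by (simp add: card_verts)
    finally have 1: "(real n * (1 / (2 * real (w + 1)))) ^ w * q \<le> slope n"
      unfolding slope_def mult.assoc q_def[symmetric] using q by (intro mult_right_mono) auto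
    have "(real n / 2)\<^sup>2 \<le> real (n choose 2)"
    proof -
      have "real n * (real n / 2) \<le> real n * (real n - 1)" using elim by (intro mult_left_mono) auto
      then show ?thesis by (simp add: real_choose_2 power2_eq_square)
    qed
    then have 2: "real n / 2 \<le> sqrt (n choose 2)" by (rule real_le_rsqrt)
    have "((real n * (1 / (2 * real (w + 1)))) ^ w * q) * (real n / 2) \<le> linear_sd n"
      unfolding linear_sd_def using q by (intro mult_mono[OF 1 2] order.trans[OF _ 1]) auto
    also have "((real n * (1 / (2 * real (w + 1)))) ^ w * q) * (real n / 2) = c * real n ^ (w + 1)"
      unfolding c_def power_mult_distrib by simp
    finally show ?case .
  qed
  moreover have "c > 0" using q by (simp add: c_def)
  ultimately show thesis by (rule that[rotated])
qed

text \<open>The second moment needs no separate count of pairs: its square is at most the fourth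
  moment, because the variance of the squared remainder is nonnegative. This gives n^(2w+1) against
  n^(2w+2).\<close>

lemma remainder_variance_negligible:
  "(\<lambda>n. expectation (\<lambda>\<omega>. (remainder H n \<omega>)\<^sup>2) / (linear_sd n)\<^sup>2) \<longlonglongrightarrow> 0"
proof -
  obtain K where K: "K \<ge> 0"
    "\<forall>\<^sub>F n in sequentially. expectation (\<lambda>\<omega>. remainder H n \<omega> ^ 4) \<le> K * real n ^ (4 * w + 2)"
    by (rule remainder_moment_bound)
  obtain c where c: "c > 0" "\<forall>\<^sub>F n in sequentially. c * real n ^ (w + 1) \<le> linear_sd n"
    by (rule linear_sd_lower_bound)
  have ev: "\<forall>\<^sub>F n in sequentially. norm (expectation (\<lambda>\<omega>. (remainder H n \<omega>)\<^sup>2) / (linear_sd n)\<^sup>2) \<le> sqrt K / c\<^sup>2 * (1 / real n)"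
    using K(2) c(2) eventually_gt_at_top[of 0]
  proof eventually_elim
    case (elim n)
    define r where "r = expectation (\<lambda>\<omega>. (remainder H n \<omega>)\<^sup>2)"
    have r0: "r \<ge> 0" unfolding r_def by (rule Bochner_Integration.integral_nonneg) simp
    have "variance (\<lambda>\<omega>. (remainder H n \<omega>)\<^sup>2) = expectation (\<lambda>\<omega>. remainder H n \<omega> ^ 4) - r\<^sup>2"
      using remainder_powers_integrable[of n] by (subst variance_eq) (simp_all add: r_def)
    then have "r\<^sup>2 \<le> expectation (\<lambda>\<omega>. remainder H n \<omega> ^ 4)"
      using variance_positive[of "\<lambda>\<omega>. (remainder H n \<omega>)\<^sup>2"] by linarith
    also have "\<dots> \<le> K * real n ^ (4 * w + 2)" by (rule elim(1))
    also have "4 * w + 2 = (2 * w + 1) * 2" by simp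
    also have "real n ^ ((2 * w + 1) * 2) = (real n ^ (2 * w + 1))\<^sup>2" by (rule power_mult)
    finally have "sqrt (r\<^sup>2) \<le> sqrt (K * (real n ^ (2 * w + 1))\<^sup>2)" by (rule real_sqrt_le_mono)
    then have r: "r \<le> sqrt K * real n ^ (2 * w + 1)" using r0 by (simp add: real_sqrt_mult)
    have "(c * real n ^ (w + 1))\<^sup>2 \<le> (linear_sd n)\<^sup>2" using elim c(1) by (intro power_mono) auto
    moreover have "(c * real n ^ (w + 1))\<^sup>2 = c\<^sup>2 * (real n ^ (2 * w + 1) * real n)"
    proof -
      have "(real n ^ (w + 1))\<^sup>2 = real n ^ ((w + 1) * 2)" by (rule power_mult[symmetric])
      also have "(w + 1) * 2 = Suc (2 * w + 1)" by simp
      finally show ?thesis by (simp only: power_mult_distrib power_Suc2)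
    qed
    ultimately have sd: "c\<^sup>2 * (real n ^ (2 * w + 1) * real n) \<le> (linear_sd n)\<^sup>2" by simp
    have "r / (linear_sd n)\<^sup>2 \<le> (sqrt K * real n ^ (2 * w + 1)) / (c\<^sup>2 * (real n ^ (2 * w + 1) * real n))"
      using r r0 sd elim(3) c(1) K(1) by (intro frac_le) auto
    also have "\<dots> = sqrt K / c\<^sup>2 * (1 / real n)" using elim(3) c(1) by (simp add: field_simps)
    finally show ?case using r0 by (simp add: r_def)
  qed
  have "(\<lambda>n. sqrt K / c\<^sup>2 * (1 / real n)) \<longlonglongrightarrow> 0" by real_asymp
  then show ?thesis by (rule Lim_null_comparison[OF ev])
qed

text \<open>The true standard deviation is \<open>linear_sd n * sqrt (1 + \<rho> n)\<close> with
  \<rho> tending to 0. The ratio therefore equals a factor tending to 1 times the ratio for the edge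
  count plus a null sequence, and neither changes the upper limit.\<close>

theorem copy_count_lil:
  "AE \<omega> in M. limsup (\<lambda>n. ereal ((copy_count H G n \<omega> - mean n) /
     (sqrt (variance (copy_count H G n)) * sqrt (2 * ln (ln (real n)))))) = 1"
proof -
  obtain c where c: "c > 0" "\<forall>\<^sub>F n in sequentially. c * real n ^ (w + 1) \<le> linear_sd n"
    by (rule linear_sd_lower_bound)
  have sd_pos: "\<forall>\<^sub>F n in sequentially. linear_sd n > 0"
    using c(2) eventually_gt_at_top[of 0]
  proof eventually_elim
    case (elim n)
    have "0 < c * real n ^ (w + 1)" using c(1) elim by simp
    then show ?case using elim by linarith
  qed
  define \<rho> where "\<rho> n = expectation (\<lambda>\<omega>. (remainder H n \<omega>)\<^sup>2) / (linear_sd n)\<^sup>2" for n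
  have \<rho>0: "\<rho> n \<ge> 0" for n unfolding \<rho>_def by (intro divide_nonneg_nonneg Bochner_Integration.integral_nonneg) auto
  have ratio: "(\<lambda>n. 1 / sqrt (1 + \<rho> n)) \<longlonglongrightarrow> 1"
  proof -
    have "(\<lambda>n. 1 / sqrt (1 + \<rho> n)) \<longlonglongrightarrow> 1 / sqrt (1 + 0)"
      unfolding \<rho>_def by (intro tendsto_intros remainder_variance_negligible) auto
    then show ?thesis by simp
  qed
  have sd: "sqrt (variance (copy_count H G n)) = linear_sd n * sqrt (1 + \<rho> n)" if "linear_sd n > 0" for n
  proof -
    have "variance (copy_count H G n) = (linear_sd n)\<^sup>2 * (1 + \<rho> n)"
      using that by (simp add: variance_copy_count \<rho>_def distrib_left) (simp add: linear_sd_def power_mult_distrib)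
    then show ?thesis using that by (simp add: real_sqrt_mult)
  qed
  show ?thesis
    using law_of_iterated_logarithm remainder_negligible_AE AE_space
  proof eventually_elim
    case (elim \<omega>)
    define a where "a n = remainder H n \<omega> / linear_sd n * (1 / sqrt (2 * ln (ln (real n))))" for n
    have "(\<lambda>n. remainder H n \<omega> / linear_sd n) \<longlonglongrightarrow> 0"
    proof (rule Lim_null_comparison)
      show "\<forall>\<^sub>F n in sequentially. norm (remainder H n \<omega> / linear_sd n) \<le>
          1 / c * norm (remainder H n \<omega> / real n ^ (w + 1))"
        using c(2) eventually_gt_at_top[of 0]
      proof eventually_elim
        case (elim n)
        have "\<bar>remainder H n \<omega>\<bar> / linear_sd n \<le> \<bar>remainder H n \<omega>\<bar> / (c * real n ^ (w + 1))"
          using elim c(1) by (intro frac_le) auto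
        moreover have "0 < linear_sd n" using elim c(1) by (intro less_le_trans[OF _ elim(1)]) auto
        ultimately show ?case by (simp add: abs_divide)
      qed
      show "(\<lambda>n. 1 / c * norm (remainder H n \<omega> / real n ^ (w + 1))) \<longlonglongrightarrow> 0"
        by (rule tendsto_mult_right_zero[OF tendsto_norm_zero[OF elim(2)]])
    qed
    moreover have "(\<lambda>n::nat. 1 / sqrt (2 * ln (ln (real n)))) \<longlonglongrightarrow> 0" by real_asymp
    ultimately have a: "a \<longlonglongrightarrow> 0" unfolding a_def using tendsto_mult_zero by blast
    have LL: "\<forall>\<^sub>F n::nat in sequentially. 0 < ln (ln (real n))" by real_asymp
    have "limsup (\<lambda>n. ereal ((copy_count H G n \<omega> - mean n) /
        (sqrt (variance (copy_count H G n)) * sqrt (2 * ln (ln (real n)))))) =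
      limsup (\<lambda>n. ereal (1 / sqrt (1 + \<rho> n)) * (ereal (a n) + ereal (T (pairs {1..n}) \<omega> / lil_scale n)))"
    proof (rule Limsup_eq)
      show "\<forall>\<^sub>F n in sequentially. ereal ((copy_count H G n \<omega> - mean n) /
          (sqrt (variance (copy_count H G n)) * sqrt (2 * ln (ln (real n))))) =
        ereal (1 / sqrt (1 + \<rho> n)) * (ereal (a n) + ereal (T (pairs {1..n}) \<omega> / lil_scale n))"
        using sd_pos LL eventually_ge_at_top[of 2]
      proof eventually_elim
        case (elim n)
        define L where "L = sqrt (2 * ln (ln (real n)))"
        have L: "L > 0" using elim(2) by (simp add: L_def)
        have N: "sqrt (n choose 2) > 0" using elim(3) by simp
        have sl: "slope n > 0" using elim(1) N by (simp add: linear_sd_def zero_less_mult_iff)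
        have sc: "lil_scale n = sqrt (n choose 2) * L" by (simp add: lil_scale_def L_def real_sqrt_mult)
        have t: "sqrt (1 + \<rho> n) > 0" using \<rho>0[of n] by simp
        have "(copy_count H G n \<omega> - mean n) / (sqrt (variance (copy_count H G n)) * L) =
            (slope n * Y n \<omega> + remainder H n \<omega>) / (linear_sd n * sqrt (1 + \<rho> n) * L)"
          using copy_count_decomposition[OF \<open>\<omega> \<in> space M\<close>] sd[OF elim(1)] by simp
        also have "\<dots> = (1 / sqrt (1 + \<rho> n)) * (remainder H n \<omega> / linear_sd n * (1 / L) + slope n * Y n \<omega> / (linear_sd n * L))"
          using elim(1) L t by (simp add: field_simps)
        also have "slope n * Y n \<omega> / (linear_sd n * L) = T (pairs {1..n}) \<omega> / lil_scale n"
          using sl N L by (simp add: sc linear_sd_def Y_def)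
        finally show ?case by (simp add: a_def L_def)
      qed
    qed
    also have "\<dots> = 1 * (0 + limsup (\<lambda>n. ereal (T (pairs {1..n}) \<omega> / lil_scale n)))"
    proof (subst ereal_limsup_lim_mult)
      show "(\<lambda>n. ereal (1 / sqrt (1 + \<rho> n))) \<longlonglongrightarrow> 1" using ratio by (simp add: one_ereal_def)
      show "1 * limsup (\<lambda>n. ereal (a n) + ereal (T (pairs {1..n}) \<omega> / lil_scale n)) =
          1 * (0 + limsup (\<lambda>n. ereal (T (pairs {1..n}) \<omega> / lil_scale n)))"
        using a by (subst ereal_limsup_lim_add[where a=0]) (auto simp: zero_ereal_def)
    qed auto
    also have "\<dots> = 1" using elim(1) by simp
    finally show ?case .
  qed
qed

lemma measurable_copy_count: "copy_count H G n \<in> borel_measurable M"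
proof -
  have "(\<lambda>\<omega>. \<Sum>S\<in>complete_copies H n. monomial (edges S) \<omega>) \<in> borel_measurable M"
    using complete_copies_props(6)[OF H] by (intro borel_measurable_sum measurable_monomial)
  then show ?thesis by (subst measurable_cong[OF copy_count_eq[OF _ H(1,2)]])
qed

end

theorem theorem1p3:
  fixes M :: "'w measure" and p :: real and G :: "'w \<Rightarrow> nat graph" and H :: "'a graph"
    and X :: "nat \<Rightarrow> 'w \<Rightarrow> real" and \<mu> \<sigma> :: "nat \<Rightarrow> real"
  assumes "0 < p" and "p < 1"
    and "infinite_random_graph M p G"
    and "simple_graph H" and "finite (verts H)" and "edges H \<noteq> {}"
    and "\<And>n. X n = copy_count H G n"
    and "\<And>n. \<mu> n = prob_space.expectation M (X n)"
    and "\<And>n. \<sigma> n = sqrt (prob_space.variance M (X n))"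
  shows "measure M {\<omega> \<in> space M.
           limsup (\<lambda>n. ereal ((X n \<omega> - \<mu> n) / (\<sigma> n * sqrt (2 * ln (ln (real n)))))) = 1} = 1"
proof -
  interpret subgraph_counts M p G H
    by (intro subgraph_counts.intro subgraph_counts_axioms.intro assms)
  \<comment> \<open>Needed to turn the almost sure statement into a probability: the set in question
    has to be an event.\<close>
  have [measurable]: "X n \<in> borel_measurable M" for n
    using measurable_copy_count assms(7) by simp
  have "AE \<omega> in M. limsup (\<lambda>n. ereal ((X n \<omega> - \<mu> n) / (\<sigma> n * sqrt (2 * ln (ln (real n)))))) = 1"
    using copy_count_lil by (simp add: assms(7-9) expectation_copy_count)
  then show ?thesis
    by (subst prob_Collect_eq_1) measurable
qed

end
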